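(* The functions $$\tilde f^{(1)}_{l,m,n}(Z)=\begin{pmatrix}t^{l+\frac12}_{m\,\underline{n+\frac12}}(Z^{-1})\\-t^{l+\frac12}_{m\,\underline{n-\frac12}}(Z^{-1})\end{pmatrix},\quad m=-l-\tfrac12,\dots,l+\tfrac12,\ \ n=-l,\dots,l,$$ $$\tilde f^{(2)}_{l,m,n}(Z)=\begin{pmatrix}(l-n)N(Z)^{-1}t^{l-\frac12}_{m\,\underline{n+\frac12}}(Z^{-1})\\(l+n)N(Z)^{-1}t^{l-\frac12}_{m\,\underline{n-\frac12}}(Z^{-1})\end{pmatrix},\quad m=-l+\tfrac12,\dots,l-\tfrac12,\ \ n=-l,\dots,l,$$ $$\tilde f^{(3)}_{l,m,n}(Z)=\begin{pmatrix}N(Z)^{-1}t^{l-\frac12}_{m\,\underline{n+\frac12}}(Z^{-1})\\-N(Z)^{-1}t^{l-\frac12}_{m\,\underline{n-\frac12}}(Z^{-1})\end{pmatrix},\quad m=-l+\tfrac12,-l+\tfrac32,\dots,l-\tfrac12,\ \ n=-l+1,\dots,l-1,$$ span respectively the $V_l\boxtimes V_{l+\frac12}$, $V_l\boxtimes V_{l-\frac12}$ and $V_{l-1}\boxtimes V_{l-\frac12}$ components of ${\cal U}(-2l-1)$, $l=0,\frac12,1,\frac32,\dots$. The functions $$\tilde g^{(1)}_{l,m,n}(Z)=\bigl((l+m+1)t^{l+\frac12}_{m+\frac12\,\underline n}(Z^{-1}),\,-(l-m+1)t^{l+\frac12}_{m-\frac12\,\underline n}(Z^{-1})\bigr),\quad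 m=-l,\dots,l,\ \ n=-l-\tfrac12,\dots,l+\tfrac12,$$ $$\tilde g^{(2)}_{l,m,n}(Z)=N(Z)^{-1}\bigl(t^{l-\frac12}_{m+\frac12\,\underline n}(Z^{-1}),\,t^{l-\frac12}_{m-\frac12\,\underline n}(Z^{-1})\bigr),\quad m=-l,\dots,l,\ \ n=-l+\tfrac12,\dots,l-\tfrac12,$$ $$\tilde g^{(3)}_{l,m,n}(Z)=N(Z)^{-1}\bigl((l+m)t^{l-\frac12}_{m+\frac12\,\underline n}(Z^{-1}),\,-(l-m)t^{l-\frac12}_{m-\frac12\,\underline n}(Z^{-1})\bigr),\quad m=-l+1,\dots,l-1,\ \ n=-l+\tfrac12,\dots,l-\tfrac12,$$ span respectively the $V_{l+\frac12}\boxtimes V_l$, $V_{l-\frac12}\boxtimes V_l$ and $V_{l-\frac12}\boxtimes V_{l-1}$ components of ${\cal U}'(-2l-1)$, $l=0,\frac12,1,\frac32,\dots$.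
   Context: $\mathbb H_{\mathbb C}=\mathbb C\otimes_{\mathbb R}\mathbb H$ is identified with $2\times2$ complex matrices $Z=\bigl(\begin{smallmatrix}z_{11}&z_{12}\\ z_{21}&z_{22}\end{smallmatrix}\bigr)=z^0e_0+z^1e_1+z^2e_2+z^3e_3$, with $e_0=1$, $e_1=\bigl(\begin{smallmatrix}0&-i\\-i&0\end{smallmatrix}\bigr)$, $e_2=\bigl(\begin{smallmatrix}0&-1\\1&0\end{smallmatrix}\bigr)$, $e_3=\bigl(\begin{smallmatrix}-i&0\\0&i\end{smallmatrix}\bigr)$; $N(Z)=\det Z$; $\operatorname{Re}A=\frac12\operatorname{Tr}A$. $\mathbb S$, $\mathbb S'$ are the spaces of complex $2$-columns and $2$-rows. For $l=0,\frac12,1,\dots$, $m,n\in\mathbb Z+l$, $-l\le m,n\le l$: $t^l_{n\,\underline m}(Z)=\frac1{2\pi i}\oint(sz_{11}+z_{21})^{l-m}(sz_{12}+z_{22})^{l+m}s^{-l+n}\frac{ds}s$ (counterclockwise loop around $0$); $t^l_{n\,\underline m}=0$ when an index is out of range. All the indices $m,n$ in the claim advance in steps of $1$. $\nabla=e_0\partial_{z^0}-e_1\partial_{z^1}-e_2\partial_{z^2}-e_3\partial_{z^3}$, $\square=\sum_j\partial_{z^j}^2$, $g\overleftarrow\nabla$ is $\nabla$ acting from the right. ${\cal U}=\{f\in\mathbb C[z^0,z^1,z^2,z^3,N(Z)^{-1}]\otimes\mathbb S;\nabla\square f=0\}$, ${\cal U}'=\{g\in\mathbb C[z^0,z^1,z^2,z^3,N(Z)^{-1}]\otimes\mathbb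 S';(\square g)\overleftarrow\nabla=0\}$; ${\cal U}(d)$, ${\cal U}'(d)$ are their subspaces of functions homogeneous of degree $d$. $\mathfrak{gl}(2,\mathbb H_{\mathbb C})$ acts by differentiating $(\pi'_l(h)f)(Z)=\frac{a'-Zc'}{N(a'-Zc')}f\bigl((a'-Zc')^{-1}(-b'+Zd')\bigr)$ on ${\cal U}$ and $(\pi'_r(h)g)(Z)=g\bigl((aZ+b)(cZ+d)^{-1}\bigr)\frac{cZ+d}{N(cZ+d)}$ on ${\cal U}'$, $h=\bigl(\begin{smallmatrix}a'&b'\\ c'&d'\end{smallmatrix}\bigr)$, $h^{-1}=\bigl(\begin{smallmatrix}a&b\\ c&d\end{smallmatrix}\bigr)$. Under $\mathfrak{sl}(2,\mathbb C)\times\mathfrak{sl}(2,\mathbb C)=\{\bigl(\begin{smallmatrix}A&0\\0&D\end{smallmatrix}\bigr);\operatorname{Re}A=\operatorname{Re}D=0\}$ one has ${\cal U}(-2l-1)=(V_l\boxtimes V_{l+\frac12})\oplus(V_l\boxtimes V_{l-\frac12})\oplus(V_{l-1}\boxtimes V_{l-\frac12})$ and ${\cal U}'(-2l-1)=(V_{l+\frac12}\boxtimes V_l)\oplus(V_{l-\frac12}\boxtimes V_l)\oplus(V_{l-\frac12}\boxtimes V_{l-1})$, where $V_l$ is the irreducible $\mathfrak{sl}(2,\mathbb C)$-module of dimension $2l+1$ ($V_j=0$ for $j<0$), the first factor being acted on by $A$ and the second by $D$. *)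

theory Defs
  imports "HOL-Complex_Analysis.Contour_Integration" "HOL-Library.Function_Algebras"
begin

type_synonym hc = "complex^2^2"

definition hscale :: "complex \<Rightarrow> hc \<Rightarrow> hc" where
  "hscale c Z = (\<chi> i j. c * Z $ i $ j)"

definition qe :: "nat \<Rightarrow> hc" where
  "qe p = (if p = 0 then vector [vector [1, 0], vector [0, 1]]
           else if p = 1 then vector [vector [0, - \<i>], vector [- \<i>, 0]]
           else if p = 2 then vector [vector [0, - 1], vector [1, 0]]
           else vector [vector [- \<i>, 0], vector [0, \<i>]])"

definition coord :: "nat \<Rightarrow> hc \<Rightarrow> complex" where
  "coord p Z = (if p = 0 then (Z $ 1 $ 1 + Z $ 2 $ 2) / 2
                else if p = 1 then \<i> * (Z $ 1 $ 2 + Z $ 2 $ 1) / 2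
                else if p = 2 then (Z $ 2 $ 1 - Z $ 1 $ 2) / 2
                else \<i> * (Z $ 1 $ 1 - Z $ 2 $ 2) / 2)"

lemma coord_expansion: "Z = (\<Sum>p<4. hscale (coord p Z) (qe p))"
proof -
  have set4: "{..<4} = {0, 1, 2, 3 :: nat}" by auto
  have ii: "\<i> * (\<i> * x) = - x" "\<i> * (x * \<i>) = - x" for x
    by (simp_all add: complex_eq_iff)
  show ?thesis
    unfolding set4 by (simp add: vec_eq_iff forall_2 hscale_def qe_def coord_def ii field_simps)
qed

text \<open>
  Functions on the invertible elements of \<open>\<bbbH>\<^sub>\<complex>\<close> are represented by total functions that vanish
  where \<open>N(Z) = det Z\<close> vanishes, so that equality of functions on the invertible elements is
  equality in HOL.
\<close>

definition ext0 :: "(hc \<Rightarrow> 'a::zero) \<Rightarrow> hc \<Rightarrow> 'a" where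
  "ext0 f Z = (if det Z = 0 then 0 else f Z)"

text \<open>The algebra \<open>\<complex>[z\<^sup>0, z\<^sup>1, z\<^sup>2, z\<^sup>3, N(Z)\<^sup>-\<^sup>1]\<close>:\<close>

inductive_set laurent :: "(hc \<Rightarrow> complex) set" where
  const: "ext0 (\<lambda>Z. c) \<in> laurent"
| coord: "p < 4 \<Longrightarrow> ext0 (coord p) \<in> laurent"
| inv_norm: "ext0 (\<lambda>Z. 1 / det Z) \<in> laurent"
| add: "f \<in> laurent \<Longrightarrow> g \<in> laurent \<Longrightarrow> (\<lambda>Z. f Z + g Z) \<in> laurent"
| mult: "f \<in> laurent \<Longrightarrow> g \<in> laurent \<Longrightarrow> (\<lambda>Z. f Z * g Z) \<in> laurent"

text \<open>
  Both columns (\<open>\<bbbS>\<close>) and rows (\<open>\<bbbS>'\<close>) are elements of \<^typ>\<open>complex^2\<close>; matrices act on columns by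
  \<open>*v\<close> and on rows by \<open>v*\<close>.
\<close>

type_synonym field2 = "hc \<Rightarrow> complex^2"

definition pd :: "nat \<Rightarrow> field2 \<Rightarrow> field2" where
  "pd p f = ext0 (\<lambda>Z. \<chi> i. deriv (\<lambda>w. f (Z + hscale w (qe p)) $ i) 0)"

definition qe_conj :: "nat \<Rightarrow> hc" where
  "qe_conj p = (if p = 0 then qe p else - qe p)"

definition nabla_left :: "field2 \<Rightarrow> field2" where
  "nabla_left f Z = (\<Sum>p<4. qe_conj p *v pd p f Z)"

definition nabla_right :: "field2 \<Rightarrow> field2" where
  "nabla_right g Z = (\<Sum>p<4. pd p g Z v* qe_conj p)"

definition laplace :: "field2 \<Rightarrow> field2" where
  "laplace f Z = (\<Sum>p<4. pd p (pd p f) Z)"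

definition homogeneous :: "int \<Rightarrow> field2 \<Rightarrow> bool" where
  "homogeneous d f \<longleftrightarrow> (\<forall>c Z. c \<noteq> 0 \<longrightarrow> f (hscale c Z) = (c powi d) *s f Z)"

definition U_left :: "field2 set" where
  "U_left = {f. (\<forall>i. (\<lambda>Z. f Z $ i) \<in> laurent) \<and> nabla_left (laplace f) = (\<lambda>Z. 0)}"

definition U_right :: "field2 set" where
  "U_right = {g. (\<forall>i. (\<lambda>Z. g Z $ i) \<in> laurent) \<and> nabla_right (laplace g) = (\<lambda>Z. 0)}"

definition U_left_deg :: "int \<Rightarrow> field2 set" where
  "U_left_deg d = {f \<in> U_left. homogeneous d f}"

definition U_right_deg :: "int \<Rightarrow> field2 set" where
  "U_right_deg d = {g \<in> U_right. homogeneous d g}"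

text \<open>Elements of \<open>\<gg>\<ll>(2, \<bbbH>\<^sub>\<complex>)\<close> are \<open>4 \<times> 4\<close> complex matrices, indexed so as to consist of four blocks.\<close>

type_synonym gl2hc = "complex^(2 + 2)^(2 + 2)"

definition block11 :: "gl2hc \<Rightarrow> hc" where "block11 h = (\<chi> i j. h $ Inl i $ Inl j)"
definition block12 :: "gl2hc \<Rightarrow> hc" where "block12 h = (\<chi> i j. h $ Inl i $ Inr j)"
definition block21 :: "gl2hc \<Rightarrow> hc" where "block21 h = (\<chi> i j. h $ Inr i $ Inl j)"
definition block22 :: "gl2hc \<Rightarrow> hc" where "block22 h = (\<chi> i j. h $ Inr i $ Inr j)"

definition block_diag :: "hc \<Rightarrow> hc \<Rightarrow> gl2hc" where
  "block_diag A D = (\<chi> r s. case (r, s) of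
      (Inl i, Inl j) \<Rightarrow> A $ i $ j
    | (Inr i, Inr j) \<Rightarrow> D $ i $ j
    | _ \<Rightarrow> 0)"

definition pi_left :: "gl2hc \<Rightarrow> field2 \<Rightarrow> field2" where
  "pi_left h f Z =
    (let a' = block11 h; b' = block12 h; c' = block21 h; d' = block22 h; M = a' - Z ** c'
     in (1 / det M) *s (M *v f (matrix_inv M ** (- b' + Z ** d'))))"

definition pi_right :: "gl2hc \<Rightarrow> field2 \<Rightarrow> field2" where
  "pi_right h g Z =
    (let k = matrix_inv h; a = block11 k; b = block12 k; c = block21 k; d = block22 k;
         M = c ** Z + d
     in (1 / det M) *s (g ((a ** Z + b) ** matrix_inv M) v* M))"

text \<open>
  The differentiated actions: the derivative at the identity, in the direction \<open>X\<close>, of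
  \<open>h \<mapsto> \<pi>(h) f\<close>. The curve \<open>1 + t X\<close> has the same tangent vector at \<open>t = 0\<close> as \<open>exp (t X)\<close>.
\<close>

definition dpi_left :: "gl2hc \<Rightarrow> field2 \<Rightarrow> field2" where
  "dpi_left X f Z =
    (\<chi> i. deriv (\<lambda>t. pi_left (mat 1 + (\<chi> r s. t * X $ r $ s)) f Z $ i) 0)"

definition dpi_right :: "gl2hc \<Rightarrow> field2 \<Rightarrow> field2" where
  "dpi_right X g Z =
    (\<chi> i. deriv (\<lambda>t. pi_right (mat 1 + (\<chi> r s. t * X $ r $ s)) g Z $ i) 0)"

definition sl2 :: "hc set" where
  "sl2 = {A. trace A / 2 = 0}"

type_synonym cseq = "nat \<Rightarrow> complex"

definition seq_scale :: "complex \<Rightarrow> cseq \<Rightarrow> cseq" where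
  "seq_scale c v = (\<lambda>i. c * v i)"

definition tensor_scale :: "complex \<Rightarrow> (nat \<Rightarrow> cseq) \<Rightarrow> (nat \<Rightarrow> cseq)" where
  "tensor_scale c v = (\<lambda>i j. c * v i j)"

definition field_scale :: "complex \<Rightarrow> field2 \<Rightarrow> field2" where
  "field_scale c f = (\<lambda>Z. c *s f Z)"

lemma vector_space_seq_scale: "vector_space seq_scale"
  by unfold_locales (auto simp: seq_scale_def fun_eq_iff algebra_simps)

lemma vector_space_tensor_scale: "vector_space tensor_scale"
  by unfold_locales (auto simp: tensor_scale_def fun_eq_iff algebra_simps)

lemma vector_space_field_scale: "vector_space field_scale"
  by unfold_locales (auto simp: field_scale_def fun_eq_iff vec_eq_iff algebra_simps)

definition sl2_module :: "cseq set \<Rightarrow> (hc \<Rightarrow> cseq \<Rightarrow> cseq) \<Rightarrow> bool" where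
  "sl2_module V \<rho> \<longleftrightarrow>
     module.subspace seq_scale V \<and>
     (\<forall>A\<in>sl2. \<forall>v\<in>V. \<rho> A v \<in> V) \<and>
     (\<forall>A\<in>sl2. \<forall>c. \<forall>v\<in>V. \<forall>w\<in>V. \<rho> A (seq_scale c v + w) = seq_scale c (\<rho> A v) + \<rho> A w) \<and>
     (\<forall>A\<in>sl2. \<forall>B\<in>sl2. \<forall>c. \<forall>v\<in>V. \<rho> (hscale c A + B) v = seq_scale c (\<rho> A v) + \<rho> B v) \<and>
     (\<forall>A\<in>sl2. \<forall>B\<in>sl2. \<forall>v\<in>V. \<rho> (A ** B - B ** A) v = \<rho> A (\<rho> B v) - \<rho> B (\<rho> A v))"

definition irreducible_sl2_module :: "cseq set \<Rightarrow> (hc \<Rightarrow> cseq \<Rightarrow> cseq) \<Rightarrow> bool" where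
  "irreducible_sl2_module V \<rho> \<longleftrightarrow>
     sl2_module V \<rho> \<and> V \<noteq> {0} \<and>
     (\<forall>S. module.subspace seq_scale S \<and> S \<subseteq> V \<and> (\<forall>A\<in>sl2. \<forall>v\<in>S. \<rho> A v \<in> S)
          \<longrightarrow> S = {0} \<or> S = V)"

text \<open>
  \<open>(V, \<rho>)\<close> is a realisation of \<open>V\<^sub>j\<close>, the irreducible module of dimension \<open>2 j + 1\<close> (zero for
  \<open>j < 0\<close>). Every finite-dimensional module has a realisation inside \<^typ>\<open>cseq\<close>.
\<close>

definition is_V :: "real \<Rightarrow> cseq set \<Rightarrow> (hc \<Rightarrow> cseq \<Rightarrow> cseq) \<Rightarrow> bool" where
  "is_V j V \<rho> \<longleftrightarrow>
     (if j < 0 then sl2_module V \<rho> \<and> V = {0}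
      else irreducible_sl2_module V \<rho> \<and> real (vector_space.dim seq_scale V) = 2 * j + 1)"

definition pure_tensor :: "cseq \<Rightarrow> cseq \<Rightarrow> (nat \<Rightarrow> cseq)" where
  "pure_tensor v w = (\<lambda>i j. v i * w j)"

definition tensor_space :: "cseq set \<Rightarrow> cseq set \<Rightarrow> (nat \<Rightarrow> cseq) set" where
  "tensor_space V W = module.span tensor_scale {pure_tensor v w | v w. v \<in> V \<and> w \<in> W}"

text \<open>
  \<open>iso_box act j k M\<close>: the space \<open>M\<close>, with \<open>(A, D) \<in> \<ss>\<ll>(2,\<complex>) \<times> \<ss>\<ll>(2,\<complex>)\<close> acting by
  \<open>act (block_diag A D)\<close>, is an \<open>\<ss>\<ll>(2,\<complex>) \<times> \<ss>\<ll>(2,\<complex>)\<close>-module isomorphic to the external tensor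
  product of \<open>V\<^sub>j\<close> (acted on by \<open>A\<close>) and \<open>V\<^sub>k\<close> (acted on by \<open>D\<close>).
\<close>

definition iso_box :: "(gl2hc \<Rightarrow> field2 \<Rightarrow> field2) \<Rightarrow> real \<Rightarrow> real \<Rightarrow> field2 set \<Rightarrow> bool" where
  "iso_box act j k M \<longleftrightarrow>
     (\<exists>V \<rho> W \<sigma> \<phi>. is_V j V \<rho> \<and> is_V k W \<sigma> \<and>
        Vector_Spaces.linear tensor_scale field_scale \<phi> \<and>
        bij_betw \<phi> (tensor_space V W) M \<and>
        (\<forall>A\<in>sl2. \<forall>D\<in>sl2. \<forall>v\<in>V. \<forall>w\<in>W.
           act (block_diag A D) (\<phi> (pure_tensor v w)) =
             \<phi> (pure_tensor (\<rho> A v) w + pure_tensor v (\<sigma> D w))))"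

text \<open>
  \<open>M\<close> is the internal direct sum of submodules \<open>M1\<close>, \<open>M2\<close>, \<open>M3\<close> of the types \<open>V\<^sub>j \<boxtimes> V\<^sub>k\<close> given by the
  three pairs \<open>(j, k)\<close>.
\<close>

definition sl2sl2_components ::
  "(gl2hc \<Rightarrow> field2 \<Rightarrow> field2) \<Rightarrow> field2 set \<Rightarrow> real \<times> real \<Rightarrow> real \<times> real \<Rightarrow> real \<times> real \<Rightarrow>
   field2 set \<Rightarrow> field2 set \<Rightarrow> field2 set \<Rightarrow> bool" where
  "sl2sl2_components act M \<tau>1 \<tau>2 \<tau>3 M1 M2 M3 \<longleftrightarrow>
     iso_box act (fst \<tau>1) (snd \<tau>1) M1 \<and>
     iso_box act (fst \<tau>2) (snd \<tau>2) M2 \<and>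
     iso_box act (fst \<tau>3) (snd \<tau>3) M3 \<and>
     bij_betw (\<lambda>(x, y, z). x + y + z) (M1 \<times> M2 \<times> M3) M"

definition cspan :: "field2 set \<Rightarrow> field2 set" where
  "cspan = module.span field_scale"

definition tcoef :: "real \<Rightarrow> real \<Rightarrow> real \<Rightarrow> hc \<Rightarrow> complex" where
  "tcoef l n m Z =
    (if 2 * l \<in> \<nat> \<and> l - m \<in> \<int> \<and> l - n \<in> \<int> \<and> \<bar>m\<bar> \<le> l \<and> \<bar>n\<bar> \<le> l then
       1 / (2 * of_real pi * \<i>) *
       contour_integral (circlepath 0 1)
         (\<lambda>s. (s * Z $ 1 $ 1 + Z $ 2 $ 1) ^ nat \<lfloor>l - m\<rfloor> *
              (s * Z $ 1 $ 2 + Z $ 2 $ 2) ^ nat \<lfloor>l + m\<rfloor> *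
              s powi \<lfloor>- l + n\<rfloor> / s)
     else 0)"

definition steps :: "real \<Rightarrow> real \<Rightarrow> real set" where
  "steps a b = {a + real i | i. a + real i \<le> b}"

definition ft1 :: "real \<Rightarrow> real \<Rightarrow> real \<Rightarrow> field2" where
  "ft1 l m n = ext0 (\<lambda>Z. vector
     [tcoef (l + 1/2) m (n + 1/2) (matrix_inv Z),
      - tcoef (l + 1/2) m (n - 1/2) (matrix_inv Z)])"

definition ft2 :: "real \<Rightarrow> real \<Rightarrow> real \<Rightarrow> field2" where
  "ft2 l m n = ext0 (\<lambda>Z. vector
     [of_real (l - n) * (1 / det Z) * tcoef (l - 1/2) m (n + 1/2) (matrix_inv Z),
      of_real (l + n) * (1 / det Z) * tcoef (l - 1/2) m (n - 1/2) (matrix_inv Z)])"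

definition ft3 :: "real \<Rightarrow> real \<Rightarrow> real \<Rightarrow> field2" where
  "ft3 l m n = ext0 (\<lambda>Z. vector
     [(1 / det Z) * tcoef (l - 1/2) m (n + 1/2) (matrix_inv Z),
      - ((1 / det Z) * tcoef (l - 1/2) m (n - 1/2) (matrix_inv Z))])"

definition gt1 :: "real \<Rightarrow> real \<Rightarrow> real \<Rightarrow> field2" where
  "gt1 l m n = ext0 (\<lambda>Z. vector
     [of_real (l + m + 1) * tcoef (l + 1/2) (m + 1/2) n (matrix_inv Z),
      - (of_real (l - m + 1) * tcoef (l + 1/2) (m - 1/2) n (matrix_inv Z))])"

definition gt2 :: "real \<Rightarrow> real \<Rightarrow> real \<Rightarrow> field2" where
  "gt2 l m n = ext0 (\<lambda>Z. (1 / det Z) *s vector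
     [tcoef (l - 1/2) (m + 1/2) n (matrix_inv Z),
      tcoef (l - 1/2) (m - 1/2) n (matrix_inv Z)])"

definition gt3 :: "real \<Rightarrow> real \<Rightarrow> real \<Rightarrow> field2" where
  "gt3 l m n = ext0 (\<lambda>Z. (1 / det Z) *s vector
     [of_real (l + m) * tcoef (l - 1/2) (m + 1/2) n (matrix_inv Z),
      - (of_real (l - m) * tcoef (l - 1/2) (m - 1/2) n (matrix_inv Z))])"

end

theory Submission
  imports Defs "HOL-Computational_Algebra.Fundamental_Theorem_Algebra"
    "HOL-Complex_Analysis.Cauchy_Integral_Formula"
begin

text \<open>
  Put \<open>k = 2l\<close>, \<open>x = s z\<^sub>2\<^sub>2 - z\<^sub>2\<^sub>1\<close> and \<open>y = z\<^sub>1\<^sub>1 - s z\<^sub>1\<^sub>2\<close>, so that \<open>(x, y) = (s, 1) adj(Z)\<close> with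
  \<open>adj(Z) = N(Z) Z\<^sup>-\<^sup>1\<close>. The contour integral extracts a coefficient of a polynomial in \<open>s\<close>, hence
  \<open>t\<^sup>l\<^sub>n\<^sub>m(Z\<^sup>-\<^sup>1)\<close> is \<open>N(Z)\<^sup>-\<^sup>2\<^sup>l\<close> times the coefficient of \<open>s\<^sup>l\<^sup>-\<^sup>n\<close> in \<open>x\<^sup>l\<^sup>-\<^sup>m y\<^sup>l\<^sup>+\<^sup>m\<close> (\<open>tcoef_inverse\<close>). The three
  families of columns in the theorem are therefore instances of just two families, indexed by
  integers \<open>p\<close>, \<open>i\<close> and naturals \<open>a\<close>, \<open>b\<close>: the coefficients \<open>F1 p a b i\<close> of \<open>s\<^sup>i\<close> in
  \<open>N\<^sup>p x\<^sup>a y\<^sup>b (y, - x)\<^sup>T\<close> and \<open>F2 p a b i\<close> of \<open>s\<^sup>i\<close> in \<open>N\<^sup>p (\<partial>\<^sub>x, \<partial>\<^sub>y)\<^sup>T (x\<^sup>a y\<^sup>b)\<close>.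

  \<^bold>\<open>The solution space.\<close> Multiplication by an entry of \<open>Z\<close> maps the coefficients of \<open>x\<^sup>a y\<^sup>b\<close> to
  combinations of such coefficients and their multiples by \<open>N(Z)\<close>. This Clebsch-Gordan
  rule shows that \<open>F1\<close> and \<open>F2\<close> span all Laurent columns (\<open>laurent_fields_span\<close>).
  Writing \<open>n = a + b\<close>, these functions are homogeneous of degrees \<open>2p + n + 1\<close> and \<open>2p + n - 1\<close>, and they
  are eigenvectors of \<open>N(Z) Z \<nabla>\<box>\<close> with eigenvalues \<open>8 p (p + n + 2) (p + n + 1)\<close> and
  \<open>8 p (p - 1) (p + n)\<close> (\<open>symbol3_F1\<close>, \<open>symbol3_F2\<close>). An element of \<open>U(-k-1)\<close> is a joint eigenvector
  of the Euler operator and of \<open>N(Z) Z \<nabla>\<box>\<close>, so it is a combination of those \<open>F1\<close>, \<open>F2\<close> that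
  have degree \<open>- k - 1\<close> and eigenvalue \<open>0\<close>. Solving the two equations leaves exactly \<open>F1\<close> with
  \<open>p = - k - 1\<close>, \<open>n = k\<close>; \<open>F2\<close> with \<open>p = - k\<close>, \<open>n = k\<close>; and \<open>F1\<close> with \<open>p = - k\<close>, \<open>n = k - 2\<close>
  (\<open>U_left_deg_span\<close>). These are the three families of the theorem.

  \<^bold>\<open>The module structure.\<close> The matrix \<open>A\<close> acts on the pair \<open>(x, y)\<close>, that is on the index \<open>a\<close>, as on
  binary forms of degree \<open>n\<close>; the matrix \<open>D\<close> acts on the powers of \<open>s\<close>, that is on the index \<open>i\<close>.
  After division by binomial coefficients the second action has the same shape, with \<open>D\<close> replaced
  by \<open>- D\<^sup>T\<close>. Functions with different \<open>(a, i)\<close> have different weights and none of them is zero, so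
  each family spans a copy of the expected tensor product (\<open>iso_box_family\<close>).

  \<^bold>\<open>Uniqueness.\<close> On \<open>V\<^sub>i \<boxtimes> V\<^sub>j\<close> the Casimir elements of the two factors act by \<open>4 i (i + 1)\<close> and
  \<open>4 j (j + 1)\<close> (\<open>casimir_irreducible\<close>). These pairs of scalars distinguish the three types as
  far as these are non-zero, so that the components are the joint eigenspaces, for whatever decomposition into modules of these
  types is given (\<open>casimir_separates\<close>).

  \<^bold>\<open>Rows.\<close> The substitution \<open>Z \<mapsto> Z\<^sup>T\<close> maps \<open>U\<close> to \<open>U'\<close> and exchanges the two factors of the Lie algebra
  up to \<open>A \<mapsto> - A\<^sup>T\<close> (\<open>dpi_right_transp\<close>). The polynomial \<open>(x u + y)\<^sup>n\<close> is unchanged if \<open>s\<close> and \<open>u\<close> are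
  interchanged and \<open>Z\<close> is transposed; comparing coefficients, the rows of the theorem
  are non-zero multiples of the transposed columns (\<open>F1_transpose\<close>, \<open>F2_transpose\<close>).
\<close>

section \<open>Eigenvectors in complex vector spaces\<close>

text \<open>
  The eigenspace of an operator for the eigenvalue \<open>\<mu>\<close> is spanned by the members with
  eigenvalue \<open>\<mu>\<close> of any spanning set of eigenvectors; \<open>B\<close> may be linearly dependent, and the operator is linear on its span only.
  The induction removes one \<open>b \<in> t\<close> at a time: if the eigenvalue of \<open>b\<close> is not \<open>\<mu>\<close>, then applying
  \<open>T - ev b\<close> to \<open>x\<close> removes the \<open>b\<close>-component and multiplies \<open>x\<close> by a non-zero number.
\<close>

lemma (in vector_space) eigen_span:
  assumes f: "f \<in> span B" and Tf: "T f = scale \<mu> f"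
    and lin: "\<And>x y c. x \<in> span B \<Longrightarrow> y \<in> span B \<Longrightarrow> T (scale c x + y) = scale c (T x) + T y"
    and "\<And>b. b \<in> B \<Longrightarrow> \<exists>\<nu>. T b = scale \<nu> b"
  shows "f \<in> span {b \<in> B. T b = scale \<mu> b}"
proof -
  obtain ev where ev: "\<And>b. b \<in> B \<Longrightarrow> T b = scale (ev b) b"
    using assms(4) by metis
  have T0: "T 0 = 0"
    using lin[of 0 0 1] by (simp add: span_zero)
  have "x \<in> span t \<and> T x \<in> span t" if "t \<subseteq> B" "x \<in> span t" for t x
    using that(2)
  proof (induction rule: span_induct_alt)
    case base
    then show ?case by (simp add: T0 span_zero)
  next
    case (step c x y)
    have xs: "x \<in> B" "x \<in> span B" "y \<in> span B" "T x = scale (ev x) x"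
      using step(1,2) that(1) subsetD[OF span_mono[OF that(1)], of y]
      by (auto intro: span_base ev)
    show ?case
      unfolding lin[OF xs(2,3)] xs(4)
      using step by (auto intro!: span_add span_scale intro: span_base)
  qed
  then have inv: "T x \<in> span t" if "t \<subseteq> B" "x \<in> span t" for t x
    using that by blast
  obtain t where t: "finite t" "t \<subseteq> B" "f \<in> span t"
    using f unfolding span_explicit by (auto intro: span_sum span_scale span_base)
  have "x \<in> span {b \<in> t. ev b = \<mu>}" if "T x = scale \<mu> x" "x \<in> span t" for x
    using t(1,2) that
  proof (induction t arbitrary: x rule: finite_induct)
    case empty
    then show ?case by (simp add: span_zero)
  next
    case (insert b t)
    then obtain c where c: "x - scale c b \<in> span t"
      using span_breakdown_eq[of x b t] by auto
    have tB: "t \<subseteq> B" "b \<in> B" "b \<in> span B" and xB: "x \<in> span B"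
      using insert.prems(1,3) span_mono[OF insert.prems(1)] by (auto intro: span_base)
    have Tx': "T (x - scale c b) = scale \<mu> x - scale (c * ev b) b"
      using lin[OF tB(3) xB, of "- c"] ev[OF tB(2)] insert.prems(2) by simp
    show ?case
    proof (cases "ev b = \<mu>")
      case True
      then have "T (x - scale c b) = scale \<mu> (x - scale c b)"
        using Tx' by (simp add: scale_right_diff_distrib mult.commute)
      from insert.IH[OF tB(1) this c] have "x - scale c b \<in> span {a \<in> insert b t. ev a = \<mu>}"
        by (rule subsetD[OF span_mono, rotated]) blast
      from span_add[OF this, of "scale c b"] show ?thesis
        using True by (simp add: span_scale span_base)
    next
      case False
      have "T (x - scale c b) - scale (ev b) (x - scale c b) = scale (\<mu> - ev b) x"
        unfolding Tx' by (simp add: scale_right_diff_distrib scale_left_diff_distrib mult.commute)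
      then have "scale (\<mu> - ev b) x \<in> span t"
        using inv[OF tB(1) c] c span_diff span_scale by metis
      then have "scale (inverse (\<mu> - ev b)) (scale (\<mu> - ev b) x) \<in> span t"
        by (rule span_scale)
      then have "x \<in> span t"
        using False by simp
      from insert.IH[OF tB(1) insert.prems(2) this] show ?thesis
        by (rule subsetD[OF span_mono, rotated]) blast
    qed
  qed
  from this[OF Tf t(3)] show ?thesis
    by (rule subsetD[OF span_mono, rotated]) (use t(2) ev in auto)
qed

lemma (in vector_space) eigenvector_not_in_span:
  assumes T: "\<And>i. i \<in> I \<Longrightarrow> T (u i) = scale (ev i) (u i)" "T x = scale \<mu> x"
    and lin: "\<And>x y c. x \<in> span (u ` I) \<Longrightarrow> y \<in> span (u ` I) \<Longrightarrow>
      T (scale c x + y) = scale c (T x) + T y"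
    and "x \<noteq> 0" "\<And>i. i \<in> I \<Longrightarrow> ev i \<noteq> \<mu>"
  shows "x \<notin> span (u ` I)"
proof
  assume "x \<in> span (u ` I)"
  then have "x \<in> span {b \<in> u ` I. T b = scale \<mu> b}"
    using T by (intro eigen_span lin) auto
  moreover have "{b \<in> u ` I. T b = scale \<mu> b} \<subseteq> {0}"
    using assms by auto
  ultimately have "x \<in> span {0}"
    using span_mono by blast
  then show False
    using assms(4) by simp
qed

lemma (in vector_space) independent_sequence:
  fixes u :: "nat \<Rightarrow> 'b"
  assumes "\<And>i. i < d \<Longrightarrow> u i \<notin> span (u ` {..<i})"
  shows "independent (u ` {..<d}) \<and> card (u ` {..<d}) = d"
  using assms
proof (induction d)
  case (Suc d)
  moreover have "u d \<notin> u ` {..<d}"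
    using Suc.prems[of d] span_base[of "u d" "u ` {..<d}"] by auto
  ultimately show ?case
    by (auto simp: lessThan_Suc independent_insert)
qed (simp add: independent_empty)

lemma (in vector_space) first_dependent_power:
  assumes "finite B" and "\<And>i. u i \<in> span B"
  shows "\<exists>d::nat. u d \<in> span (u ` {..<d})"
proof (rule ccontr)
  assume neg: "\<not> ?thesis"
  then have "independent (u ` {..<d}) \<and> card (u ` {..<d}) = d" for d
    by (intro independent_sequence) blast
  then have "Suc (card B) \<le> card B"
    using independent_span_bound[of B "u ` {..<Suc (card B)}"] assms by auto
  then show False by simp
qed

text \<open>
  The vectors \<open>v, T v, T\<^sup>2 v, ...\<close> lie in a finite-dimensional space, so \<open>q(T) v = 0\<close> for some
  \<open>q \<noteq> 0\<close>. If \<open>q\<close> has least degree and \<open>q = (X - \<mu>) r\<close>, then \<open>r(T) v \<noteq> 0\<close> is an eigenvector. In the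
  proof \<open>P p\<close> is \<open>p(T) v\<close>.
\<close>

lemma complex_operator_has_eigenvector:
  fixes scale :: "complex \<Rightarrow> 'b::ab_group_add \<Rightarrow> 'b"
  assumes "vector_space scale" and V: "module.subspace scale V"
    and B: "finite B" "V \<subseteq> module.span scale B"
    and T: "\<And>x. x \<in> V \<Longrightarrow> T x \<in> V"
    and lin: "\<And>x y c. x \<in> V \<Longrightarrow> y \<in> V \<Longrightarrow> T (scale c x + y) = scale c (T x) + T y"
    and v: "v \<in> V" "v \<noteq> 0"
  shows "\<exists>\<mu>. \<exists>x\<in>V. x \<noteq> 0 \<and> T x = scale \<mu> x"
proof -
  interpret vector_space scale by fact
  define u where "u i = (T ^^ i) v" for i
  have uV: "u i \<in> V" for i
    by (induction i) (auto simp: u_def v T)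
  have uS: "T (u i) = u (Suc i)" for i
    by (simp add: u_def)
  have T0: "T 0 = 0"
    using lin[of 0 0 1] V by (simp add: subspace_0)
  define P where "P p = (\<Sum>i\<le>degree p. scale (coeff p i) (u i))" for p :: "complex poly"
  have P_bound: "P p = (\<Sum>i\<le>n. scale (coeff p i) (u i))" if "degree p \<le> n" for p n
    unfolding P_def using that
    by (intro sum.mono_neutral_left) (auto simp: coeff_eq_0)
  have sV: "sum g I \<in> V" if "\<And>i. i \<in> I \<Longrightarrow> g i \<in> V" for g and I :: "nat set"
    using that V subspace_sum by blast
  have PV: "P p \<in> V" for p
    unfolding P_def by (intro sV subspace_scale V uV)
  have Tsum: "T (\<Sum>i\<in>I. scale (c i) (u i)) = (\<Sum>i\<in>I. scale (c i) (u (Suc i)))"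
    if "finite I" for c and I :: "nat set"
    using that
  proof (induction I rule: finite_induct)
    case (insert i I)
    have "(\<Sum>i\<in>I. scale (c i) (u i)) \<in> V"
      by (intro sV subspace_scale V uV)
    then show ?case
      using insert by (simp add: lin uV uS)
  qed (simp add: T0)
  have P_diff: "P (p - q) = P p - P q" for p q
  proof -
    define n where "n = max (degree p) (degree q)"
    have "degree (p - q) \<le> n" "degree p \<le> n" "degree q \<le> n"
      by (auto simp: n_def degree_diff_le_max)
    then show ?thesis
      by (simp add: P_bound scale_left_diff_distrib sum_subtractf)
  qed
  have P_smult: "P (smult c p) = scale c (P p)" for c p
    using P_bound[of "smult c p" "degree p"]
    by (simp add: degree_smult_le scale_sum_right P_def)
  have P_X: "P (pCons 0 p) = T (P p)" for p
  proof -
    have "P (pCons 0 p) = (\<Sum>i\<le>Suc (degree p). scale (coeff (pCons 0 p) i) (u i))"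
      by (rule P_bound) (simp add: degree_pCons_le)
    then show ?thesis
      by (simp add: sum.atMost_Suc_shift Tsum P_def del: sum.atMost_Suc)
  qed
  obtain d where d: "u d \<in> span (u ` {..<d})"
    using first_dependent_power[OF B(1), of u] uV B(2) by blast
  have "\<exists>p. (\<forall>i\<ge>d. coeff p i = 0) \<and> P p = x" if "x \<in> span (u ` {..<d})" for x
    using that
  proof (induction rule: span_induct_alt)
    case base
    show ?case by (intro exI[of _ 0]) (simp add: P_def)
  next
    case (step c x y)
    then obtain j p where j: "j < d" "x = u j" and p: "\<forall>i\<ge>d. coeff p i = 0" "P p = y"
      by blast
    have m: "P (monom (- c) j) = - scale c (u j)"
      by (subst P_bound[of _ j]) (simp_all add: degree_monom_le lessThan_Suc_atMost[symmetric]
          sum.neutral)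
    then show ?case
      using j p P_diff[of p "monom (- c) j"]
      by (intro exI[of _ "p - monom (- c) j"]) (auto simp: add.commute)
  qed
  with d obtain p where p: "\<forall>i\<ge>d. coeff p i = 0" "P p = u d"
    by blast
  have "P (monom 1 d) = u d"
    by (subst P_bound[of _ d]) (simp_all add: degree_monom_le lessThan_Suc_atMost[symmetric]
        sum.neutral)
  then have "P (monom 1 d - p) = 0" "coeff (monom 1 d - p) d \<noteq> 0"
    using p by (simp_all add: P_diff)
  then have "\<exists>q. q \<noteq> 0 \<and> P q = 0"
    by (metis coeff_0)
  then obtain q where q: "q \<noteq> 0" "P q = 0"
    and min: "\<And>r. r \<noteq> 0 \<Longrightarrow> P r = 0 \<Longrightarrow> degree q \<le> degree r"
    using ex_has_least_nat[of "\<lambda>q. q \<noteq> 0 \<and> P q = 0" _ degree] by metis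
  have "degree q \<noteq> 0"
  proof
    assume "degree q = 0"
    then have "scale (coeff q 0) v = 0"
      using q(2) by (simp add: P_def u_def)
    then show False
      using v(2) q(1) \<open>degree q = 0\<close> leading_coeff_0_iff[of q] by auto
  qed
  then obtain \<mu> where "poly q \<mu> = 0"
    using Fundamental_Theorem_Algebra.fundamental_theorem_of_algebra[of q] constant_degree[of q] by auto
  then obtain r where r: "q = [:- \<mu>, 1:] * r"
    using poly_eq_0_iff_dvd by blast
  then have r0: "r \<noteq> 0"
    using q(1) by auto
  have dr: "degree q = Suc (degree r)"
    unfolding r by (subst degree_mult_eq) (use r0 in auto)
  have "q = pCons 0 r - smult \<mu> r"
    using r by simp
  then have "T (P r) = scale \<mu> (P r)"
    using q(2) by (simp add: P_diff P_smult P_X)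
  moreover have "P r \<noteq> 0"
    using min[of r] r0 dr by auto
  ultimately show ?thesis
    using PV by blast
qed

section \<open>Irreducible modules of \<open>sl(2, \<complex>)\<close>\<close>

interpretation seqs: vector_space seq_scale
  by (rule vector_space_seq_scale)

interpretation fields: vector_space field_scale
  by (rule vector_space_field_scale)

interpretation tensors: vector_space tensor_scale
  by (rule vector_space_tensor_scale)

definition hmat :: "complex \<Rightarrow> complex \<Rightarrow> complex \<Rightarrow> complex \<Rightarrow> hc" where
  "hmat p q r s = vector [vector [p, q], vector [r, s]]"

lemma hmat_nth [simp]:
  "hmat p q r s $ 1 $ 1 = p" "hmat p q r s $ 1 $ 2 = q"
  "hmat p q r s $ 2 $ 1 = r" "hmat p q r s $ 2 $ 2 = s"
  by (simp_all add: hmat_def)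

lemma hc_eq_iff:
  "(A::hc) = B \<longleftrightarrow> A $ 1 $ 1 = B $ 1 $ 1 \<and> A $ 1 $ 2 = B $ 1 $ 2 \<and> A $ 2 $ 1 = B $ 2 $ 1 \<and> A $ 2 $ 2 = B $ 2 $ 2"
  by (auto simp: vec_eq_iff forall_2)

lemma hc_mult_nth: "((A::hc) ** B) $ i $ j = A $ i $ 1 * B $ 1 $ j + A $ i $ 2 * B $ 2 $ j"
  by (simp add: matrix_matrix_mult_def sum_2)

lemma hscale_nth [simp]: "hscale c A $ i $ j = c * A $ i $ j"
  by (simp add: hscale_def)

lemma hscale_0 [simp]: "hscale c 0 = 0"
  by (simp add: hc_eq_iff)

lemma sl2_iff: "A \<in> sl2 \<longleftrightarrow> A $ 1 $ 1 + A $ 2 $ 2 = 0"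
  by (simp add: sl2_def trace_def sum_2)

abbreviation (input) "slH \<equiv> hmat 1 0 0 (-1)"
abbreviation (input) "slE \<equiv> hmat 0 1 0 0"
abbreviation (input) "slF \<equiv> hmat 0 0 1 0"

lemma sl2_basis [simp]: "slH \<in> sl2" "slE \<in> sl2" "slF \<in> sl2"
  by (auto simp: sl2_iff)

lemma sl2_expand:
  assumes "A \<in> sl2"
  shows "A = hscale (A $ 1 $ 1) slH + (hscale (A $ 1 $ 2) slE + (hscale (A $ 2 $ 1) slF + 0))"
  using assms by (simp add: sl2_iff hc_eq_iff add_eq_0_iff)

lemma sl2_closed [simp]: "0 \<in> sl2" "A \<in> sl2 \<Longrightarrow> B \<in> sl2 \<Longrightarrow> A + B \<in> sl2" "A \<in> sl2 \<Longrightarrow> hscale c A \<in> sl2"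
  by (auto simp: sl2_iff algebra_simps add_eq_0_iff)

text \<open>
  The Casimir element \<open>H\<^sup>2 + 2H + 4FE\<close>. It is defined for an arbitrary action, as it is applied both
  to modules of sequences and to the actions on columns.
\<close>

definition casimir :: "(hc \<Rightarrow> 'b \<Rightarrow> 'b) \<Rightarrow> (complex \<Rightarrow> 'b \<Rightarrow> 'b) \<Rightarrow> 'b \<Rightarrow> 'b::ab_group_add" where
  "casimir \<rho> sc v = \<rho> slH (\<rho> slH v) + sc 2 (\<rho> slH v) + sc 4 (\<rho> slF (\<rho> slE v))"

locale sl2_rep =
  fixes V :: "cseq set" and \<rho> :: "hc \<Rightarrow> cseq \<Rightarrow> cseq"
  assumes module: "sl2_module V \<rho>"
begin

lemma subspace: "seqs.subspace V"
  using module by (simp add: sl2_module_def)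

lemma closed [simp]:
  "0 \<in> V" "v \<in> V \<Longrightarrow> w \<in> V \<Longrightarrow> v + w \<in> V" "v \<in> V \<Longrightarrow> w \<in> V \<Longrightarrow> v - w \<in> V" "v \<in> V \<Longrightarrow> seq_scale c v \<in> V"
  "A \<in> sl2 \<Longrightarrow> v \<in> V \<Longrightarrow> \<rho> A v \<in> V"
  using subspace module
  by (auto simp: seqs.subspace_0 seqs.subspace_add seqs.subspace_diff seqs.subspace_scale sl2_module_def)

lemma lin: "A \<in> sl2 \<Longrightarrow> v \<in> V \<Longrightarrow> w \<in> V \<Longrightarrow> \<rho> A (seq_scale c v + w) = seq_scale c (\<rho> A v) + \<rho> A w"
  using module by (auto simp: sl2_module_def)

lemma rho_0 [simp]: "A \<in> sl2 \<Longrightarrow> \<rho> A 0 = 0"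
  using lin[of A 0 0 1] by simp

lemma rho_add [simp]: "A \<in> sl2 \<Longrightarrow> v \<in> V \<Longrightarrow> w \<in> V \<Longrightarrow> \<rho> A (v + w) = \<rho> A v + \<rho> A w"
  using lin[of A v w 1] by simp

lemma rho_diff [simp]: "A \<in> sl2 \<Longrightarrow> v \<in> V \<Longrightarrow> w \<in> V \<Longrightarrow> \<rho> A (v - w) = \<rho> A v - \<rho> A w"
  using rho_add[of A "v - w" w] by (simp add: eq_diff_eq del: rho_add)

lemma rho_scale [simp]: "A \<in> sl2 \<Longrightarrow> v \<in> V \<Longrightarrow> \<rho> A (seq_scale c v) = seq_scale c (\<rho> A v)"
  using lin[of A v 0 c] by simp

lemma lin_left: "A \<in> sl2 \<Longrightarrow> B \<in> sl2 \<Longrightarrow> v \<in> V \<Longrightarrow> \<rho> (hscale c A + B) v = seq_scale c (\<rho> A v) + \<rho> B v"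
  using module by (auto simp: sl2_module_def)

lemma rho_zero [simp]: "v \<in> V \<Longrightarrow> \<rho> 0 v = 0"
  using lin_left[of 0 0 v 1] by simp

lemma rho_hscale: "A \<in> sl2 \<Longrightarrow> v \<in> V \<Longrightarrow> \<rho> (hscale c A) v = seq_scale c (\<rho> A v)"
  using lin_left[of A 0 v c] by simp

lemma bracket: "A \<in> sl2 \<Longrightarrow> B \<in> sl2 \<Longrightarrow> v \<in> V \<Longrightarrow> \<rho> (A ** B - B ** A) v = \<rho> A (\<rho> B v) - \<rho> B (\<rho> A v)"
  using module by (auto simp: sl2_module_def)

lemma rho_expand:
  "A \<in> sl2 \<Longrightarrow> v \<in> V \<Longrightarrow>
    \<rho> A v = seq_scale (A $ 1 $ 1) (\<rho> slH v) + (seq_scale (A $ 1 $ 2) (\<rho> slE v) + seq_scale (A $ 2 $ 1) (\<rho> slF v))"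
  by (subst sl2_expand[of A]) (simp_all only: lin_left rho_hscale sl2_closed sl2_basis rho_zero add_0_right)

lemma HE: "v \<in> V \<Longrightarrow> \<rho> slH (\<rho> slE v) = \<rho> slE (\<rho> slH v) + seq_scale 2 (\<rho> slE v)"
proof -
  assume v: "v \<in> V"
  have "slH ** slE - slE ** slH = hscale 2 slE"
    by (simp add: hc_eq_iff hc_mult_nth)
  with bracket[OF _ _ v, of slH slE] v show ?thesis
    by (simp add: rho_hscale algebra_simps)
qed

lemma HF: "v \<in> V \<Longrightarrow> \<rho> slH (\<rho> slF v) = \<rho> slF (\<rho> slH v) - seq_scale 2 (\<rho> slF v)"
proof -
  assume v: "v \<in> V"
  have "slH ** slF - slF ** slH = hscale (-2) slF"
    by (simp add: hc_eq_iff hc_mult_nth)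
  with bracket[OF _ _ v, of slH slF] v rho_hscale[OF _ v, of slF "-2"] show ?thesis
    by (simp add: algebra_simps)
qed

lemma EF: "v \<in> V \<Longrightarrow> \<rho> slE (\<rho> slF v) = \<rho> slF (\<rho> slE v) + \<rho> slH v"
proof -
  assume v: "v \<in> V"
  have "slE ** slF - slF ** slE = slH"
    by (simp add: hc_eq_iff hc_mult_nth)
  with bracket[OF _ _ v, of slE slF] v show ?thesis
    by (simp add: algebra_simps)
qed

abbreviation "C \<equiv> casimir \<rho> seq_scale"

lemma casimir_H: "v \<in> V \<Longrightarrow> C (\<rho> slH v) = \<rho> slH (C v)"
  by (simp add: casimir_def HE HF EF)

lemma casimir_E: "v \<in> V \<Longrightarrow> C (\<rho> slE v) = \<rho> slE (C v)"
  by (simp add: casimir_def HE HF EF) (simp add: fun_eq_iff seq_scale_def algebra_simps)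

lemma casimir_F: "v \<in> V \<Longrightarrow> C (\<rho> slF v) = \<rho> slF (C v)"
  by (simp add: casimir_def HE HF EF) (simp add: fun_eq_iff seq_scale_def algebra_simps)

lemma casimir_lin: "v \<in> V \<Longrightarrow> w \<in> V \<Longrightarrow> C (seq_scale c v + w) = seq_scale c (C v) + C w"
  by (simp add: casimir_def) (simp add: fun_eq_iff seq_scale_def algebra_simps)

lemma invariant_subspaceI:
  assumes "seqs.subspace S" "S \<subseteq> V" "\<And>v. v \<in> S \<Longrightarrow> \<rho> slH v \<in> S \<and> \<rho> slE v \<in> S \<and> \<rho> slF v \<in> S"
    and "irreducible_sl2_module V \<rho>" "x \<in> S" "x \<noteq> 0"
  shows "S = V"
proof -
  have "\<rho> A v \<in> S" if "A \<in> sl2" "v \<in> S" for A v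
    using that assms by (subst rho_expand) (auto intro!: seqs.subspace_add seqs.subspace_scale)
  then show ?thesis
    using assms unfolding irreducible_sl2_module_def by blast
qed

lemma weight_E: "v \<in> V \<Longrightarrow> \<rho> slH v = seq_scale \<mu> v \<Longrightarrow> \<rho> slH (\<rho> slE v) = seq_scale (\<mu> + 2) (\<rho> slE v)"
  by (simp add: HE) (simp add: fun_eq_iff seq_scale_def algebra_simps)

lemma weight_F: "v \<in> V \<Longrightarrow> \<rho> slH v = seq_scale \<mu> v \<Longrightarrow> \<rho> slH (\<rho> slF v) = seq_scale (\<mu> - 2) (\<rho> slF v)"
  by (simp add: HF) (simp add: fun_eq_iff seq_scale_def algebra_simps)

text \<open>
  Eigenvectors for different eigenvalues are independent, so an infinite string of them does not
  fit into a finite-dimensional space. This terminates the chains \<open>E\<^sup>i x\<close> and \<open>F\<^sup>i x\<close> below.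
\<close>

lemma weight_vectors_vanish:
  assumes fin: "finite B" "V \<subseteq> seqs.span B"
    and u: "\<And>i. u i \<in> V" "\<And>i. \<rho> slH (u i) = seq_scale (ev i) (u i)" and "inj ev"
  shows "\<exists>d::nat. u d = 0"
proof -
  obtain d where d: "u d \<in> seqs.span (u ` {..<d})"
    using seqs.first_dependent_power[OF fin(1), of u] u(1) fin(2) by blast
  have sp: "seqs.span (u ` {..<d}) \<subseteq> V"
    using u(1) by (intro seqs.span_minimal subspace) auto
  have "u d \<notin> seqs.span (u ` {..<d})" if "u d \<noteq> 0"
    using that u sp \<open>inj ev\<close>
    by (intro seqs.eigenvector_not_in_span[where T = "\<rho> slH" and ev = ev and \<mu> = "ev d"] lin)
      (auto simp: inj_def)
  with d show ?thesis
    by blast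
qed

lemma highest_weight_vector:
  assumes fin: "finite B" "V \<subseteq> seqs.span B" and "V \<noteq> {0}"
  shows "\<exists>\<mu>. \<exists>x\<in>V. x \<noteq> 0 \<and> \<rho> slH x = seq_scale \<mu> x \<and> \<rho> slE x = 0"
proof -
  obtain v where "v \<in> V" "v \<noteq> 0"
    using \<open>V \<noteq> {0}\<close> closed(1) by blast
  then obtain \<mu> x where x: "x \<in> V" "x \<noteq> 0" "\<rho> slH x = seq_scale \<mu> x"
    using complex_operator_has_eigenvector[OF vector_space_seq_scale subspace fin, of "\<rho> slH" v] lin
    by auto
  define u where "u i = (\<rho> slE ^^ i) x" for i
  have u: "u i \<in> V \<and> \<rho> slH (u i) = seq_scale (\<mu> + 2 * of_nat i) (u i)" for i
  proof (induction i)
    case (Suc i)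
    have "\<mu> + 2 * of_nat (Suc i) = (\<mu> + 2 * of_nat i) + 2"
      by simp
    then show ?case
      using weight_E[of "u i"] Suc by (simp only: u_def funpow.simps o_apply closed(5) sl2_basis simp_thms)
  qed (simp add: u_def x)
  have "\<exists>d. u d = 0"
    using u by (intro weight_vectors_vanish[OF fin, of u "\<lambda>i. \<mu> + 2 * of_nat i"]) (auto simp: inj_def)
  then obtain d where d: "u (Suc d) = 0" "u d \<noteq> 0"
    using x(2) ex_least_nat_less[of "\<lambda>i. u i = 0"] by (metis (no_types, lifting) LeastI Least_le
      not_less_eq_eq not_less_Least funpow_0 u_def lessI not0_implies_Suc)
  show ?thesis
    using u[of d] d by (auto simp: u_def)
qed

text \<open>
  The eigenspace of the Casimir element through a highest weight vector \<open>x\<close> of weight \<open>\<mu>\<close> is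
  invariant, hence is \<open>V\<close>, and the eigenvalue is \<open>c = \<mu> (\<mu> + 2)\<close>. The span of the non-zero
  vectors \<open>F\<^sup>i x\<close>, \<open>i < r\<close>, is invariant as well, so that \<open>r = dim V = n + 1\<close>. Finally
  \<open>4 E F\<close> acts on a vector of weight \<open>\<nu>\<close> by \<open>c - \<nu>\<^sup>2 + 2 \<nu>\<close>; this must be \<open>0\<close> for the last vector
  \<open>F\<^sup>n x\<close>, whose weight is \<open>\<mu> - 2n\<close>, and yields \<open>\<mu> = n\<close>.
\<close>

lemma casimir_irreducible:
  assumes irr: "irreducible_sl2_module V \<rho>" and dim: "seqs.dim V = Suc n" and "v \<in> V"
  shows "C v = seq_scale (of_nat (n * (n + 2))) v"
proof -
  obtain B where B: "B \<subseteq> V" "seqs.independent B" "V \<subseteq> seqs.span B" "card B = Suc n"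
    using seqs.basis_exists[of V] dim by metis
  have fin: "finite B"
    using B(4) card.infinite by fastforce
  obtain \<mu> x where x: "x \<in> V" "x \<noteq> 0" "\<rho> slH x = seq_scale \<mu> x" "\<rho> slE x = 0"
    using highest_weight_vector[OF fin B(3)] irr unfolding irreducible_sl2_module_def by blast
  define c where "c = \<mu> * (\<mu> + 2)"
  have Cx: "C x = seq_scale c x"
    using x by (simp add: casimir_def) (simp add: fun_eq_iff seq_scale_def algebra_simps c_def)
  have "{v \<in> V. C v = seq_scale c v} = V"
  proof (rule invariant_subspaceI[OF _ _ _ irr])
    show "seqs.subspace {v \<in> V. C v = seq_scale c v}"
    proof (rule seqs.subspaceI)
      show "0 \<in> {v \<in> V. C v = seq_scale c v}"
        by (simp add: casimir_def)
      show "v + w \<in> {v \<in> V. C v = seq_scale c v}"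
        if "v \<in> {v \<in> V. C v = seq_scale c v}" "w \<in> {v \<in> V. C v = seq_scale c v}" for v w
        using that casimir_lin[of v w 1] by (simp add: seqs.scale_right_distrib)
      show "seq_scale a v \<in> {v \<in> V. C v = seq_scale c v}" if "v \<in> {v \<in> V. C v = seq_scale c v}" for a v
        using that casimir_lin[of v 0 a] by (simp add: casimir_def mult.commute)
    qed
    show "\<rho> slH v \<in> {v \<in> V. C v = seq_scale c v} \<and> \<rho> slE v \<in> {v \<in> V. C v = seq_scale c v}
      \<and> \<rho> slF v \<in> {v \<in> V. C v = seq_scale c v}" if "v \<in> {v \<in> V. C v = seq_scale c v}" for v
      using that by (simp add: casimir_H casimir_E casimir_F)
  qed (use x Cx in auto)
  then have C: "C v = seq_scale c v" if "v \<in> V" for v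
    using that by blast
  define u where "u i = (\<rho> slF ^^ i) x" for i
  have u: "u i \<in> V \<and> \<rho> slH (u i) = seq_scale (\<mu> - 2 * of_nat i) (u i)" for i
  proof (induction i)
    case (Suc i)
    have "\<mu> - 2 * of_nat (Suc i) = (\<mu> - 2 * of_nat i) - 2"
      by simp
    then show ?case
      using weight_F[of "u i"] Suc by (simp only: u_def funpow.simps o_apply closed(5) sl2_basis simp_thms)
  qed (simp add: u_def x)
  have uS: "\<rho> slF (u i) = u (Suc i)" for i
    by (simp add: u_def)
  have EF_weight: "seq_scale 4 (\<rho> slE (\<rho> slF v)) = seq_scale (c - \<nu> ^ 2 + 2 * \<nu>) v"
    if "v \<in> V" "\<rho> slH v = seq_scale \<nu> v" for v \<nu>
  proof -
    have "seq_scale 4 (\<rho> slE (\<rho> slF v)) = C v - seq_scale (\<nu> ^ 2) v + seq_scale (2 * \<nu>) v"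
      using that by (simp add: EF casimir_def)
        (simp add: fun_eq_iff seq_scale_def algebra_simps power2_eq_square)
    then show ?thesis
      using that by (simp add: C seqs.scale_left_distrib seqs.scale_left_diff_distrib)
  qed
  have "\<exists>d. u d = 0"
    using u by (intro weight_vectors_vanish[OF fin B(3), of u "\<lambda>i. \<mu> - 2 * of_nat i"]) (auto simp: inj_def)
  then obtain r where r: "u r = 0" "\<And>i. i < r \<Longrightarrow> u i \<noteq> 0"
    using exists_least_iff[of "\<lambda>i. u i = 0"] by blast
  let ?S = "seqs.span (u ` {..<r})"
  have subS: "?S \<subseteq> V"
    using u by (intro seqs.span_minimal subspace) auto
  have uS': "u i \<in> ?S" if "i \<le> r" for i
    using that r(1) by (cases "i = r") (auto simp: seqs.span_zero intro: seqs.span_base)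
  have "?S = V"
  proof (rule invariant_subspaceI[OF _ subS _ irr])
    show "u 0 \<in> ?S" "u 0 \<noteq> 0"
      using uS'[of 0] x(2) by (auto simp: u_def)
    have "v \<in> ?S \<and> \<rho> slH v \<in> ?S \<and> \<rho> slE v \<in> ?S \<and> \<rho> slF v \<in> ?S" if "v \<in> ?S" for v
      using that
    proof (induction rule: seqs.span_induct_alt)
      case base
      then show ?case by (simp only: rho_0 sl2_basis seqs.span_zero simp_thms)
    next
      case (step a w y)
      then obtain i where i: "i < r" "w = u i"
        by blast
      have E: "\<rho> slE (u i) \<in> ?S"
      proof (cases i)
        case 0
        then show ?thesis
          using x by (simp add: u_def seqs.span_zero)
      next
        case (Suc j)
        define a where "a = c - (\<mu> - 2 * of_nat j) ^ 2 + 2 * (\<mu> - 2 * of_nat j)"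
        have "seq_scale (1 / 4) (seq_scale 4 (\<rho> slE (u i))) = seq_scale (1 / 4) (seq_scale a (u j))"
          using EF_weight[of "u j" "\<mu> - 2 * of_nat j"] u[of j] by (simp only: Suc uS a_def)
        then have "\<rho> slE (u i) = seq_scale (1 / 4 * a) (u j)"
          by simp
        moreover have "u j \<in> ?S"
          using uS'[of j] i(1) Suc by simp
        ultimately show ?thesis
          by (simp only: seqs.span_scale)
      qed
      have "y \<in> V" "u i \<in> V"
        using u step.IH subS by blast+
      note L = lin[OF _ this(2,1), where c = a]
      show ?case
        unfolding i(2) L[OF sl2_basis(1)] L[OF sl2_basis(2)] L[OF sl2_basis(3)] uS u[THEN conjunct2]
        using step.IH E uS'[of i] uS'[of "Suc i"] i(1)
        by (intro conjI seqs.span_add seqs.span_scale) auto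
    qed
    then show "\<rho> slH v \<in> ?S \<and> \<rho> slE v \<in> ?S \<and> \<rho> slF v \<in> ?S" if "v \<in> ?S" for v
      using that by blast
  qed auto
  moreover have "seqs.independent (u ` {..<r}) \<and> card (u ` {..<r}) = r"
  proof (rule seqs.independent_sequence)
    fix i assume "i < r"
    have "seqs.span (u ` {..<i}) \<subseteq> V"
      using u by (intro seqs.span_minimal subspace) auto
    then show "u i \<notin> seqs.span (u ` {..<i})"
      using u r(2)[OF \<open>i < r\<close>]
      by (intro seqs.eigenvector_not_in_span[where T = "\<rho> slH" and ev = "\<lambda>i. \<mu> - 2 * of_nat i"
            and \<mu> = "\<mu> - 2 * of_nat i"] lin) auto
  qed
  ultimately have "r = Suc n"
    using dim seqs.dim_span_eq_card_independent[of "u ` {..<r}"] by auto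
  define \<nu> where "\<nu> = \<mu> - 2 * of_nat n"
  have "seq_scale (c - \<nu> ^ 2 + 2 * \<nu>) (u n) = 0"
    using EF_weight[of "u n" \<nu>] u[of n] r(1) \<open>r = Suc n\<close> by (simp add: \<nu>_def uS)
  then have "c - \<nu> ^ 2 + 2 * \<nu> = 0"
    using r(2)[of n] \<open>r = Suc n\<close> by simp
  then have "4 * (of_nat n + 1) * (\<mu> - of_nat n) = 0"
    by (simp add: \<nu>_def c_def algebra_simps power2_eq_square)
  moreover have "(of_nat n + 1 :: complex) \<noteq> 0"
    by (metis of_nat_Suc of_nat_eq_0_iff add.commute nat.distinct(1))
  ultimately have "\<mu> = of_nat n"
    by (auto simp only: mult_eq_0_iff right_minus_eq numeral_neq_zero)
  then show ?thesis
    using C[OF \<open>v \<in> V\<close>] by (simp add: c_def algebra_simps)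
qed

end

section \<open>The standard model of \<open>V\<^sub>n\<^sub>/\<^sub>2\<close> and the contragredient action\<close>

definition model_space :: "nat \<Rightarrow> cseq set" where
  "model_space n = {v. \<forall>i>n. v i = 0}"

text \<open>
  In terms of the unit sequences, \<open>E e\<^sub>i = (n - i) e\<^sub>i\<^sub>+\<^sub>1\<close>, \<open>F e\<^sub>i = i e\<^sub>i\<^sub>-\<^sub>1\<close>, and \<open>H e\<^sub>i = (2i - n) e\<^sub>i\<close>: the
  representation on binary forms of degree \<open>n\<close> with \<open>e\<^sub>i\<close> in the role of \<open>u\<^sup>i v\<^sup>n\<^sup>-\<^sup>i\<close>, where \<open>A\<close> sends \<open>u\<close>
  to \<open>a\<^sub>1\<^sub>1 u + a\<^sub>2\<^sub>1 v\<close> and \<open>v\<close> to \<open>a\<^sub>1\<^sub>2 u + a\<^sub>2\<^sub>2 v\<close> and is extended as a derivation.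
\<close>

definition model_rho :: "nat \<Rightarrow> hc \<Rightarrow> cseq \<Rightarrow> cseq" where
  "model_rho n A v i =
     (of_nat i * A $ 1 $ 1 + (of_nat n - of_nat i) * A $ 2 $ 2) * v i
     + (of_nat i + 1) * A $ 2 $ 1 * v (Suc i)
     + (of_nat n - of_nat i + 1) * A $ 1 $ 2 * (case i of 0 \<Rightarrow> 0 | Suc j \<Rightarrow> v j)"

definition unit_seq :: "nat \<Rightarrow> cseq" where
  "unit_seq i = (\<lambda>j. if j = i then 1 else 0)"

text \<open>
  Functions are treated as vectors from here on; pointwise evaluation of their sums is requested
  explicitly.
\<close>

declare plus_fun_apply [simp del] zero_fun_apply [simp del] minus_apply [simp del]

lemma seq_scale_apply: "seq_scale c v i = c * v i"
  by (simp add: seq_scale_def)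

lemma tensor_scale_apply: "tensor_scale c v i = (\<lambda>j. c * v i j)"
  by (simp add: tensor_scale_def)

lemmas pointwise = plus_fun_apply zero_fun_apply minus_apply seq_scale_apply tensor_scale_apply

lemma model_subspace: "seqs.subspace (model_space n)"
  by (rule seqs.subspaceI) (auto simp: model_space_def pointwise)

lemma model_rho_closed: "v \<in> model_space n \<Longrightarrow> model_rho n A v \<in> model_space n"
  by (auto simp: model_space_def model_rho_def split: nat.split)

lemma model_rho_bracket:
  "model_rho n (A ** B - B ** A) v = model_rho n A (model_rho n B v) - model_rho n B (model_rho n A v)"
proof
  fix i
  consider "i = 0" | "i = Suc 0" | j where "i = Suc (Suc j)"
    by (metis not0_implies_Suc)
  then show "model_rho n (A ** B - B ** A) v i
    = (model_rho n A (model_rho n B v) - model_rho n B (model_rho n A v)) i"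
    by cases (simp_all add: model_rho_def hc_mult_nth pointwise algebra_simps)
qed

lemma model_module: "sl2_module (model_space n) (model_rho n)"
  unfolding sl2_module_def
  by (auto simp: model_subspace model_rho_closed model_rho_bracket)
    (auto simp: fun_eq_iff model_rho_def pointwise algebra_simps split: nat.split)

lemma unit_seq_in_model: "i \<le> n \<Longrightarrow> unit_seq i \<in> model_space n"
  by (simp add: unit_seq_def model_space_def)

lemma sum_fun_apply: "(\<Sum>i\<in>I. f i) x = (\<Sum>i\<in>I. f i x)" for f :: "'i \<Rightarrow> 'b \<Rightarrow> 'c::comm_monoid_add"
  by (induction I rule: infinite_finite_induct) (auto simp: pointwise)

lemma model_expand:
  assumes "v \<in> model_space n"
  shows "v = (\<Sum>i\<le>n. seq_scale (v i) (unit_seq i))"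
proof
  fix j
  have "(\<Sum>i\<le>n. v i * (if j = i then 1 else 0)) = (\<Sum>i\<le>n. if j = i then v i else 0)"
    by (intro sum.cong) auto
  then show "v j = (\<Sum>i\<le>n. seq_scale (v i) (unit_seq i)) j"
    using assms by (auto simp: sum_fun_apply unit_seq_def model_space_def pointwise)
qed

lemma model_dim: "seqs.dim (model_space n) = Suc n"
proof -
  have "unit_seq i \<notin> seqs.span (unit_seq ` {..<i})" for i
  proof -
    have "seqs.span (unit_seq ` {..<i}) \<subseteq> {v. v i = 0}"
      by (intro seqs.span_minimal seqs.subspaceI) (auto simp: unit_seq_def pointwise)
    then show ?thesis
      by (auto simp: unit_seq_def)
  qed
  then have "seqs.independent (unit_seq ` {..<Suc n}) \<and> card (unit_seq ` {..<Suc n}) = Suc n"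
    by (intro seqs.independent_sequence)
  moreover have "model_space n \<subseteq> seqs.span (unit_seq ` {..<Suc n})"
  proof
    fix v assume "v \<in> model_space n"
    show "v \<in> seqs.span (unit_seq ` {..<Suc n})"
      by (subst model_expand[OF \<open>v \<in> model_space n\<close>])
        (intro seqs.span_sum seqs.span_scale seqs.span_base, auto)
  qed
  moreover have "unit_seq ` {..<Suc n} \<subseteq> model_space n"
    using unit_seq_in_model by auto
  ultimately show ?thesis
    using seqs.dim_unique by metis
qed

lemma model_rho_E_unit:
  "model_rho n slE (unit_seq i) = seq_scale (of_nat n - of_nat i) (unit_seq (Suc i))"
  by (auto simp: fun_eq_iff model_rho_def unit_seq_def pointwise split: nat.split)

lemma model_irreducible: "irreducible_sl2_module (model_space n) (model_rho n)"
  unfolding irreducible_sl2_module_def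
proof (intro conjI allI impI model_module)
  show "model_space n \<noteq> {0}"
  proof
    assume "model_space n = {0}"
    then have "unit_seq 0 = 0"
      using unit_seq_in_model[of 0 n] by simp
    from fun_cong[OF this, of 0] show False
      by (simp add: unit_seq_def pointwise)
  qed
next
  fix S assume S: "seqs.subspace S \<and> S \<subseteq> model_space n \<and> (\<forall>A\<in>sl2. \<forall>v\<in>S. model_rho n A v \<in> S)"
  then have sub: "seqs.subspace S" and SV: "S \<subseteq> model_space n"
    and inv: "\<And>A v. A \<in> sl2 \<Longrightarrow> v \<in> S \<Longrightarrow> model_rho n A v \<in> S"
    by auto
  show "S = {0} \<or> S = model_space n"
  proof (rule disjCI)
    assume "S \<noteq> model_space n"
    show "S = {0}"
    proof (rule ccontr)
      assume "S \<noteq> {0}"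
      then obtain w where w: "w \<in> S" "w \<noteq> 0"
        using seqs.subspace_0[OF sub] by auto
      \<comment> \<open>lowering a vector with top coefficient at \<open>d\<close> exactly \<open>d\<close> times leaves a multiple of the
          first unit vector\<close>
      have e0: "unit_seq 0 \<in> S" if "v \<in> S" "v d \<noteq> 0" "\<And>i. i > d \<Longrightarrow> v i = 0" for v d
        using that
      proof (induction d arbitrary: v)
        case 0
        then have "unit_seq 0 = seq_scale (1 / v 0) v"
          by (auto simp: fun_eq_iff unit_seq_def pointwise)
        then show ?case
          using 0 sub by (simp add: seqs.subspace_scale)
      next
        case (Suc d)
        have F: "model_rho n slF v i = (of_nat i + 1) * v (Suc i)" for i
          by (simp add: model_rho_def)
        have "(of_nat d + 1 :: complex) \<noteq> 0"
          by (metis of_nat_Suc of_nat_eq_0_iff add.commute nat.distinct(1))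
        then show ?case
          using Suc.prems by (intro Suc.IH[of "model_rho n slF v"] inv) (auto simp: F)
      qed
      obtain d where "w d \<noteq> 0"
        using w by (auto simp: fun_eq_iff pointwise)
      moreover have "i \<le> n" if "w i \<noteq> 0" for i
        using that w SV by (force simp: model_space_def)
      ultimately have "\<exists>d. w d \<noteq> 0 \<and> (\<forall>i. w i \<noteq> 0 \<longrightarrow> i \<le> d)"
        using GreatestI_nat[of "\<lambda>i. w i \<noteq> 0" d n] Greatest_le_nat[of "\<lambda>i. w i \<noteq> 0" _ n]
        by (intro exI[of _ "GREATEST i. w i \<noteq> 0"]) blast
      then have "unit_seq 0 \<in> S"
        using e0 w(1) by (metis leD)
      have "unit_seq i \<in> S" if "i \<le> n" for i
        using that
      proof (induction i)
        case (Suc i)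
        then have "(of_nat n - of_nat i :: complex) \<noteq> 0"
          by simp
        then have "unit_seq (Suc i) = seq_scale (1 / (of_nat n - of_nat i)) (model_rho n slE (unit_seq i))"
          by (simp add: model_rho_E_unit)
        moreover have "model_rho n slE (unit_seq i) \<in> S"
          using Suc by (intro inv) auto
        ultimately show ?case
          using sub by (simp add: seqs.subspace_scale)
      qed (simp add: \<open>unit_seq 0 \<in> S\<close>)
      then have "v \<in> S" if "v \<in> model_space n" for v
        by (subst model_expand[OF that]) (intro seqs.subspace_sum seqs.subspace_scale sub, auto)
      then show False
        using SV \<open>S \<noteq> model_space n\<close> by blast
    qed
  qed
qed

lemma model_is_V: "is_V (real n / 2) (model_space n) (model_rho n)"
  by (simp add: is_V_def model_irreducible model_dim)

lemma zero_is_V: "j < 0 \<Longrightarrow> is_V j {0} (\<lambda>A v. 0)"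
  by (auto simp: is_V_def sl2_module_def seqs.subspace_0 intro!: seqs.subspaceI)

text \<open>
  Precomposition with \<open>A \<mapsto> - A\<^sup>T\<close>, an automorphism of \<open>sl(2, \<complex>)\<close>, turns a representation into
  another one of the same dimension. It occurs twice: the action of \<open>D\<close> on powers of \<open>s\<close> is of this
  form, and so is the comparison of \<open>U\<close> with \<open>U'\<close>.
\<close>

definition dual :: "hc \<Rightarrow> hc" where
  "dual A = - transpose A"

lemma dual_nth [simp]: "dual A $ i $ j = - (A $ j $ i)"
  by (simp add: dual_def transpose_def)

lemma dual_dual [simp]: "dual (dual A) = A"
  by (simp add: hc_eq_iff)

lemma dual_sl2 [simp]: "dual A \<in> sl2 \<longleftrightarrow> A \<in> sl2"
proof -
  have "- x + - y = 0 \<longleftrightarrow> x + y = 0" for x y :: complex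
    by (metis add.inverse_inverse minus_add_distrib add.commute neg_0_equal_iff_equal)
  then show ?thesis
    by (simp only: sl2_iff dual_nth)
qed

lemma dual_module:
  assumes "sl2_module V \<rho>"
  shows "sl2_module V (\<lambda>A. \<rho> (dual A))"
proof -
  interpret sl2_rep V \<rho> by unfold_locales fact
  have 1: "dual (hscale c A + B) = hscale c (dual A) + (dual B)" for c A B
    by (simp add: hc_eq_iff)
  have 2: "dual (A ** B - B ** A)
    = (dual A) ** (dual B) - (dual B) ** (dual A)" for A B :: hc
    by (simp add: hc_eq_iff hc_mult_nth algebra_simps)
  show ?thesis
    unfolding sl2_module_def 1 2
    using subspace by (auto simp: lin lin_left bracket)
qed

lemma dual_is_V:
  assumes "is_V j V \<rho>"
  shows "is_V j V (\<lambda>A. \<rho> (dual A))"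
proof -
  have inv: "(\<forall>A\<in>sl2. \<forall>v\<in>S. \<rho> A v \<in> S) \<longleftrightarrow> (\<forall>A\<in>sl2. \<forall>v\<in>S. \<rho> (dual A) v \<in> S)" for S
    using dual_sl2 dual_dual by metis
  show ?thesis
  proof (cases "j < 0")
    case True
    then show ?thesis
      using assms dual_module[of V \<rho>] unfolding is_V_def by metis
  next
    case False
    then show ?thesis
      using assms dual_module[of V \<rho>] inv
      by (simp only: is_V_def irreducible_sl2_module_def if_False) blast
  qed
qed

section \<open>Box modules spanned by weight bases\<close>

text \<open>
  How \<open>A\<close> acts on a weight basis \<open>g\<^sub>0, ..., g\<^sub>n\<close> that transforms like the unit sequences under \<open>model_rho\<close>.
  At \<open>i = 0\<close> and \<open>i = n\<close> the coefficients of the terms \<open>g (i - 1)\<close> and \<open>g (Suc i)\<close>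
  respectively vanish.
\<close>

definition ladder :: "nat \<Rightarrow> hc \<Rightarrow> (nat \<Rightarrow> field2) \<Rightarrow> nat \<Rightarrow> field2" where
  "ladder n A g i =
     field_scale (of_nat i * A $ 1 $ 1 + (of_nat n - of_nat i) * A $ 2 $ 2) (g i)
     + field_scale (of_nat i * A $ 2 $ 1) (g (i - 1))
     + field_scale ((of_nat n - of_nat i) * A $ 1 $ 2) (g (Suc i))"

lemma field_scale_nth: "field_scale c f Z $ p = c * f Z $ p"
  by (simp add: field_scale_def)

lemma field_eqI: "(\<And>Z p. f Z $ p = g Z $ p) \<Longrightarrow> f = (g :: field2)"
  by (simp add: fun_eq_iff vec_eq_iff)

text \<open>
  The matrix of \<open>model_rho\<close> on coordinates and the action \<open>ladder\<close> on basis vectors are transposes of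
  each other; the identity is a summation by shifting the index.
\<close>

lemma sum_model_rho_complex:
  fixes g :: "nat \<Rightarrow> complex"
  assumes "v \<in> model_space n"
  shows "(\<Sum>i\<le>n. model_rho n A v i * g i) = (\<Sum>i\<le>n. v i *
     ((of_nat i * A $ 1 $ 1 + (of_nat n - of_nat i) * A $ 2 $ 2) * g i
       + of_nat i * A $ 2 $ 1 * g (i - 1) + (of_nat n - of_nat i) * A $ 1 $ 2 * g (Suc i)))"
proof -
  have "v (Suc n) = 0"
    using assms by (simp add: model_space_def)
  then have "(\<Sum>i\<le>n. (of_nat i + 1) * v (Suc i) * g i) = (\<Sum>i\<le>Suc n. of_nat i * v i * g (i - 1))"
    by (subst sum.atMost_Suc_shift) (simp add: add.commute)
  also have "\<dots> = (\<Sum>i\<le>n. of_nat i * v i * g (i - 1))"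
    using \<open>v (Suc n) = 0\<close> by simp
  finally have 1: "(\<Sum>i\<le>n. (of_nat i + 1) * v (Suc i) * g i) = (\<Sum>i\<le>n. of_nat i * v i * g (i - 1))" .
  have "(\<Sum>i\<le>n. (of_nat n - of_nat i + 1) * (case i of 0 \<Rightarrow> 0 | Suc j \<Rightarrow> v j) * g i)
      = (\<Sum>i\<le>Suc n. (of_nat n - of_nat i + 1) * (case i of 0 \<Rightarrow> 0 | Suc j \<Rightarrow> v j) * g i)"
    by simp
  also have "\<dots> = (\<Sum>i\<le>n. (of_nat n - of_nat i) * v i * g (Suc i))"
    by (subst sum.atMost_Suc_shift) (simp add: algebra_simps)
  finally have 2: "(\<Sum>i\<le>n. (of_nat n - of_nat i + 1) * (case i of 0 \<Rightarrow> 0 | Suc j \<Rightarrow> v j) * g i)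
      = (\<Sum>i\<le>n. (of_nat n - of_nat i) * v i * g (Suc i))" .
  have "(\<Sum>i\<le>n. model_rho n A v i * g i)
      = (\<Sum>i\<le>n. (of_nat i * A $ 1 $ 1 + (of_nat n - of_nat i) * A $ 2 $ 2) * v i * g i)
       + A $ 2 $ 1 * (\<Sum>i\<le>n. (of_nat i + 1) * v (Suc i) * g i)
       + A $ 1 $ 2 * (\<Sum>i\<le>n. (of_nat n - of_nat i + 1) * (case i of 0 \<Rightarrow> 0 | Suc j \<Rightarrow> v j) * g i)"
    unfolding sum_distrib_left sum.distrib[symmetric]
    by (intro sum.cong refl) (simp add: model_rho_def algebra_simps)
  also have "\<dots> = (\<Sum>i\<le>n. v i *
     ((of_nat i * A $ 1 $ 1 + (of_nat n - of_nat i) * A $ 2 $ 2) * g i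
       + of_nat i * A $ 2 $ 1 * g (i - 1) + (of_nat n - of_nat i) * A $ 1 $ 2 * g (Suc i)))"
    unfolding 1 2 sum_distrib_left sum.distrib[symmetric]
    by (intro sum.cong refl) (simp add: algebra_simps)
  finally show ?thesis .
qed

lemma sum_model_rho:
  assumes "v \<in> model_space n"
  shows "(\<Sum>i\<le>n. field_scale (model_rho n A v i) (g i)) = (\<Sum>i\<le>n. field_scale (v i) (ladder n A g i))"
  using sum_model_rho_complex[OF assms, of A "\<lambda>i. g i Z $ p" for Z p]
  by (intro field_eqI) (simp add: sum_fun_apply ladder_def field_scale_nth pointwise)

lemma tensor_space_model:
  "tensor_space (model_space n) (model_space m) = {T. \<forall>i j. n < i \<or> m < j \<longrightarrow> T i j = 0}"
proof
  show "tensor_space (model_space n) (model_space m) \<subseteq> {T. \<forall>i j. n < i \<or> m < j \<longrightarrow> T i j = 0}"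
    unfolding tensor_space_def
    by (intro tensors.span_minimal tensors.subspaceI)
      (auto simp: pure_tensor_def model_space_def pointwise)
next
  show "{T. \<forall>i j. n < i \<or> m < j \<longrightarrow> T i j = 0} \<subseteq> tensor_space (model_space n) (model_space m)"
  proof
    fix T :: "nat \<Rightarrow> cseq" assume T: "T \<in> {T. \<forall>i j. n < i \<or> m < j \<longrightarrow> T i j = 0}"
    have "T = (\<Sum>i\<le>n. pure_tensor (unit_seq i) (T i))"
    proof (intro ext)
      fix a b
      have "(\<Sum>i\<le>n. (if a = i then 1 else 0) * T i b) = (\<Sum>i\<le>n. if a = i then T i b else 0)"
        by (intro sum.cong) auto
      then show "T a b = (\<Sum>i\<le>n. pure_tensor (unit_seq i) (T i)) a b"
        using T by (auto simp: sum_fun_apply pure_tensor_def unit_seq_def not_le)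
    qed
    moreover have "T i \<in> model_space m" for i
      using T by (simp add: model_space_def)
    ultimately show "T \<in> tensor_space (model_space n) (model_space m)"
      unfolding tensor_space_def
      by (metis (mono_tags, lifting) tensors.span_sum tensors.span_base unit_seq_in_model atMost_iff mem_Collect_eq)
  qed
qed

text \<open>
  The isomorphism sends the matrix \<open>T\<close> to \<open>\<Sum> T\<^sub>i\<^sub>j G\<^sub>i\<^sub>j\<close>. It intertwines the actions because of
  \<open>sum_model_rho\<close>. It is injective because the \<open>G\<^sub>i\<^sub>j\<close> are non-zero with pairwise different weights
  \<open>(2i - n, m - 2j)\<close> under the diagonal matrices of the two factors: by \<open>eigen_span\<close> for both
  weights, no \<open>G\<^sub>p\<^sub>q\<close> is in the span of the others. The set \<open>L\<close> only has to be a domain on which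
  the action is linear.
\<close>

lemma iso_box_weight_basis:
  fixes G :: "nat \<Rightarrow> nat \<Rightarrow> field2" and n m :: nat
  defines "B \<equiv> {G i j | i j. i \<le> n \<and> j \<le> m}"
  assumes L: "fields.subspace L" "\<And>i j. i \<le> n \<Longrightarrow> j \<le> m \<Longrightarrow> G i j \<in> L"
    and lin: "\<And>A D c f g. A \<in> sl2 \<Longrightarrow> D \<in> sl2 \<Longrightarrow> f \<in> L \<Longrightarrow> g \<in> L \<Longrightarrow>
      act (block_diag A D) (field_scale c f + g) = field_scale c (act (block_diag A D) f) + act (block_diag A D) g"
    and act: "\<And>A D i j. A \<in> sl2 \<Longrightarrow> D \<in> sl2 \<Longrightarrow> i \<le> n \<Longrightarrow> j \<le> m \<Longrightarrow>
      act (block_diag A D) (G i j) = ladder n A (\<lambda>i. G i j) i + ladder m (dual D) (G i) j"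
    and nz: "\<And>i j. i \<le> n \<Longrightarrow> j \<le> m \<Longrightarrow> G i j \<noteq> 0"
  shows "iso_box act (real n / 2) (real m / 2) (cspan B)"
proof -
  define \<phi> where "\<phi> T = (\<Sum>i\<le>n. \<Sum>j\<le>m. field_scale (T i j) (G i j))" for T :: "nat \<Rightarrow> cseq"
  have linear: "Vector_Spaces.linear tensor_scale field_scale \<phi>"
    unfolding \<phi>_def
    by unfold_locales (simp_all add: fields.scale_left_distrib sum.distrib pointwise fields.scale_sum_right)
  interpret \<phi>: Vector_Spaces.linear tensor_scale field_scale \<phi>
    by (fact linear)
  have BL: "fields.span B \<subseteq> L"
    using L by (intro fields.span_minimal) (auto simp: B_def)
  have act_0: "act (block_diag A D) 0 = 0" if "A \<in> sl2" "D \<in> sl2" for A D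
    using lin[OF that, of 0 0 1] fields.subspace_0[OF L(1)] by simp
  have act_sum: "act (block_diag A D) (\<Sum>i\<in>I. field_scale (c i) (g i))
      = (\<Sum>i\<in>I. field_scale (c i) (act (block_diag A D) (g i)))
      \<and> (\<Sum>i\<in>I. field_scale (c i) (g i)) \<in> L"
    if "A \<in> sl2" "D \<in> sl2" "finite I" "\<And>i. i \<in> I \<Longrightarrow> g i \<in> L" for A D c g and I :: "nat set"
    using that(3,4)
  proof (induction I rule: finite_induct)
    case (insert i I)
    then show ?case
      using L(1) by (simp add: lin[OF that(1,2)] fields.subspace_add fields.subspace_scale)
  qed (use L(1) in \<open>simp_all add: act_0[OF that(1,2)] fields.subspace_0\<close>)
  let ?TS = "tensor_space (model_space n) (model_space m)"
  have weightA: "act (block_diag slH 0) (G i j) = field_scale (2 * of_nat i - of_nat n) (G i j)"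
    and weightD: "act (block_diag 0 slH) (G i j) = field_scale (of_nat m - 2 * of_nat j) (G i j)"
    if "i \<le> n" "j \<le> m" for i j
    unfolding act[OF sl2_basis(1) sl2_closed(1) that] act[OF sl2_closed(1) sl2_basis(1) that]
    by (intro field_eqI, simp add: ladder_def field_scale_nth pointwise, simp add: algebra_simps)+
  have "inj_on \<phi> ?TS"
  proof (rule inj_onI)
    fix S T assume ST: "S \<in> ?TS" "T \<in> ?TS" "\<phi> S = \<phi> T"
    define R where "R = S - T"
    have R: "\<phi> R = 0"
      using ST by (simp add: R_def \<phi>.diff)
    have "R p q = 0" for p q
    proof (rule ccontr)
      assume Rpq: "R p q \<noteq> 0"
      then have pq: "p \<le> n" "q \<le> m"
        using ST unfolding tensor_space_model R_def by (auto simp: pointwise not_less[symmetric])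
      let ?P = "({..n} \<times> {..m}) - {(p, q)}"
      define C where "C = (\<lambda>(i, j). G i j) ` ?P"
      have "\<phi> R = (\<Sum>(i, j)\<in>{..n} \<times> {..m}. field_scale (R i j) (G i j))"
        by (simp add: \<phi>_def sum.cartesian_product)
      also have "\<dots> = field_scale (R p q) (G p q) + (\<Sum>(i, j)\<in>?P. field_scale (R i j) (G i j))"
        using pq by (subst sum.remove[of _ "(p, q)"]) auto
      finally have "field_scale (R p q) (G p q) = - (\<Sum>(i, j)\<in>?P. field_scale (R i j) (G i j))"
        using R by (simp add: eq_neg_iff_add_eq_0)
      also have "\<dots> \<in> fields.span C"
      proof (intro fields.span_neg fields.span_sum)
        fix x assume "x \<in> ?P"
        then have "(\<lambda>(i, j). G i j) x \<in> C"
          unfolding C_def by (rule imageI)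
        then show "(case x of (i, j) \<Rightarrow> field_scale (R i j) (G i j)) \<in> fields.span C"
          by (auto intro: fields.span_scale fields.span_base split: prod.splits)
      qed
      finally have "field_scale (1 / R p q) (field_scale (R p q) (G p q)) \<in> fields.span C"
        by (rule fields.span_scale)
      then have G: "G p q \<in> fields.span C"
        using Rpq by simp
      have CB: "C \<subseteq> B"
        by (auto simp: C_def B_def)
      \<comment> \<open>no element of \<open>C\<close> has both weights of \<open>G p q\<close>, so filtering by weights leaves nothing\<close>
      have "G p q \<in> fields.span {b \<in> C. act (block_diag slH 0) b = field_scale (2 * of_nat p - of_nat n) b}"
        using fields.span_mono[OF CB] BL pq
        by (intro fields.eigen_span[OF G] lin[OF sl2_basis(1) sl2_closed(1)] weightA) (auto simp: C_def weightA)
      then have "G p q \<in> fields.span {b \<in> {b \<in> C. act (block_diag slH 0) b = field_scale (2 * of_nat p - of_nat n) b}.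
          act (block_diag 0 slH) b = field_scale (of_nat m - 2 * of_nat q) b}"
        by (rule fields.eigen_span)
          (use fields.span_mono[of "{b \<in> C. act (block_diag slH 0) b = field_scale (2 * of_nat p - of_nat n) b}" B] CB BL pq
            in \<open>auto simp: C_def weightD intro!: lin[OF sl2_closed(1) sl2_basis(1)]\<close>)
      also have "{b \<in> {b \<in> C. act (block_diag slH 0) b = field_scale (2 * of_nat p - of_nat n) b}.
          act (block_diag 0 slH) b = field_scale (of_nat m - 2 * of_nat q) b} = {}"
        using nz pq by (auto simp: C_def weightA weightD)
      finally show False
        using nz[OF pq] by simp
    qed
    then show "S = T"
      by (simp add: R_def fun_eq_iff pointwise)
  qed
  moreover have "\<phi> ` ?TS = fields.span B"
  proof
    show "\<phi> ` ?TS \<subseteq> fields.span B"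
    proof (rule image_subsetI)
      fix T :: "nat \<Rightarrow> cseq"
      have "G i j \<in> fields.span B" if "i \<le> n" "j \<le> m" for i j
        using that by (intro fields.span_base) (auto simp: B_def)
      then show "\<phi> T \<in> fields.span B"
        unfolding \<phi>_def by (intro fields.span_sum fields.span_scale) auto
    qed
    show "fields.span B \<subseteq> \<phi> ` ?TS"
    proof (rule fields.span_minimal)
      show "fields.subspace (\<phi> ` ?TS)"
        unfolding tensor_space_def by (intro \<phi>.subspace_image tensors.subspace_span)
      show "B \<subseteq> \<phi> ` ?TS"
      proof
        fix b assume "b \<in> B"
        then obtain p q where pq: "b = G p q" "p \<le> n" "q \<le> m"
          by (auto simp: B_def)
        have "\<phi> (pure_tensor (unit_seq p) (unit_seq q)) = (\<Sum>i\<le>n. if p = i then (\<Sum>j\<le>m. if q = j then G i j else 0) else 0)"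
          unfolding \<phi>_def
        proof (intro sum.cong[OF refl])
          fix i
          have "(\<Sum>j\<le>m. field_scale (pure_tensor (unit_seq p) (unit_seq q) i j) (G i j))
              = (\<Sum>j\<le>m. if p = i then if q = j then G i j else 0 else 0)"
            by (intro sum.cong[OF refl]) (simp add: pure_tensor_def unit_seq_def)
          then show "(\<Sum>j\<le>m. field_scale (pure_tensor (unit_seq p) (unit_seq q) i j) (G i j))
              = (if p = i then \<Sum>j\<le>m. if q = j then G i j else 0 else 0)"
            by (cases "p = i") simp_all
        qed
        also have "\<dots> = b"
          using pq by (simp add: sum.delta)
        finally show "b \<in> \<phi> ` ?TS"
          using pq unfolding tensor_space_def
          by (force intro: tensors.span_base unit_seq_in_model)
      qed
    qed
  qed
  ultimately have bij: "bij_betw \<phi> ?TS (cspan B)"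
    by (simp add: bij_betw_def cspan_def)
  have "act (block_diag A D) (\<phi> (pure_tensor v w))
      = \<phi> (pure_tensor (model_rho n A v) w + pure_tensor v (model_rho m (dual D) w))"
    if AD: "A \<in> sl2" "D \<in> sl2" and v: "v \<in> model_space n" and w: "w \<in> model_space m" for A D v w
  proof -
    have 1: "\<phi> (pure_tensor v w) = (\<Sum>i\<le>n. field_scale (v i) (\<Sum>j\<le>m. field_scale (w j) (G i j)))" for v w
      by (simp add: \<phi>_def pure_tensor_def fields.scale_sum_right)
    have 2: "\<phi> (pure_tensor v w) = (\<Sum>j\<le>m. field_scale (w j) (\<Sum>i\<le>n. field_scale (v i) (G i j)))" for v w
      by (simp add: \<phi>_def pure_tensor_def fields.scale_sum_right mult.commute) (rule sum.swap)
    have inner: "act (block_diag A D) (\<Sum>j\<le>m. field_scale (w j) (G i j))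
        = (\<Sum>j\<le>m. field_scale (w j) (act (block_diag A D) (G i j)))"
      "(\<Sum>j\<le>m. field_scale (w j) (G i j)) \<in> L" if "i \<le> n" for i
      using act_sum[OF AD, of "{..m}" "G i" w] L(2) that by auto
    have "act (block_diag A D) (\<phi> (pure_tensor v w))
        = (\<Sum>i\<le>n. field_scale (v i) (\<Sum>j\<le>m. field_scale (w j) (act (block_diag A D) (G i j))))"
      using act_sum[OF AD, of "{..n}" "\<lambda>i. \<Sum>j\<le>m. field_scale (w j) (G i j)" v] inner
      by (simp add: 1)
    also have "\<dots> = (\<Sum>i\<le>n. \<Sum>j\<le>m. field_scale (v i * w j) (act (block_diag A D) (G i j)))"
      by (simp add: fields.scale_sum_right)
    also have "\<dots> = (\<Sum>i\<le>n. \<Sum>j\<le>m. field_scale (v i * w j) (ladder n A (\<lambda>i. G i j) i))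
        + (\<Sum>i\<le>n. \<Sum>j\<le>m. field_scale (v i * w j) (ladder m (dual D) (G i) j))"
      by (simp add: act[OF AD] fields.scale_right_distrib sum.distrib)
    also have "(\<Sum>i\<le>n. \<Sum>j\<le>m. field_scale (v i * w j) (ladder n A (\<lambda>i. G i j) i))
        = (\<Sum>j\<le>m. field_scale (w j) (\<Sum>i\<le>n. field_scale (v i) (ladder n A (\<lambda>i. G i j) i)))"
      by (simp add: fields.scale_sum_right mult.commute) (rule sum.swap)
    also have "\<dots> = \<phi> (pure_tensor (model_rho n A v) w)"
      unfolding 2 sum_model_rho[OF v] ..
    also have "(\<Sum>i\<le>n. \<Sum>j\<le>m. field_scale (v i * w j) (ladder m (dual D) (G i) j))
        = (\<Sum>i\<le>n. field_scale (v i) (\<Sum>j\<le>m. field_scale (w j) (ladder m (dual D) (G i) j)))"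
      by (simp add: fields.scale_sum_right)
    also have "\<dots> = \<phi> (pure_tensor v (model_rho m (dual D) w))"
      unfolding 1 sum_model_rho[OF w] ..
    finally show ?thesis
      by (simp add: \<phi>.add)
  qed
  then show ?thesis
    unfolding iso_box_def
    using model_is_V[of n] dual_is_V[OF model_is_V[of m]] linear bij by blast
qed

text \<open>
  This covers the degenerate types with a factor \<open>V\<^sub>j\<close>, \<open>j < 0\<close>, which occur for \<open>l = 0\<close> and \<open>l = 1/2\<close>.
\<close>

lemma iso_box_zero:
  assumes "is_V j V \<rho>" "is_V k W \<sigma>" "j < 0 \<or> k < 0" "\<And>X. act X 0 = 0"
  shows "iso_box act j k {0}"
proof -
  have "V = {0} \<or> W = {0}"
    using assms by (auto simp: is_V_def)
  then have "{pure_tensor v w | v w. v \<in> V \<and> w \<in> W} \<subseteq> {0}"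
    by (auto simp: pure_tensor_def fun_eq_iff pointwise)
  then have "tensor_space V W \<subseteq> {0}"
    unfolding tensor_space_def by (intro tensors.span_minimal) (auto intro: tensors.subspace_single_0)
  then have TS: "tensor_space V W = {0}"
    unfolding tensor_space_def using tensors.span_zero by blast
  have lin: "Vector_Spaces.linear tensor_scale field_scale (\<lambda>T. 0)"
    by unfold_locales auto
  show ?thesis
    unfolding iso_box_def
    by (rule exI[of _ V], rule exI[of _ \<rho>], rule exI[of _ W], rule exI[of _ \<sigma>], rule exI[of _ "\<lambda>T. 0"])
      (use assms lin TS in auto)
qed

section \<open>Differentiation of Laurent functions\<close>

definition dd :: "hc \<Rightarrow> (hc \<Rightarrow> complex) \<Rightarrow> hc \<Rightarrow> complex" where
  "dd E f = ext0 (\<lambda>Z. deriv (\<lambda>w. f (Z + hscale w E)) 0)"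

text \<open>
  The group action moves a point along curves that are rational in the parameter, so directional
  derivatives along straight lines are not enough: the chain rule is needed for every curve with
  velocity \<open>E\<close> at \<open>Z\<close>.
\<close>

definition curve_at :: "(complex \<Rightarrow> hc) \<Rightarrow> hc \<Rightarrow> hc \<Rightarrow> bool" where
  "curve_at \<gamma> Z E \<longleftrightarrow> \<gamma> 0 = Z \<and> (\<forall>i j. ((\<lambda>t. \<gamma> t $ i $ j) has_field_derivative E $ i $ j) (at 0))"

text \<open>
  The derivative of \<open>det\<close> at \<open>Z\<close> in the direction \<open>E\<close>; it is bilinear and symmetric.
\<close>

definition ddet :: "hc \<Rightarrow> hc \<Rightarrow> complex" where
  "ddet E Z = E $ 1 $ 1 * Z $ 2 $ 2 + Z $ 1 $ 1 * E $ 2 $ 2 - E $ 1 $ 2 * Z $ 2 $ 1 - Z $ 1 $ 2 * E $ 2 $ 1"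

lemma curve_at_0: "curve_at \<gamma> Z E \<Longrightarrow> \<gamma> 0 = Z"
  by (simp add: curve_at_def)

lemma curve_at_nth: "curve_at \<gamma> Z E \<Longrightarrow> ((\<lambda>t. \<gamma> t $ i $ j) has_field_derivative E $ i $ j) (at 0)"
  by (simp add: curve_at_def)

lemma curve_line: "curve_at (\<lambda>w. Z + hscale w E) Z E"
  by (auto simp: curve_at_def hc_eq_iff intro!: derivative_eq_intros)

lemma curve_det:
  assumes "curve_at \<gamma> Z E"
  shows "((\<lambda>t. det (\<gamma> t)) has_field_derivative ddet E Z) (at 0)"
  unfolding det_2 ddet_def
  by (rule derivative_eq_intros curve_at_nth[OF assms] refl)+ (simp add: curve_at_0[OF assms])

text \<open>
  Being regular is an open condition, so the extension by zero does not affect derivatives at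
  regular points.
\<close>

lemma curve_ext0:
  assumes \<gamma>: "curve_at \<gamma> Z E" and Z: "det Z \<noteq> 0"
    and g: "((\<lambda>t. g (\<gamma> t)) has_field_derivative d) (at 0)"
  shows "((\<lambda>t. ext0 g (\<gamma> t)) has_field_derivative d) (at 0)"
proof -
  have "isCont (\<lambda>t. det (\<gamma> t)) 0"
    using curve_det[OF \<gamma>] by (rule DERIV_isCont)
  then have "\<forall>\<^sub>F t in nhds 0. det (\<gamma> t) \<noteq> 0"
    using Z curve_at_0[OF \<gamma>]
    by (intro tendsto_imp_eventually_ne[of _ "det (\<gamma> 0)"]) (auto simp: isCont_def tendsto_at_iff_tendsto_nhds[of "\<lambda>t. det (\<gamma> t)"])
  then have "\<forall>\<^sub>F t in nhds 0. g (\<gamma> t) = ext0 g (\<gamma> t)"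
    by eventually_elim (simp add: ext0_def)
  then show ?thesis
    using g by (subst (asm) DERIV_cong_ev[OF refl _ refl]) auto
qed

lemma ext0_singular [simp]: "det Z = 0 \<Longrightarrow> ext0 f Z = 0"
  by (simp add: ext0_def)

lemma ext0_regular [simp]: "det Z \<noteq> 0 \<Longrightarrow> ext0 f Z = f Z"
  by (simp add: ext0_def)

lemma dd_singular [simp]: "det Z = 0 \<Longrightarrow> dd E f Z = 0"
  by (simp add: dd_def)

lemma laurent_singular: "f \<in> laurent \<Longrightarrow> det Z = 0 \<Longrightarrow> f Z = 0"
  by (induction rule: laurent.induct) auto

lemma coord_curve:
  assumes "curve_at \<gamma> Z E"
  shows "((\<lambda>t. coord p (\<gamma> t)) has_field_derivative coord p E) (at 0)"
  unfolding coord_def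
  by (auto intro!: derivative_eq_intros curve_at_nth[OF assms])

text \<open>
  Total differentiability at \<open>Z\<close>, with the entries of \<open>G\<close> as partial derivatives, in the form of the
  chain rule.
\<close>

definition has_gradient :: "(hc \<Rightarrow> complex) \<Rightarrow> hc \<Rightarrow> hc \<Rightarrow> bool" where
  "has_gradient f Z G \<longleftrightarrow> (\<forall>E \<gamma>. curve_at \<gamma> Z E \<longrightarrow> ((\<lambda>t. f (\<gamma> t)) has_field_derivative
     (G $ 1 $ 1 * E $ 1 $ 1 + G $ 1 $ 2 * E $ 1 $ 2 + G $ 2 $ 1 * E $ 2 $ 1 + G $ 2 $ 2 * E $ 2 $ 2)) (at 0))"

lemma has_gradientI:
  assumes "\<And>E \<gamma>. curve_at \<gamma> Z E \<Longrightarrow> ((\<lambda>t. f (\<gamma> t)) has_field_derivative d E) (at 0)"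
    and "\<And>E. d E = p * E $ 1 $ 1 + q * E $ 1 $ 2 + r * E $ 2 $ 1 + s * E $ 2 $ 2"
  shows "has_gradient f Z (hmat p q r s)"
  using assms by (simp add: has_gradient_def)

lemma has_gradientD:
  "has_gradient f Z G \<Longrightarrow> curve_at \<gamma> Z E \<Longrightarrow> ((\<lambda>t. f (\<gamma> t)) has_field_derivative
     (G $ 1 $ 1 * E $ 1 $ 1 + G $ 1 $ 2 * E $ 1 $ 2 + G $ 2 $ 1 * E $ 2 $ 1 + G $ 2 $ 2 * E $ 2 $ 2)) (at 0)"
  by (simp add: has_gradient_def)

lemma laurent_gradient:
  assumes "f \<in> laurent" "det Z \<noteq> 0"
  shows "\<exists>G. has_gradient f Z G"
  using assms(1)
proof (induction rule: laurent.induct)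
  case (const c)
  have "has_gradient (ext0 (\<lambda>Z. c)) Z (hmat 0 0 0 0)"
    using assms(2) by (intro has_gradientI[where d = "\<lambda>E. 0"] curve_ext0) auto
  then show ?case ..
next
  case (coord p)
  have "has_gradient (ext0 (coord p)) Z (hmat (coord p (hmat 1 0 0 0)) (coord p (hmat 0 1 0 0))
      (coord p (hmat 0 0 1 0)) (coord p (hmat 0 0 0 1)))"
    using assms(2)
    by (intro has_gradientI[where d = "coord p"] curve_ext0 coord_curve) (simp_all add: coord_def field_simps)
  then show ?case ..
next
  case inv_norm
  have "((\<lambda>t. ext0 (\<lambda>Z. 1 / det Z) (\<gamma> t)) has_field_derivative - ddet E Z / (det Z)^2) (at 0)"
    if "curve_at \<gamma> Z E" for E \<gamma>
    using assms(2) curve_at_0[OF that]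
    by (intro curve_ext0[OF that])
      (auto intro!: derivative_eq_intros curve_det[OF that] simp: power2_eq_square)
  then have "has_gradient (ext0 (\<lambda>Z. 1 / det Z)) Z (hmat (- Z $ 2 $ 2 / (det Z)^2) (Z $ 2 $ 1 / (det Z)^2)
      (Z $ 1 $ 2 / (det Z)^2) (- Z $ 1 $ 1 / (det Z)^2))"
    using assms(2) by (intro has_gradientI) (auto simp: ddet_def field_simps)
  then show ?case ..
next
  case (add f g)
  then obtain F G where FG: "has_gradient f Z F" "has_gradient g Z G" by blast
  have "((\<lambda>t. f (\<gamma> t) + g (\<gamma> t)) has_field_derivative
      (F $ 1 $ 1 * E $ 1 $ 1 + F $ 1 $ 2 * E $ 1 $ 2 + F $ 2 $ 1 * E $ 2 $ 1 + F $ 2 $ 2 * E $ 2 $ 2)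
      + (G $ 1 $ 1 * E $ 1 $ 1 + G $ 1 $ 2 * E $ 1 $ 2 + G $ 2 $ 1 * E $ 2 $ 1 + G $ 2 $ 2 * E $ 2 $ 2)) (at 0)"
    if \<gamma>: "curve_at \<gamma> Z E" for E \<gamma>
    using DERIV_add[OF has_gradientD[OF FG(1) \<gamma>] has_gradientD[OF FG(2) \<gamma>]] .
  then have "has_gradient (\<lambda>Z. f Z + g Z) Z (hmat (F $ 1 $ 1 + G $ 1 $ 1) (F $ 1 $ 2 + G $ 1 $ 2)
      (F $ 2 $ 1 + G $ 2 $ 1) (F $ 2 $ 2 + G $ 2 $ 2))"
    by (intro has_gradientI) (auto simp: algebra_simps)
  then show ?case ..
next
  case (mult f g)
  then obtain F G where FG: "has_gradient f Z F" "has_gradient g Z G" by blast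
  have "((\<lambda>t. f (\<gamma> t) * g (\<gamma> t)) has_field_derivative
      (F $ 1 $ 1 * E $ 1 $ 1 + F $ 1 $ 2 * E $ 1 $ 2 + F $ 2 $ 1 * E $ 2 $ 1 + F $ 2 $ 2 * E $ 2 $ 2) * g Z
      + (G $ 1 $ 1 * E $ 1 $ 1 + G $ 1 $ 2 * E $ 1 $ 2 + G $ 2 $ 1 * E $ 2 $ 1 + G $ 2 $ 2 * E $ 2 $ 2) * f Z) (at 0)"
    if \<gamma>: "curve_at \<gamma> Z E" for E \<gamma>
    using DERIV_mult[OF has_gradientD[OF FG(1) \<gamma>] has_gradientD[OF FG(2) \<gamma>]]
    by (simp only: curve_at_0[OF \<gamma>])
  then have "has_gradient (\<lambda>Z. f Z * g Z) Z
     (hmat (F $ 1 $ 1 * g Z + f Z * G $ 1 $ 1) (F $ 1 $ 2 * g Z + f Z * G $ 1 $ 2)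
      (F $ 2 $ 1 * g Z + f Z * G $ 2 $ 1) (F $ 2 $ 2 * g Z + f Z * G $ 2 $ 2))"
    by (intro has_gradientI) (auto simp: algebra_simps)
  then show ?case ..
qed

lemma dd_eqI:
  assumes "det Z \<noteq> 0"
    and "\<And>\<gamma>. curve_at \<gamma> Z E \<Longrightarrow> ((\<lambda>t. f (\<gamma> t)) has_field_derivative d) (at 0)"
  shows "dd E f Z = d"
  using DERIV_imp_deriv[OF assms(2)[OF curve_line]] assms(1) by (simp add: dd_def)

lemma dd_gradient:
  assumes "det Z \<noteq> 0" "has_gradient f Z G"
  shows "dd E f Z = G $ 1 $ 1 * E $ 1 $ 1 + G $ 1 $ 2 * E $ 1 $ 2 + G $ 2 $ 1 * E $ 2 $ 1 + G $ 2 $ 2 * E $ 2 $ 2"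
  by (rule dd_eqI[OF assms(1)]) (rule has_gradientD[OF assms(2)])

lemma laurent_curve:
  assumes f: "f \<in> laurent" and Z: "det Z \<noteq> 0" and \<gamma>: "curve_at \<gamma> Z E"
  shows "((\<lambda>t. f (\<gamma> t)) has_field_derivative dd E f Z) (at 0)"
proof -
  obtain G where G: "has_gradient f Z G"
    using laurent_gradient[OF f Z] ..
  from has_gradientD[OF G \<gamma>] show ?thesis
    by (simp only: dd_gradient[OF Z G])
qed

lemma dd_expand:
  assumes f: "f \<in> laurent"
  shows "dd E f Z = E $ 1 $ 1 * dd (hmat 1 0 0 0) f Z + E $ 1 $ 2 * dd (hmat 0 1 0 0) f Z
     + E $ 2 $ 1 * dd (hmat 0 0 1 0) f Z + E $ 2 $ 2 * dd (hmat 0 0 0 1) f Z"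
proof (cases "det Z = 0")
  case False
  then obtain G where G: "has_gradient f Z G"
    using laurent_gradient[OF f] by blast
  show ?thesis
    by (simp add: dd_gradient[OF False G])
qed simp

lemma dd_add: "f \<in> laurent \<Longrightarrow> g \<in> laurent \<Longrightarrow> dd E (\<lambda>Z. f Z + g Z) Z = dd E f Z + dd E g Z"
  by (cases "det Z = 0") (auto intro!: dd_eqI derivative_eq_intros laurent_curve)

lemma dd_mult:
  assumes "f \<in> laurent" "g \<in> laurent"
  shows "dd E (\<lambda>Z. f Z * g Z) Z = dd E f Z * g Z + f Z * dd E g Z"
proof (cases "det Z = 0")
  case False
  show ?thesis
  proof (rule dd_eqI[OF False])
    fix \<gamma> assume \<gamma>: "curve_at \<gamma> Z E"
    show "((\<lambda>t. f (\<gamma> t) * g (\<gamma> t)) has_field_derivative dd E f Z * g Z + f Z * dd E g Z) (at 0)"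
      by (rule DERIV_cong[OF DERIV_mult[OF laurent_curve[OF assms(1) False \<gamma>] laurent_curve[OF assms(2) False \<gamma>]]])
        (simp add: curve_at_0[OF \<gamma>])
  qed
qed simp

lemma dd_ext0:
  assumes "det Z \<noteq> 0" and "\<And>\<gamma>. curve_at \<gamma> Z E \<Longrightarrow> ((\<lambda>t. f (\<gamma> t)) has_field_derivative d) (at 0)"
  shows "dd E (ext0 f) Z = d"
  using assms by (intro dd_eqI curve_ext0) auto

lemma dd_const: "dd E (ext0 (\<lambda>Z. c)) Z = 0"
  by (cases "det Z = 0") (auto intro!: dd_ext0 derivative_eq_intros)

lemma dd_cmult: "f \<in> laurent \<Longrightarrow> dd E (\<lambda>Z. c * f Z) Z = c * dd E f Z"
  by (cases "det Z = 0") (auto intro!: dd_eqI derivative_eq_intros laurent_curve)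

lemma laurent_cmult: "f \<in> laurent \<Longrightarrow> (\<lambda>Z. c * f Z) \<in> laurent"
proof -
  assume f: "f \<in> laurent"
  have "(\<lambda>Z. ext0 (\<lambda>Z. c) Z * f Z) = (\<lambda>Z. c * f Z)"
    using laurent_singular[OF f] by (auto simp: ext0_def)
  then show ?thesis
    using laurent.mult[OF laurent.const f, of c] by simp
qed

lemma laurent_diff: "f \<in> laurent \<Longrightarrow> g \<in> laurent \<Longrightarrow> (\<lambda>Z. f Z - g Z) \<in> laurent"
  using laurent.add[OF _ laurent_cmult[of g "-1"], of f] by simp

lemma laurent_uminus: "f \<in> laurent \<Longrightarrow> (\<lambda>Z. - f Z) \<in> laurent"
  using laurent_cmult[of f "-1"] by simp

lemma laurent_0: "(\<lambda>Z. 0) \<in> laurent"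
proof -
  have "ext0 (\<lambda>Z. 0::complex) = (\<lambda>Z. 0)"
    by (auto simp: ext0_def)
  then show ?thesis
    using laurent.const[of 0] by simp
qed

lemma dd_coord: "dd E (ext0 (coord p)) = ext0 (\<lambda>Z. coord p E)"
proof
  fix Z
  show "dd E (ext0 (coord p)) Z = ext0 (\<lambda>Z. coord p E) Z"
    by (cases "det Z = 0") (auto intro!: dd_ext0 coord_curve)
qed

lemma laurent_entry: "ext0 (\<lambda>Z. Z $ i $ j) \<in> laurent"
proof -
  have c: "ext0 (coord p) \<in> laurent" if "p < 4" for p
    using that by (rule laurent.coord)
  have ii: "\<i> * (\<i> * x) = - x" for x
    by (simp add: complex_eq_iff)
  have "ext0 (\<lambda>Z. Z $ 1 $ 1) = (\<lambda>Z. ext0 (coord 0) Z + (- \<i>) * ext0 (coord 3) Z)"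
    "ext0 (\<lambda>Z. Z $ 2 $ 2) = (\<lambda>Z. ext0 (coord 0) Z + \<i> * ext0 (coord 3) Z)"
    "ext0 (\<lambda>Z. Z $ 1 $ 2) = (\<lambda>Z. (- \<i>) * ext0 (coord 1) Z + (-1) * ext0 (coord 2) Z)"
    "ext0 (\<lambda>Z. Z $ 2 $ 1) = (\<lambda>Z. (- \<i>) * ext0 (coord 1) Z + ext0 (coord 2) Z)"
    by (auto simp: ext0_def coord_def fun_eq_iff ii field_simps)
  then have "ext0 (\<lambda>Z. Z $ 1 $ 1) \<in> laurent" "ext0 (\<lambda>Z. Z $ 2 $ 2) \<in> laurent"
      "ext0 (\<lambda>Z. Z $ 1 $ 2) \<in> laurent" "ext0 (\<lambda>Z. Z $ 2 $ 1) \<in> laurent"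
    by (simp_all only: laurent.add laurent_cmult c zero_less_numeral one_less_numeral_iff semiring_norm rel_simps)
  moreover have "i = 1 \<or> i = 2" "j = 1 \<or> j = 2"
    using exhaust_2 by auto
  ultimately show ?thesis
    by auto
qed

lemma ext0_add: "ext0 (\<lambda>Z. f Z + g Z) = (\<lambda>Z. ext0 f Z + ext0 g Z)" for f g :: "hc \<Rightarrow> complex"
  by (auto simp: ext0_def)

lemma ext0_diff: "ext0 (\<lambda>Z. f Z - g Z) = (\<lambda>Z. ext0 f Z - ext0 g Z)" for f g :: "hc \<Rightarrow> complex"
  by (auto simp: ext0_def)

lemma ext0_mult: "ext0 (\<lambda>Z. f Z * g Z) = (\<lambda>Z. ext0 f Z * ext0 g Z)" for f g :: "hc \<Rightarrow> complex"
  by (auto simp: ext0_def)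

lemma laurent_ext0_mult: "ext0 f \<in> laurent \<Longrightarrow> ext0 g \<in> laurent \<Longrightarrow> ext0 (\<lambda>Z. f Z * g Z) \<in> laurent"
  unfolding ext0_mult by (rule laurent.mult)

lemma laurent_ext0_diff: "ext0 f \<in> laurent \<Longrightarrow> ext0 g \<in> laurent \<Longrightarrow> ext0 (\<lambda>Z. f Z - g Z) \<in> laurent"
  unfolding ext0_diff by (rule laurent_diff)

lemma laurent_ext0_add: "ext0 f \<in> laurent \<Longrightarrow> ext0 g \<in> laurent \<Longrightarrow> ext0 (\<lambda>Z. f Z + g Z) \<in> laurent"
  unfolding ext0_add by (rule laurent.add)

lemma laurent_det_power: "ext0 (\<lambda>Z. det Z powi p) \<in> laurent"
proof -
  have d: "ext0 det \<in> laurent"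
    unfolding det_2 by (intro laurent_ext0_diff laurent_ext0_mult laurent_entry)
  have "ext0 (\<lambda>Z. det Z ^ n) \<in> laurent" for n
    by (induction n) (simp_all add: laurent.const laurent_ext0_mult d)
  moreover have "ext0 (\<lambda>Z. (1 / det Z) ^ n) \<in> laurent" for n
    by (induction n) (simp_all only: power_Suc power_0 laurent.const laurent_ext0_mult laurent.inv_norm)
  ultimately show ?thesis
    by (cases "p \<ge> 0") (simp_all add: power_int_def inverse_eq_divide power_one_over)
qed

lemma dd_laurent: "f \<in> laurent \<Longrightarrow> dd E f \<in> laurent"
proof (induction rule: laurent.induct)
  case (const c)
  have "dd E (ext0 (\<lambda>Z. c)) = (\<lambda>Z. 0)"
    by (simp add: fun_eq_iff dd_const)
  then show ?case
    by (simp add: laurent_0)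
next
  case (coord p)
  show ?case
    by (simp add: dd_coord laurent.const)
next
  case inv_norm
  have "dd E (ext0 (\<lambda>Z. 1 / det Z)) = ext0 (\<lambda>Z. - 1 * ((ddet E Z * (1 / det Z)) * (1 / det Z)))"
  proof
    fix Z
    show "dd E (ext0 (\<lambda>Z. 1 / det Z)) Z = ext0 (\<lambda>Z. - 1 * ((ddet E Z * (1 / det Z)) * (1 / det Z))) Z"
    proof (cases "det Z = 0")
      case False
      have "((\<lambda>t. 1 / det (\<gamma> t)) has_field_derivative - 1 * ((ddet E Z * (1 / det Z)) * (1 / det Z))) (at 0)"
        if \<gamma>: "curve_at \<gamma> Z E" for \<gamma>
        using False curve_at_0[OF \<gamma>] by (auto intro!: derivative_eq_intros curve_det[OF \<gamma>])
      then show ?thesis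
        using dd_ext0[OF False, of E "\<lambda>Z. 1 / det Z"] False by simp
    qed simp
  qed
  moreover have "ext0 (\<lambda>Z. ddet E Z) \<in> laurent"
    unfolding ddet_def
    by (intro laurent_ext0_add laurent_ext0_diff laurent_ext0_mult laurent_entry laurent.const)
  ultimately show ?case
    by (simp only: laurent_ext0_mult laurent.const laurent.inv_norm)
next
  case (add f g)
  then have "dd E (\<lambda>Z. f Z + g Z) = (\<lambda>Z. dd E f Z + dd E g Z)"
    by (simp add: fun_eq_iff dd_add)
  with add show ?case
    by (simp add: laurent.add)
next
  case (mult f g)
  then have "dd E (\<lambda>Z. f Z * g Z) = (\<lambda>Z. dd E f Z * g Z + f Z * dd E g Z)"
    by (simp add: fun_eq_iff dd_mult)
  with mult show ?case
    by (simp add: laurent.add laurent.mult)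
qed

section \<open>Coefficients of products of powers of two linear forms\<close>

text \<open>
  \<open>Sb b i\<close> is the coefficient of \<open>s\<^sup>i\<close> in \<open>y\<^sup>b\<close> and \<open>S a b i\<close> the one in \<open>x\<^sup>a y\<^sup>b\<close>, for the linear forms
  \<open>x = s z\<^sub>2\<^sub>2 - z\<^sub>2\<^sub>1\<close> and \<open>y = z\<^sub>1\<^sub>1 - s z\<^sub>1\<^sub>2\<close>. The index \<open>i\<close> is an integer, and coefficients outside
  \<open>0..a+b\<close> are zero, which keeps the recursions free of case distinctions.
\<close>

primrec Sb :: "nat \<Rightarrow> int \<Rightarrow> hc \<Rightarrow> complex" where
  "Sb 0 i Z = (if i = 0 then 1 else 0)"
| "Sb (Suc b) i Z = Z $ 1 $ 1 * Sb b i Z - Z $ 1 $ 2 * Sb b (i - 1) Z"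

primrec S :: "nat \<Rightarrow> nat \<Rightarrow> int \<Rightarrow> hc \<Rightarrow> complex" where
  "S 0 b i Z = Sb b i Z"
| "S (Suc a) b i Z = Z $ 2 $ 2 * S a b (i - 1) Z - Z $ 2 $ 1 * S a b i Z"

lemma S_Suc_right: "S a (Suc b) i Z = Z $ 1 $ 1 * S a b i Z - Z $ 1 $ 2 * S a b (i - 1) Z"
proof (induction a arbitrary: i)
  case (Suc a)
  show ?case
    unfolding S.simps Suc.IH by (simp add: algebra_simps)
qed simp

lemma S_0_0: "S 0 0 i Z = (if i = 0 then 1 else 0)"
  by simp

declare S.simps(1) [simp del]

text \<open>
  It suffices to raise \<open>b\<close> while \<open>a = 0\<close>, where \<open>S\<close> reduces to \<open>Sb\<close>.
\<close>

lemma S_induct [case_names 0 left right]: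
  assumes "P 0 0" "\<And>a b. P a b \<Longrightarrow> P (Suc a) b" "\<And>b. P 0 b \<Longrightarrow> P 0 (Suc b)"
  shows "P a b"
proof (induction a)
  case 0
  show ?case by (induction b) (auto intro: assms)
qed (auto intro: assms)

lemma S_out_of_range: "i < 0 \<or> i > int (a + b) \<Longrightarrow> S a b i Z = 0"
  by (induction a b arbitrary: i rule: S_induct) (auto simp: S_0_0 S_Suc_right)

text \<open>
  The product rule for \<open>x\<^sup>a y\<^sup>b\<close>: differentiating at \<open>Z\<close> in the direction \<open>E\<close> replaces one factor \<open>x\<close>
  or \<open>y\<close> by the corresponding form built from \<open>E\<close>.
\<close>

definition dS :: "hc \<Rightarrow> nat \<Rightarrow> nat \<Rightarrow> int \<Rightarrow> hc \<Rightarrow> complex" where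
  "dS E a b i Z =
     of_nat a * (E $ 2 $ 2 * S (a - 1) b (i - 1) Z - E $ 2 $ 1 * S (a - 1) b i Z)
     + of_nat b * (E $ 1 $ 1 * S a (b - 1) i Z - E $ 1 $ 2 * S a (b - 1) (i - 1) Z)"

lemma S_left: "a > 0 \<Longrightarrow> S a b i Z = Z $ 2 $ 2 * S (a - 1) b (i - 1) Z - Z $ 2 $ 1 * S (a - 1) b i Z"
  by (cases a) auto

lemma S_right: "b > 0 \<Longrightarrow> S a b i Z = Z $ 1 $ 1 * S a (b - 1) i Z - Z $ 1 $ 2 * S a (b - 1) (i - 1) Z"
  by (cases b) (auto simp: S_Suc_right)

lemma dS_Suc_left: "dS E (Suc a) b i Z
  = E $ 2 $ 2 * S a b (i - 1) Z - E $ 2 $ 1 * S a b i Z + Z $ 2 $ 2 * dS E a b (i - 1) Z - Z $ 2 $ 1 * dS E a b i Z"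
  by (cases a) (simp_all add: dS_def algebra_simps)

lemma dS_Suc_right: "dS E a (Suc b) i Z
  = E $ 1 $ 1 * S a b i Z - E $ 1 $ 2 * S a b (i - 1) Z + Z $ 1 $ 1 * dS E a b i Z - Z $ 1 $ 2 * dS E a b (i - 1) Z"
  by (cases b) (simp_all add: dS_def S_Suc_right algebra_simps)

lemma S_curve:
  assumes \<gamma>: "curve_at \<gamma> Z E"
  shows "((\<lambda>t. S a b i (\<gamma> t)) has_field_derivative dS E a b i Z) (at 0)"
proof (induction a b arbitrary: i rule: S_induct)
  case 0
  then show ?case by (simp add: S_0_0 dS_def)
next
  case (left a b)
  show ?case
    unfolding S.simps dS_Suc_left
    by (rule derivative_eq_intros left curve_at_nth[OF \<gamma>] refl)+
      (simp add: curve_at_0[OF \<gamma>] algebra_simps)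
next
  case (right b)
  show ?case
    unfolding S_Suc_right dS_Suc_right
    by (rule derivative_eq_intros right curve_at_nth[OF \<gamma>] refl)+
      (simp add: curve_at_0[OF \<gamma>] algebra_simps)
qed

text \<open>
  The coefficient identity for \<open>s d/ds\<close> applied to \<open>x\<^sup>a y\<^sup>b\<close>. The next lemma is the complementary
  count of the factors that do not contribute an \<open>s\<close>.
\<close>

lemma S_count:
  "of_int i * S a b i Z
    = of_nat a * Z $ 2 $ 2 * S (a - 1) b (i - 1) Z - of_nat b * Z $ 1 $ 2 * S a (b - 1) (i - 1) Z"
proof (induction a b arbitrary: i rule: S_induct)
  case 0
  then show ?case by (simp add: S_0_0)
next
  case (left a b)
  have "of_int i * S (Suc a) b i Z = Z $ 2 $ 2 * (of_int (i - 1) * S a b (i - 1) Z)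
      + Z $ 2 $ 2 * S a b (i - 1) Z - Z $ 2 $ 1 * (of_int i * S a b i Z)"
    by (simp add: algebra_simps)
  then show ?case
    unfolding left by (cases a; cases b) (simp_all add: S_Suc_right algebra_simps)
next
  case (right b)
  have "of_int i * S 0 (Suc b) i Z = Z $ 1 $ 1 * (of_int i * S 0 b i Z)
      - Z $ 1 $ 2 * (of_int (i - 1) * S 0 b (i - 1) Z) - Z $ 1 $ 2 * S 0 b (i - 1) Z"
    by (simp add: S_Suc_right algebra_simps)
  then show ?case
    unfolding right by (cases b) (simp_all add: S_Suc_right algebra_simps)
qed

lemma S_count': "(of_nat a + of_nat b - of_int i) * S a b i Z
    = - of_nat a * Z $ 2 $ 1 * S (a - 1) b i Z + of_nat b * Z $ 1 $ 1 * S a (b - 1) i Z"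
proof -
  have a: "of_nat a * S a b i Z = of_nat a * (Z $ 2 $ 2 * S (a - 1) b (i - 1) Z - Z $ 2 $ 1 * S (a - 1) b i Z)"
    by (cases "a > 0") (auto simp: S_left)
  have b: "of_nat b * S a b i Z = of_nat b * (Z $ 1 $ 1 * S a (b - 1) i Z - Z $ 1 $ 2 * S a (b - 1) (i - 1) Z)"
    by (cases "b > 0") (auto simp: S_right)
  have "(of_nat a + of_nat b - of_int i) * S a b i Z
      = of_nat a * S a b i Z + of_nat b * S a b i Z - of_int i * S a b i Z"
    by (simp add: algebra_simps)
  then show ?thesis
    unfolding a b S_count by (simp add: algebra_simps)
qed

lemma S_laurent: "ext0 (S a b i) \<in> laurent"
proof -
  have "ext0 (\<lambda>Z. S a b i Z) \<in> laurent"
  proof (induction a b arbitrary: i rule: S_induct)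
    case 0
    show ?case
      unfolding S_0_0 by (rule laurent.const)
  next
    case (left a b)
    show ?case
      unfolding S.simps by (intro laurent_ext0_diff laurent_ext0_mult laurent_entry left)
  next
    case (right b)
    show ?case
      unfolding S_Suc_right by (intro laurent_ext0_diff laurent_ext0_mult laurent_entry right)
  qed
  then show ?thesis by simp
qed

text \<open>
  Multiplication by an entry of \<open>Z\<close> raises the degree in \<open>(x, y)\<close> by one or lowers it by one at the
  price of a factor \<open>N(Z)\<close>: the decomposition of the tensor product with a two-dimensional
  representation. The determinant arises as \<open>z\<^sub>2\<^sub>2 y + z\<^sub>1\<^sub>2 x = N(Z)\<close> and \<open>z\<^sub>2\<^sub>1 y + z\<^sub>1\<^sub>1 x = s N(Z)\<close>.
\<close>

lemma mult_z22_S: "(of_nat a + of_nat b + 1) * Z $ 2 $ 2 * S a b i Z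
    = (of_int i + 1) * S (Suc a) b (i + 1) Z + of_nat b * det Z * S a (b - 1) i Z"
  using S_count[of "i + 1" "Suc a" b Z] by (cases b) (simp_all add: S_Suc_right det_2 algebra_simps)

lemma mult_z21_S: "(of_nat a + of_nat b + 1) * Z $ 2 $ 1 * S a b i Z
    = - (of_nat a + of_nat b + 1 - of_int i) * S (Suc a) b i Z + of_nat b * det Z * S a (b - 1) (i - 1) Z"
  using S_count'[of "Suc a" b i Z] by (cases b) (simp_all add: S_Suc_right det_2 algebra_simps)

lemma mult_z12_S: "(of_nat a + of_nat b + 1) * Z $ 1 $ 2 * S a b i Z
    = - (of_int i + 1) * S a (Suc b) (i + 1) Z + of_nat a * det Z * S (a - 1) b i Z"
  using S_count[of "i + 1" a "Suc b" Z] by (cases a) (simp_all add: S_Suc_right det_2 algebra_simps)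

lemma mult_z11_S: "(of_nat a + of_nat b + 1) * Z $ 1 $ 1 * S a b i Z
    = (of_nat a + of_nat b + 1 - of_int i) * S a (Suc b) i Z + of_nat a * det Z * S (a - 1) b (i - 1) Z"
  using S_count'[of a "Suc b" i Z] by (cases a) (simp_all add: S_Suc_right det_2 algebra_simps)

definition NS :: "int \<Rightarrow> nat \<Rightarrow> nat \<Rightarrow> int \<Rightarrow> hc \<Rightarrow> complex" where
  "NS p a b i = ext0 (\<lambda>Z. det Z powi p * S a b i Z)"

lemma NS_laurent: "NS p a b i \<in> laurent"
  unfolding NS_def by (intro laurent_ext0_mult laurent_det_power) (use S_laurent in simp)

lemma curve_det_powi:
  assumes \<gamma>: "curve_at \<gamma> Z E" and Z: "det Z \<noteq> 0"
  shows "((\<lambda>t. det (\<gamma> t) powi p) has_field_derivative of_int p * det Z powi (p - 1) * ddet E Z) (at 0)"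
  using Z curve_at_0[OF \<gamma>] by (auto intro!: derivative_eq_intros curve_det[OF \<gamma>])

lemma dd_NS: "dd E (NS p a b i) = ext0 (\<lambda>Z. of_int p * det Z powi (p - 1) * ddet E Z * S a b i Z + det Z powi p * dS E a b i Z)"
proof
  fix Z
  show "dd E (NS p a b i) Z = ext0 (\<lambda>Z. of_int p * det Z powi (p - 1) * ddet E Z * S a b i Z + det Z powi p * dS E a b i Z) Z"
  proof (cases "det Z = 0")
    case False
    have "((\<lambda>t. det (\<gamma> t) powi p * S a b i (\<gamma> t)) has_field_derivative
        of_int p * det Z powi (p - 1) * ddet E Z * S a b i Z + det Z powi p * dS E a b i Z) (at 0)"
      if \<gamma>: "curve_at \<gamma> Z E" for \<gamma>
      by (rule DERIV_cong[OF DERIV_mult[OF curve_det_powi[OF \<gamma> False] S_curve[OF \<gamma>]]])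
        (simp add: curve_at_0[OF \<gamma>])
    then show ?thesis
      using dd_ext0[OF False, of E "\<lambda>Z. det Z powi p * S a b i Z"] False by (simp add: NS_def)
  qed simp
qed

lemma curve_ddet:
  assumes \<gamma>: "curve_at \<gamma> Z E"
  shows "((\<lambda>t. ddet F (\<gamma> t)) has_field_derivative ddet F E) (at 0)"
  unfolding ddet_def by (rule derivative_eq_intros curve_at_nth[OF \<gamma>] refl)+ simp

lemma curve_dS:
  assumes \<gamma>: "curve_at \<gamma> Z E"
  shows "((\<lambda>t. dS F a b i (\<gamma> t)) has_field_derivative
    (of_nat a * (F $ 2 $ 2 * dS E (a - 1) b (i - 1) Z - F $ 2 $ 1 * dS E (a - 1) b i Z)
     + of_nat b * (F $ 1 $ 1 * dS E a (b - 1) i Z - F $ 1 $ 2 * dS E a (b - 1) (i - 1) Z))) (at 0)"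
  unfolding dS_def[of F] by (rule derivative_eq_intros S_curve[OF \<gamma>] refl)+ (simp add: algebra_simps)

lemma dd_dd_NS:
  assumes Z: "det Z \<noteq> 0"
  shows "dd E (dd F (NS p a b i)) Z =
    of_int p * (of_int p - 1) * det Z powi (p - 2) * ddet E Z * ddet F Z * S a b i Z
    + of_int p * det Z powi (p - 1) * (ddet F E * S a b i Z + ddet F Z * dS E a b i Z + ddet E Z * dS F a b i Z)
    + det Z powi p * (of_nat a * (F $ 2 $ 2 * dS E (a - 1) b (i - 1) Z - F $ 2 $ 1 * dS E (a - 1) b i Z)
     + of_nat b * (F $ 1 $ 1 * dS E a (b - 1) i Z - F $ 1 $ 2 * dS E a (b - 1) (i - 1) Z))"
  unfolding dd_NS
proof (rule dd_ext0[OF Z])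
  fix \<gamma> assume \<gamma>: "curve_at \<gamma> Z E"
  have p2: "det Z powi (p - 1 - 1) = det Z powi (p - 2)"
    by simp
  show "((\<lambda>t. of_int p * det (\<gamma> t) powi (p - 1) * ddet F (\<gamma> t) * S a b i (\<gamma> t) + det (\<gamma> t) powi p * dS F a b i (\<gamma> t))
     has_field_derivative
     of_int p * (of_int p - 1) * det Z powi (p - 2) * ddet E Z * ddet F Z * S a b i Z
    + of_int p * det Z powi (p - 1) * (ddet F E * S a b i Z + ddet F Z * dS E a b i Z + ddet E Z * dS F a b i Z)
    + det Z powi p * (of_nat a * (F $ 2 $ 2 * dS E (a - 1) b (i - 1) Z - F $ 2 $ 1 * dS E (a - 1) b i Z)
     + of_nat b * (F $ 1 $ 1 * dS E a (b - 1) i Z - F $ 1 $ 2 * dS E a (b - 1) (i - 1) Z))) (at 0)"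
    by (rule derivative_eq_intros curve_det_powi[OF \<gamma> Z] S_curve[OF \<gamma>] curve_ddet[OF \<gamma>] curve_dS[OF \<gamma>] refl)+
      (simp add: curve_at_0[OF \<gamma>] p2 algebra_simps)
qed

abbreviation (input) "d11 \<equiv> dd (hmat 1 0 0 0)"
abbreviation (input) "d12 \<equiv> dd (hmat 0 1 0 0)"
abbreviation (input) "d21 \<equiv> dd (hmat 0 0 1 0)"
abbreviation (input) "d22 \<equiv> dd (hmat 0 0 0 1)"

lemma dd_fun_expand:
  assumes f: "f \<in> laurent"
  shows "dd E f = (\<lambda>Z. E $ 1 $ 1 * d11 f Z + E $ 1 $ 2 * d12 f Z + E $ 2 $ 1 * d21 f Z + E $ 2 $ 2 * d22 f Z)"
  using dd_expand[OF f] by blast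

lemma dd_lincomb4:
  assumes "f1 \<in> laurent" "f2 \<in> laurent" "f3 \<in> laurent" "f4 \<in> laurent"
  shows "dd E (\<lambda>Z. c1 * f1 Z + c2 * f2 Z + c3 * f3 Z + c4 * f4 Z) Z
     = c1 * dd E f1 Z + c2 * dd E f2 Z + c3 * dd E f3 Z + c4 * dd E f4 Z"
  using assms by (simp add: dd_add dd_cmult laurent_cmult laurent.add)

lemma set4: "{..<4::nat} = {0, 1, 2, 3}"
  by auto

lemma qe_hmat: "qe 0 = hmat 1 0 0 1" "qe (Suc 0) = hmat 0 (-\<i>) (-\<i>) 0" "qe 2 = hmat 0 (-1) 1 0" "qe 3 = hmat (-\<i>) 0 0 \<i>"
  by (simp_all add: qe_def hmat_def)

text \<open>
  With respect to the entries of \<open>Z\<close>, \<open>\<box> = 4 (\<partial>\<^sub>1\<^sub>1 \<partial>\<^sub>2\<^sub>2 - \<partial>\<^sub>1\<^sub>2 \<partial>\<^sub>2\<^sub>1)\<close>. The formula is symmetrised, so that it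
  can be used without interchanging derivatives.
\<close>

lemma laplace_expand:
  assumes f: "f \<in> laurent"
  shows "(\<Sum>p<4. dd (qe p) (dd (qe p) f) Z)
    = 2 * (d11 (d22 f) Z + d22 (d11 f) Z - d12 (d21 f) Z - d21 (d12 f) Z)"
proof -
  have ii: "\<i> * (\<i> * x) = - x" for x
    by (simp add: complex_eq_iff)
  have "dd E (dd E f) Z = E $ 1 $ 1 * (E $ 1 $ 1 * d11 (d11 f) Z + E $ 1 $ 2 * d11 (d12 f) Z + E $ 2 $ 1 * d11 (d21 f) Z + E $ 2 $ 2 * d11 (d22 f) Z)
     + E $ 1 $ 2 * (E $ 1 $ 1 * d12 (d11 f) Z + E $ 1 $ 2 * d12 (d12 f) Z + E $ 2 $ 1 * d12 (d21 f) Z + E $ 2 $ 2 * d12 (d22 f) Z)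
     + E $ 2 $ 1 * (E $ 1 $ 1 * d21 (d11 f) Z + E $ 1 $ 2 * d21 (d12 f) Z + E $ 2 $ 1 * d21 (d21 f) Z + E $ 2 $ 2 * d21 (d22 f) Z)
     + E $ 2 $ 2 * (E $ 1 $ 1 * d22 (d11 f) Z + E $ 1 $ 2 * d22 (d12 f) Z + E $ 2 $ 1 * d22 (d21 f) Z + E $ 2 $ 2 * d22 (d22 f) Z)" for E
    unfolding dd_expand[OF dd_laurent[OF f], of E E]
    by (subst (1 2 3 4) dd_fun_expand[OF f, of E]) (simp only: dd_lincomb4 dd_laurent f)
  note e = this
  have "(\<Sum>p<4. dd (qe p) (dd (qe p) f) Z) = dd (qe 0) (dd (qe 0) f) Z + (dd (qe (Suc 0)) (dd (qe (Suc 0)) f) Z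
      + (dd (qe 2) (dd (qe 2) f) Z + dd (qe 3) (dd (qe 3) f) Z))"
    by (simp add: set4)
  then show ?thesis
    unfolding e[of "qe 0"] e[of "qe (Suc 0)"] e[of "qe 2"] e[of "qe 3"]
    unfolding qe_hmat hmat_nth
    by (simp add: ii algebra_simps)
qed

text \<open>
  Two facts enter: \<open>x\<^sup>a y\<^sup>b\<close> is harmonic, since both forms are null for the quadratic form dual to
  \<open>N\<close> and orthogonal to each other, and \<open>\<box> N\<^sup>p h = 4 p (p + 1 + n) N\<^sup>p\<^sup>-\<^sup>1 h\<close> for a harmonic \<open>h\<close> that is
  homogeneous of degree \<open>n\<close>.
\<close>

lemma laplace_NS:
  "(\<Sum>q<4. dd (qe q) (dd (qe q) (NS p a b i)) Z)
    = 4 * of_int p * (of_int p + 1 + of_nat a + of_nat b) * NS (p - 1) a b i Z"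
proof (cases "det Z = 0")
  case True
  then show ?thesis by (simp add: NS_def)
next
  case False
  have a: "of_nat a * S a b i Z = of_nat a * (Z $ 2 $ 2 * S (a - 1) b (i - 1) Z - Z $ 2 $ 1 * S (a - 1) b i Z)"
    by (cases "a > 0") (auto simp: S_left)
  have b: "of_nat b * S a b i Z = of_nat b * (Z $ 1 $ 1 * S a (b - 1) i Z - Z $ 1 $ 2 * S a (b - 1) (i - 1) Z)"
    by (cases "b > 0") (auto simp: S_right)
  have euler: "(of_nat a + of_nat b) * S a b i Z
    = of_nat a * (Z $ 2 $ 2 * S (a - 1) b (i - 1) Z - Z $ 2 $ 1 * S (a - 1) b i Z)
      + of_nat b * (Z $ 1 $ 1 * S a (b - 1) i Z - Z $ 1 $ 2 * S a (b - 1) (i - 1) Z)"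
    unfolding distrib_right a b ..
  have N: "det Z powi (p - 2) * (Z $ 1 $ 1 * Z $ 2 $ 2 - Z $ 1 $ 2 * Z $ 2 $ 1) = det Z powi (p - 1)"
    using False power_int_add_1[of "det Z" "p - 2"] by (simp add: det_2)
  have "(\<Sum>q<4. dd (qe q) (dd (qe q) (NS p a b i)) Z)
    = 4 * of_int p * (of_int p - 1) * (det Z powi (p - 2) * (Z $ 1 $ 1 * Z $ 2 $ 2 - Z $ 1 $ 2 * Z $ 2 $ 1)) * S a b i Z
    + 4 * of_int p * det Z powi (p - 1) * (2 * S a b i Z
       + (of_nat a * (Z $ 2 $ 2 * S (a - 1) b (i - 1) Z - Z $ 2 $ 1 * S (a - 1) b i Z)
      + of_nat b * (Z $ 1 $ 1 * S a (b - 1) i Z - Z $ 1 $ 2 * S a (b - 1) (i - 1) Z)))"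
    by (subst laplace_expand[OF NS_laurent])
      (simp add: dd_dd_NS[OF False] ddet_def dS_def, simp add: algebra_simps)
  also have "\<dots> = 4 * of_int p * (of_int p + 1 + of_nat a + of_nat b) * det Z powi (p - 1) * S a b i Z"
    unfolding N euler[symmetric] by (simp add: algebra_simps)
  finally show ?thesis
    using False by (simp add: NS_def)
qed

section \<open>Vector-valued Laurent functions and the operator \<open>N(Z) Z \<nabla>\<box>\<close>\<close>

definition laurent_fields :: "field2 set" where
  "laurent_fields = {f. \<forall>r. (\<lambda>Z. f Z $ r) \<in> laurent}"

lemma field_scale_apply: "field_scale c f Z = c *s f Z"
  by (simp add: field_scale_def)

lemma laurent_fieldsD: "f \<in> laurent_fields \<Longrightarrow> (\<lambda>Z. f Z $ r) \<in> laurent"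
  by (simp add: laurent_fields_def)

lemma laurent_fields_subspace: "fields.subspace laurent_fields"
  by (rule fields.subspaceI)
    (simp_all add: laurent_fields_def field_scale_def pointwise laurent_0 laurent.add laurent_cmult)

lemma field_comp: "(\<lambda>Z. (field_scale c f + g) Z $ r) = (\<lambda>Z. c * f Z $ r + g Z $ r)"
  by (simp add: field_scale_def pointwise)

lemma dd_comp_linear:
  assumes "f \<in> laurent_fields" "g \<in> laurent_fields"
  shows "dd E (\<lambda>Z. (field_scale c f + g) Z $ r) Z = c * dd E (\<lambda>Z. f Z $ r) Z + dd E (\<lambda>Z. g Z $ r) Z"
  using assms[THEN laurent_fieldsD, of r] by (simp add: field_comp dd_add dd_cmult laurent_cmult)

lemma dd_comp_linear':
  assumes "f \<in> laurent_fields" "g \<in> laurent_fields"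
  shows "dd E (\<lambda>Z. c * f Z $ r + g Z $ r) Z = c * dd E (\<lambda>Z. f Z $ r) Z + dd E (\<lambda>Z. g Z $ r) Z"
  using dd_comp_linear[OF assms] by (simp only: field_comp)

lemma pd_nth: "pd p f Z $ r = dd (qe p) (\<lambda>Z. f Z $ r) Z"
  by (auto simp: pd_def dd_def ext0_def)

lemma pd_closed: "f \<in> laurent_fields \<Longrightarrow> pd p f \<in> laurent_fields"
  by (simp add: laurent_fields_def pd_nth dd_laurent)

lemma pd_linear: "f \<in> laurent_fields \<Longrightarrow> g \<in> laurent_fields \<Longrightarrow>
    pd p (field_scale c f + g) = field_scale c (pd p f) + pd p g"
  by (rule field_eqI) (simp add: pd_nth dd_comp_linear' field_scale_nth pointwise)

lemma laplace_alt: "laplace f = (\<Sum>p<4. pd p (pd p f))"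
  by (simp add: fun_eq_iff laplace_def sum_fun_apply)

lemma laplace_linear: "f \<in> laurent_fields \<Longrightarrow> g \<in> laurent_fields \<Longrightarrow>
    laplace (field_scale c f + g) = field_scale c (laplace f) + laplace g"
  by (simp add: laplace_alt pd_linear pd_closed sum.distrib fields.scale_sum_right)

lemma laplace_closed: "f \<in> laurent_fields \<Longrightarrow> laplace f \<in> laurent_fields"
  unfolding laplace_alt by (intro fields.subspace_sum laurent_fields_subspace pd_closed)

lemma laplace_nth: "laplace f Z $ r = (\<Sum>p<4. dd (qe p) (dd (qe p) (\<lambda>Z. f Z $ r)) Z)"
  by (simp add: laplace_def pd_nth)

lemma nabla_left_linear: "f \<in> laurent_fields \<Longrightarrow> g \<in> laurent_fields \<Longrightarrow>
    nabla_left (field_scale c f + g) = field_scale c (nabla_left f) + nabla_left g"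
  by (simp add: fun_eq_iff nabla_left_def pd_linear pointwise matrix_vector_right_distrib sum.distrib)
    (simp add: field_scale_apply nabla_left_def vector_scalar_commute vec_eq_iff sum_distrib_left)

lemma nabla_left_expand:
  assumes f: "f \<in> laurent_fields"
  shows "nabla_left f Z = vector [2 * (d11 (\<lambda>Z. f Z $ 1) Z + d21 (\<lambda>Z. f Z $ 2) Z),
    2 * (d12 (\<lambda>Z. f Z $ 1) Z + d22 (\<lambda>Z. f Z $ 2) Z)]"
proof -
  have ii: "\<i> * (\<i> * x) = - x" for x
    by (simp add: complex_eq_iff)
  note e = dd_expand[OF laurent_fieldsD[OF f], of "qe p" for p]
  show ?thesis
    unfolding nabla_left_def set4
    by (simp add: vec_eq_iff forall_2 matrix_vector_mult_def sum_2 pd_nth e qe_conj_def qe_hmat ii algebra_simps)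
qed

text \<open>
  For regular \<open>Z\<close> the factor \<open>N(Z) Z\<close> is invertible, so this operator has the same kernel as \<open>\<nabla>\<box>\<close>.
  It preserves the degree of homogeneity, and unlike \<open>\<nabla>\<box>\<close> it is diagonalisable.
\<close>

definition symbol3 :: "field2 \<Rightarrow> field2" where
  "symbol3 f Z = det Z *s (Z *v nabla_left (laplace f) Z)"

lemma symbol3_linear: "f \<in> laurent_fields \<Longrightarrow> g \<in> laurent_fields \<Longrightarrow>
    symbol3 (field_scale c f + g) = field_scale c (symbol3 f) + symbol3 g"
  by (simp add: fun_eq_iff symbol3_def laplace_linear nabla_left_linear laplace_closed pointwise
      matrix_vector_right_distrib)
    (simp add: field_scale_apply symbol3_def vector_scalar_commute vec_eq_iff algebra_simps)

text \<open>
  The Euler operator \<open>\<Sum> z\<^sub>r\<^sub>q \<partial>\<^sub>r\<^sub>q\<close>, as the derivative at \<open>Z\<close> in the direction \<open>Z\<close>; it measures the degree.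
\<close>

definition euler :: "field2 \<Rightarrow> field2" where
  "euler f Z = (\<chi> r. dd Z (\<lambda>Z. f Z $ r) Z)"

lemma euler_linear: "f \<in> laurent_fields \<Longrightarrow> g \<in> laurent_fields \<Longrightarrow>
    euler (field_scale c f + g) = field_scale c (euler f) + euler g"
  by (rule field_eqI) (simp add: euler_def dd_comp_linear' field_scale_nth pointwise)

lemma euler_homogeneous:
  assumes f: "f \<in> laurent_fields" and hom: "homogeneous d f"
  shows "euler f = field_scale (of_int d) f"
proof (rule field_eqI)
  fix Z r
  show "euler f Z $ r = field_scale (of_int d) f Z $ r"
  proof (cases "det Z = 0")
    case True
    then show ?thesis
      using laurent_singular[OF laurent_fieldsD[OF f] True, of r]
      by (simp add: euler_def field_scale_nth)
  next
    case False
    have "curve_at (\<lambda>t. hscale (1 + t) Z) Z Z"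
      by (auto simp: curve_at_def hc_eq_iff intro!: derivative_eq_intros)
    from laurent_curve[OF laurent_fieldsD[OF f] False this, of r]
    have 1: "((\<lambda>t. f (hscale (1 + t) Z) $ r) has_field_derivative dd Z (\<lambda>Z. f Z $ r) Z) (at 0)" .
    have "\<forall>\<^sub>F t in nhds (0::complex). t \<in> - {-1}"
      by (rule eventually_nhds_in_open) auto
    then have "\<forall>\<^sub>F t in nhds 0. f (hscale (1 + t) Z) $ r = (1 + t) powi d * f Z $ r"
    proof eventually_elim
      case (elim t)
      then have "1 + t \<noteq> 0"
        by (auto simp: add_eq_0_iff)
      then show ?case
        using hom by (simp add: homogeneous_def)
    qed
    then have "((\<lambda>t. (1 + t) powi d * f Z $ r) has_field_derivative dd Z (\<lambda>Z. f Z $ r) Z) (at 0)"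
      using 1 by (subst (asm) DERIV_cong_ev[OF refl _ refl]) auto
    moreover have "((\<lambda>t. (1 + t) powi d * f Z $ r) has_field_derivative of_int d * f Z $ r) (at 0)"
      by (auto intro!: derivative_eq_intros)
    ultimately show ?thesis
      using DERIV_unique by (simp add: euler_def field_scale_nth) blast
  qed
qed

text \<open>
  \<open>F1 p a b\<close> generates \<open>N\<^sup>p x\<^sup>a y\<^sup>b (y, - x)\<^sup>T\<close> and \<open>F2 p a b\<close> generates \<open>N\<^sup>p (\<partial>\<^sub>x, \<partial>\<^sub>y)\<^sup>T (x\<^sup>a y\<^sup>b)\<close>. They
  are the two equivariant ways to combine binary forms with the standard representation on columns.
  In \<open>F2\<close> the truncated subtractions are harmless, because the factors \<open>a\<close> and \<open>b\<close> vanish there.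
\<close>

definition F1 :: "int \<Rightarrow> nat \<Rightarrow> nat \<Rightarrow> int \<Rightarrow> field2" where
  "F1 p a b i Z = vector [NS p a (Suc b) i Z, - NS p (Suc a) b i Z]"

definition F2 :: "int \<Rightarrow> nat \<Rightarrow> nat \<Rightarrow> int \<Rightarrow> field2" where
  "F2 p a b i Z = vector [of_nat a * NS p (a - 1) b i Z, of_nat b * NS p a (b - 1) i Z]"

lemma F_nth [simp]:
  "F1 p a b i Z $ 1 = NS p a (Suc b) i Z" "F1 p a b i Z $ 2 = - NS p (Suc a) b i Z"
  "F2 p a b i Z $ 1 = of_nat a * NS p (a - 1) b i Z" "F2 p a b i Z $ 2 = of_nat b * NS p a (b - 1) i Z"
  by (simp_all add: F1_def F2_def)

lemma field_eq_iff_2: "f = g \<longleftrightarrow> (\<forall>Z. f Z $ 1 = g Z $ 1 \<and> f Z $ 2 = g Z $ 2)" for f g :: field2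
  by (simp add: fun_eq_iff vec_eq_iff forall_2)

lemma laurent_fields_2: "f \<in> laurent_fields \<longleftrightarrow> (\<lambda>Z. f Z $ 1) \<in> laurent \<and> (\<lambda>Z. f Z $ 2) \<in> laurent"
  by (simp add: laurent_fields_def forall_2)

lemma F1_laurent: "F1 p a b i \<in> laurent_fields"
  by (simp add: laurent_fields_2 NS_laurent laurent_uminus)

lemma F2_laurent: "F2 p a b i \<in> laurent_fields"
  by (simp add: laurent_fields_2 NS_laurent laurent_cmult)

lemma dd_uminus: "f \<in> laurent \<Longrightarrow> dd E (\<lambda>Z. - f Z) Z = - dd E f Z"
  using dd_cmult[of f E "-1"] by simp

lemma laplace_NS_scaled: "(\<Sum>q<4. dd (qe q) (dd (qe q) (\<lambda>Z. c * NS p a b i Z)) Z)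
    = c * (4 * of_int p * (of_int p + 1 + of_nat a + of_nat b) * NS (p - 1) a b i Z)"
proof -
  have "dd E (\<lambda>Z. c * NS p a b i Z) = (\<lambda>Z. c * dd E (NS p a b i) Z)" for E
    by (simp add: fun_eq_iff dd_cmult NS_laurent)
  then show ?thesis
    by (simp add: dd_cmult dd_laurent NS_laurent sum_distrib_left[symmetric] laplace_NS)
qed

lemma laplace_F1: "laplace (F1 p a b i)
  = field_scale (4 * of_int p * (of_int p + 2 + of_nat a + of_nat b)) (F1 (p - 1) a b i)"
proof -
  have "laplace (F1 p a b i) Z $ 1 = 4 * of_int p * (of_int p + 2 + of_nat a + of_nat b) * NS (p - 1) a (Suc b) i Z" for Z
    unfolding laplace_nth F_nth laplace_NS by (simp add: algebra_simps)
  moreover have "laplace (F1 p a b i) Z $ 2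
      = 4 * of_int p * (of_int p + 2 + of_nat a + of_nat b) * - NS (p - 1) (Suc a) b i Z" for Z
    using laplace_NS_scaled[of "-1" p "Suc a" b i Z]
    unfolding laplace_nth F_nth by (simp add: algebra_simps)
  ultimately show ?thesis
    by (simp add: field_eq_iff_2 field_scale_nth)
qed

lemma laplace_F2: "laplace (F2 p a b i)
  = field_scale (4 * of_int p * (of_int p + of_nat a + of_nat b)) (F2 (p - 1) a b i)"
proof -
  have "laplace (F2 p a b i) Z $ 1
      = 4 * of_int p * (of_int p + of_nat a + of_nat b) * (of_nat a * NS (p - 1) (a - 1) b i Z)" for Z
    unfolding laplace_nth F_nth laplace_NS_scaled by (cases a) (simp_all add: algebra_simps)
  moreover have "laplace (F2 p a b i) Z $ 2
      = 4 * of_int p * (of_int p + of_nat a + of_nat b) * (of_nat b * NS (p - 1) a (b - 1) i Z)" for Z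
    unfolding laplace_nth F_nth laplace_NS_scaled by (cases b) (simp_all add: algebra_simps)
  ultimately show ?thesis
    by (simp add: field_eq_iff_2 field_scale_nth)
qed

text \<open>
  The operator \<open>Z \<nabla>\<close> has first order, commutes with the action of \<open>A\<close> and \<open>D\<close> and preserves the degree.
  As no two of the modules spanned by \<open>F1\<close> and \<open>F2\<close> for fixed \<open>p\<close> and \<open>a + b\<close> agree in both degree and
  type, it acts on each of them by a scalar.
\<close>

lemma Z_nabla_F1:
  "Z *v nabla_left (F1 p a b i) Z = (2 * (of_int p + 2 + of_nat a + of_nat b)) *s F1 p a b i Z"
proof (cases "det Z = 0")
  case True
  then show ?thesis
    by (simp add: nabla_left_expand[OF F1_laurent] vec_eq_iff forall_2 matrix_vector_mult_def sum_2 NS_def)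
next
  case False
  have p: "det Z powi p = det Z powi (p - 1) * (Z $ 1 $ 1 * Z $ 2 $ 2 - Z $ 1 $ 2 * Z $ 2 $ 1)"
    using False power_int_add_1[of "det Z" "p - 1"] by (simp add: det_2)
  have 1: "NS p a' b' i Z = det Z powi p * S a' b' i Z" for a' b'
    using False by (simp add: NS_def)
  show ?thesis
    unfolding nabla_left_expand[OF F1_laurent]
    by (simp add: vec_eq_iff forall_2 matrix_vector_mult_def sum_2 dd_uminus NS_laurent dd_NS False dS_def ddet_def)
      (simp add: 1 p S_Suc_right, simp add: algebra_simps)
qed

lemma Z_nabla_F2:
  "Z *v nabla_left (F2 p a b i) Z = (2 * of_int p) *s F2 p a b i Z"
proof (cases "det Z = 0")
  case True
  then show ?thesis
    by (simp add: nabla_left_expand[OF F2_laurent] vec_eq_iff forall_2 matrix_vector_mult_def sum_2 NS_def)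
next
  case False
  have p: "det Z powi p = det Z powi (p - 1) * (Z $ 1 $ 1 * Z $ 2 $ 2 - Z $ 1 $ 2 * Z $ 2 $ 1)"
    using False power_int_add_1[of "det Z" "p - 1"] by (simp add: det_2)
  have 1: "NS p a' b' i Z = det Z powi p * S a' b' i Z" for a' b'
    using False by (simp add: NS_def)
  show ?thesis
    unfolding nabla_left_expand[OF F2_laurent]
    by (simp add: vec_eq_iff forall_2 matrix_vector_mult_def sum_2 dd_cmult NS_laurent dd_NS False dS_def ddet_def)
      (simp add: 1 p, simp add: algebra_simps)
qed

lemma nabla_left_scale: "f \<in> laurent_fields \<Longrightarrow> nabla_left (field_scale c f) = field_scale c (nabla_left f)"
proof -
  assume f: "f \<in> laurent_fields"
  have "nabla_left 0 = (0 :: field2)"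
    using nabla_left_linear[OF f f, of "-1"] by simp
  then show ?thesis
    using nabla_left_linear[OF f fields.subspace_0[OF laurent_fields_subspace], of c] by simp
qed

lemma NS_shift: "det Z * NS (p - 1) a b i Z = NS p a b i Z"
  using power_int_add_1[of "det Z" "p - 1"] by (cases "det Z = 0") (simp_all add: NS_def)

lemma symbol3_F1: "symbol3 (F1 p a b i) = field_scale
  (8 * of_int p * (of_int p + 2 + of_nat a + of_nat b) * (of_int p + 1 + of_nat a + of_nat b)) (F1 p a b i)"
proof
  fix Z
  have "symbol3 (F1 p a b i) Z = (4 * of_int p * (of_int p + 2 + of_nat a + of_nat b)
      * (2 * (of_int (p - 1) + 2 + of_nat a + of_nat b))) *s (det Z *s F1 (p - 1) a b i Z)"
    unfolding symbol3_def laplace_F1 nabla_left_scale[OF F1_laurent] field_scale_apply vector_scalar_commute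
      Z_nabla_F1 vector_smult_assoc by (simp only: ac_simps)
  also have "det Z *s F1 (p - 1) a b i Z = F1 p a b i Z"
    by (simp add: vec_eq_iff forall_2 NS_shift)
  finally show "symbol3 (F1 p a b i) Z = field_scale
      (8 * of_int p * (of_int p + 2 + of_nat a + of_nat b) * (of_int p + 1 + of_nat a + of_nat b)) (F1 p a b i) Z"
    unfolding field_scale_apply by (simp add: vec_eq_iff algebra_simps)
qed

lemma symbol3_F2: "symbol3 (F2 p a b i) = field_scale
  (8 * of_int p * (of_int p - 1) * (of_int p + of_nat a + of_nat b)) (F2 p a b i)"
proof
  fix Z
  have "symbol3 (F2 p a b i) Z = (4 * of_int p * (of_int p + of_nat a + of_nat b)
      * (2 * of_int (p - 1))) *s (det Z *s F2 (p - 1) a b i Z)"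
    unfolding symbol3_def laplace_F2 nabla_left_scale[OF F2_laurent] field_scale_apply vector_scalar_commute
      Z_nabla_F2 vector_smult_assoc by (simp only: ac_simps)
  also have "det Z *s F2 (p - 1) a b i Z = F2 p a b i Z"
    using NS_shift[of Z p] by (simp add: vec_eq_iff forall_2 mult.left_commute)
  finally show "symbol3 (F2 p a b i) Z = field_scale
      (8 * of_int p * (of_int p - 1) * (of_int p + of_nat a + of_nat b)) (F2 p a b i) Z"
    unfolding field_scale_apply by (simp add: vec_eq_iff algebra_simps)
qed

section \<open>The action of the block-diagonal subalgebra\<close>

lemma dd_zero [simp]: "dd E (\<lambda>Z. 0) Z = 0"
  by (simp add: dd_def ext0_def)

text \<open>
  The matrix \<open>1 + t A\<close>, with entries in a form to which the simplifier can apply derivative rules.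
\<close>

definition hadd1 :: "complex \<Rightarrow> hc \<Rightarrow> hc" where
  "hadd1 t A = hmat (1 + t * A $ 1 $ 1) (t * A $ 1 $ 2) (t * A $ 2 $ 1) (1 + t * A $ 2 $ 2)"

lemma hadd1_nth [simp]:
  "hadd1 t A $ 1 $ 1 = 1 + t * A $ 1 $ 1" "hadd1 t A $ 1 $ 2 = t * A $ 1 $ 2"
  "hadd1 t A $ 2 $ 1 = t * A $ 2 $ 1" "hadd1 t A $ 2 $ 2 = 1 + t * A $ 2 $ 2"
  by (simp_all add: hadd1_def)

lemma blocks_of_curve:
  "block11 (mat 1 + (\<chi> r s. t * block_diag A D $ r $ s)) = hadd1 t A"
  "block12 (mat 1 + (\<chi> r s. t * block_diag A D $ r $ s)) = 0"
  "block21 (mat 1 + (\<chi> r s. t * block_diag A D $ r $ s)) = 0"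
  "block22 (mat 1 + (\<chi> r s. t * block_diag A D $ r $ s)) = hadd1 t D"
  by (simp_all add: hc_eq_iff block11_def block12_def block21_def block22_def block_diag_def mat_def)

lemma matrix_inv_eqI:
  fixes A B :: "'a::semiring_1^'n^'n"
  assumes "A ** B = mat 1" "B ** A = mat 1"
  shows "matrix_inv A = B"
proof -
  have "A ** matrix_inv A = mat 1 \<and> matrix_inv A ** A = mat 1"
    unfolding matrix_inv_def by (rule someI[of _ B]) (use assms in simp)
  then show ?thesis
    using assms by (metis matrix_mul_assoc matrix_mul_lid matrix_mul_rid)
qed

lemma matrix_inv_hc:
  assumes "det M \<noteq> 0"
  shows "matrix_inv M = hmat (M $ 2 $ 2 / det M) (- M $ 1 $ 2 / det M) (- M $ 2 $ 1 / det M) (M $ 1 $ 1 / det M)"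
proof (rule matrix_inv_eqI)
  define d where "d = det M"
  have d: "d \<noteq> 0" "M $ 1 $ 1 * M $ 2 $ 2 = d + M $ 1 $ 2 * M $ 2 $ 1"
    using assms by (simp_all add: d_def det_2)
  show "M ** hmat (M $ 2 $ 2 / det M) (- M $ 1 $ 2 / det M) (- M $ 2 $ 1 / det M) (M $ 1 $ 1 / det M) = mat 1"
    "hmat (M $ 2 $ 2 / det M) (- M $ 1 $ 2 / det M) (- M $ 2 $ 1 / det M) (M $ 1 $ 1 / det M) ** M = mat 1"
    unfolding hc_eq_iff hc_mult_nth hmat_nth d_def[symmetric] using d by (auto simp: mat_def field_simps)
qed

lemma hadd1_deriv: "((\<lambda>t. hadd1 t A $ i $ j) has_field_derivative A $ i $ j) (at 0)"
proof -
  have "i = 1 \<or> i = 2" "j = 1 \<or> j = 2"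
    using exhaust_2 by auto
  then show ?thesis
    by (auto intro!: derivative_eq_intros)
qed

lemma det_hadd1_0 [simp]: "det (hadd1 0 A) = 1"
  by (simp add: det_2)

lemma det_hadd1_deriv: "((\<lambda>t. det (hadd1 t A)) has_field_derivative A $ 1 $ 1 + A $ 2 $ 2) (at 0)"
  unfolding det_2 hadd1_nth by (auto intro!: derivative_eq_intros)

lemma det_hadd1_nz: "\<forall>\<^sub>F t in nhds 0. det (hadd1 t A) \<noteq> 0"
proof -
  have "isCont (\<lambda>t. det (hadd1 t A)) 0"
    using det_hadd1_deriv by (rule DERIV_isCont)
  then have "((\<lambda>t. det (hadd1 t A)) \<longlongrightarrow> det (hadd1 0 A)) (nhds 0)"
    by (simp only: isCont_def tendsto_at_iff_tendsto_nhds[of "\<lambda>t. det (hadd1 t A)"])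
  then show ?thesis
    by (rule tendsto_imp_eventually_ne) simp
qed

lemma inv_hadd1_deriv: "((\<lambda>t. matrix_inv (hadd1 t A) $ i $ j) has_field_derivative - A $ i $ j) (at 0)"
proof -
  have ij: "i = 1 \<or> i = 2" "j = 1 \<or> j = 2"
    using exhaust_2 by auto
  have "\<forall>\<^sub>F t in nhds 0. hmat (hadd1 t A $ 2 $ 2 / det (hadd1 t A)) (- hadd1 t A $ 1 $ 2 / det (hadd1 t A))
      (- hadd1 t A $ 2 $ 1 / det (hadd1 t A)) (hadd1 t A $ 1 $ 1 / det (hadd1 t A)) $ i $ j = matrix_inv (hadd1 t A) $ i $ j"
    using det_hadd1_nz[of A] by eventually_elim (simp add: matrix_inv_hc)
  moreover have "((\<lambda>t. hmat (hadd1 t A $ 2 $ 2 / det (hadd1 t A)) (- hadd1 t A $ 1 $ 2 / det (hadd1 t A))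
      (- hadd1 t A $ 2 $ 1 / det (hadd1 t A)) (hadd1 t A $ 1 $ 1 / det (hadd1 t A)) $ i $ j)
      has_field_derivative - A $ i $ j) (at 0)"
    using ij by (auto intro!: derivative_eq_intros det_hadd1_deriv)
  ultimately show ?thesis
    by (subst (asm) DERIV_cong_ev[OF refl _ refl]) auto
qed

lemma hadd1_0: "hadd1 0 A = mat 1"
  by (simp add: hc_eq_iff mat_def)

lemma matrix_inv_mat_1: "matrix_inv (mat 1 :: hc) = mat 1"
  by (rule matrix_inv_eqI) auto

text \<open>
  The curve \<open>(1 + t A)\<^sup>-\<^sup>1 Z (1 + t D)\<close>, along which the group action evaluates a function at \<open>Z\<close>.
\<close>

lemma curve_conj: "curve_at (\<lambda>t. matrix_inv (hadd1 t A) ** (Z ** hadd1 t D)) Z (Z ** D - A ** Z)"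
  unfolding curve_at_def
proof (intro conjI allI)
  show "matrix_inv (hadd1 0 A) ** (Z ** hadd1 0 D) = Z"
    by (simp add: hadd1_0 matrix_inv_mat_1)
  fix i j :: 2
  have 0: "matrix_inv (hadd1 0 A) $ r $ s = (if r = s then 1 else 0)" for r s
    unfolding hadd1_0 matrix_inv_mat_1 by (simp add: mat_def)
  have ij: "i = 1 \<or> i = 2" "j = 1 \<or> j = 2"
    using exhaust_2 by auto
  have "((\<lambda>t. matrix_inv (hadd1 t A) $ i $ 1 * (Z $ 1 $ 1 * hadd1 t D $ 1 $ j + Z $ 1 $ 2 * hadd1 t D $ 2 $ j)
      + matrix_inv (hadd1 t A) $ i $ 2 * (Z $ 2 $ 1 * hadd1 t D $ 1 $ j + Z $ 2 $ 2 * hadd1 t D $ 2 $ j))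
      has_field_derivative (Z ** D - A ** Z) $ i $ j) (at 0)"
    by (rule DERIV_cong[OF DERIV_add[OF
            DERIV_mult[OF inv_hadd1_deriv DERIV_add[OF DERIV_cmult[OF hadd1_deriv] DERIV_cmult[OF hadd1_deriv]]]
            DERIV_mult[OF inv_hadd1_deriv DERIV_add[OF DERIV_cmult[OF hadd1_deriv] DERIV_cmult[OF hadd1_deriv]]]]])
      (use ij in \<open>auto simp: 0 hc_mult_nth\<close>)
  then show "((\<lambda>t. (matrix_inv (hadd1 t A) ** (Z ** hadd1 t D)) $ i $ j) has_field_derivative (Z ** D - A ** Z) $ i $ j) (at 0)"
    by (simp add: hc_mult_nth)
qed

text \<open>
  The factor \<open>1 / det (1 + t A)\<close> does not contribute to the derivative, because \<open>A\<close> has trace \<open>0\<close>.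
  On singular matrices both sides vanish: the curve stays within them, where Laurent functions
  are zero.
\<close>

lemma dpi_left_block_diag:
  assumes f: "f \<in> laurent_fields" and A: "A \<in> sl2"
  shows "dpi_left (block_diag A D) f Z $ r
    = (A *v f Z) $ r + dd (Z ** D - A ** Z) (\<lambda>Z. f Z $ r) Z"
proof -
  let ?\<gamma> = "\<lambda>t. matrix_inv (hadd1 t A) ** (Z ** hadd1 t D)"
  have pi: "pi_left (mat 1 + (\<chi> r s. t * block_diag A D $ r $ s)) f Z $ r
      = 1 / det (hadd1 t A) * (hadd1 t A $ r $ 1 * f (?\<gamma> t) $ 1 + hadd1 t A $ r $ 2 * f (?\<gamma> t) $ 2)" for t
    by (simp add: pi_left_def Let_def blocks_of_curve matrix_vector_mult_def sum_2)
  have r: "r = 1 \<or> r = 2"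
    using exhaust_2 by auto
  show ?thesis
  proof (cases "det Z = 0")
    case True
    then have "det (?\<gamma> t) = 0" for t
      by (simp add: det_mul)
    then have "f (?\<gamma> t) $ s = 0" for t s
      using laurent_singular[OF laurent_fieldsD[OF f]] by blast
    moreover have "f Z $ s = 0" for s
      using laurent_singular[OF laurent_fieldsD[OF f] True] by blast
    ultimately show ?thesis
      using True by (simp add: dpi_left_def pi matrix_vector_mult_def)
  next
    case False
    have g: "((\<lambda>t. f (?\<gamma> t) $ s) has_field_derivative dd (Z ** D - A ** Z) (\<lambda>Z. f Z $ s) Z) (at 0)" for s
      by (rule laurent_curve[OF laurent_fieldsD[OF f] False curve_conj])
    have tr: "A $ 1 $ 1 + A $ 2 $ 2 = 0"
      using A by (simp add: sl2_iff)
    have "((\<lambda>t. 1 / det (hadd1 t A) * (hadd1 t A $ r $ 1 * f (?\<gamma> t) $ 1 + hadd1 t A $ r $ 2 * f (?\<gamma> t) $ 2))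
      has_field_derivative (A *v f Z) $ r + dd (Z ** D - A ** Z) (\<lambda>Z. f Z $ r) Z) (at 0)"
    proof (rule DERIV_cong[OF DERIV_mult[OF _ DERIV_add[OF DERIV_mult[OF hadd1_deriv g] DERIV_mult[OF hadd1_deriv g]]]])
      show "((\<lambda>t. 1 / det (hadd1 t A)) has_field_derivative 0) (at 0)"
        by (auto intro!: derivative_eq_intros det_hadd1_deriv simp: tr)
      have "?\<gamma> 0 = Z"
        by (rule curve_at_0[OF curve_conj])
      moreover have "hadd1 0 A $ r $ s = (if r = s then 1 else 0)" for s
        unfolding hadd1_0 by (simp add: mat_def)
      ultimately show "0 * (hadd1 0 A $ r $ 1 * f (?\<gamma> 0) $ 1 + hadd1 0 A $ r $ 2 * f (?\<gamma> 0) $ 2)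
          + (A $ r $ 1 * f (?\<gamma> 0) $ 1 + dd (Z ** D - A ** Z) (\<lambda>Z. f Z $ 1) Z * hadd1 0 A $ r $ 1
            + (A $ r $ 2 * f (?\<gamma> 0) $ 2 + dd (Z ** D - A ** Z) (\<lambda>Z. f Z $ 2) Z * hadd1 0 A $ r $ 2))
          * (1 / det (hadd1 0 A)) = (A *v f Z) $ r + dd (Z ** D - A ** Z) (\<lambda>Z. f Z $ r) Z"
        using r by (auto simp: matrix_vector_mult_def sum_2 simp del: hadd1_nth)
    qed
    then show ?thesis
      by (simp add: dpi_left_def pi DERIV_imp_deriv)
  qed
qed

lemma dpi_left_0: "dpi_left X 0 = 0"
  by (rule field_eqI) (simp add: dpi_left_def pi_left_def Let_def pointwise)

text \<open>
  The substitution \<open>Z \<mapsto> A\<^sup>-\<^sup>1 Z D\<close> with \<open>A\<close> and \<open>D\<close> of determinant \<open>1\<close> preserves \<open>N(Z)\<close>; this is the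
  infinitesimal version.
\<close>

lemma ddet_rotation: "A \<in> sl2 \<Longrightarrow> D \<in> sl2 \<Longrightarrow> ddet (Z ** D - A ** Z) Z = 0"
proof -
  assume "A \<in> sl2" "D \<in> sl2"
  then have "A $ 2 $ 2 = - A $ 1 $ 1" "D $ 2 $ 2 = - D $ 1 $ 1"
    by (simp_all add: sl2_iff add_eq_0_iff)
  then show ?thesis
    by (simp add: ddet_def hc_mult_nth algebra_simps)
qed

lemma dS_diff: "dS (E - F) a b i Z = dS E a b i Z - dS F a b i Z"
  by (simp add: dS_def algebra_simps)

text \<open>
  Since \<open>(x, y) = (s, 1) adj(Z)\<close>, the infinitesimal motion \<open>- A Z\<close> changes \<open>(x, y)\<close> by \<open>(x, y) A\<close>, and
  the product rule for \<open>x\<^sup>a y\<^sup>b\<close> moves \<open>(a, b)\<close> by one step up or down.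
\<close>

lemma dS_left_rotation:
  assumes "A \<in> sl2"
  shows "- dS (A ** Z) a b i Z = (of_nat a * A $ 1 $ 1 + of_nat b * A $ 2 $ 2) * S a b i Z
    + of_nat a * A $ 2 $ 1 * S (a - 1) (Suc b) i Z + of_nat b * A $ 1 $ 2 * S (Suc a) (b - 1) i Z"
proof -
  have A: "A $ 2 $ 2 = - A $ 1 $ 1"
    using assms by (simp add: sl2_iff add_eq_0_iff)
  show ?thesis
    by (cases a; cases b) (simp_all add: dS_def hc_mult_nth S_Suc_right A, simp_all add: algebra_simps)
qed

text \<open>
  The infinitesimal motion \<open>Z D\<close> changes \<open>(x, y)\<close> by \<open>- (s, 1) D adj(Z)\<close>, a change of \<open>(s, 1)\<close>. Its
  effect on the powers of \<open>s\<close> is read off from \<open>S_count\<close> and \<open>S_count'\<close>.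
\<close>

lemma dS_right_rotation:
  assumes "D \<in> sl2"
  shows "dS (Z ** D) a b i Z
    = - (of_int i * D $ 1 $ 1 + (of_nat (a + b) - of_int i) * D $ 2 $ 2) * S a b i Z
    - (of_int i + 1) * D $ 2 $ 1 * S a b (i + 1) Z
    - (of_nat (a + b) - of_int i + 1) * D $ 1 $ 2 * S a b (i - 1) Z"
proof -
  have D: "D $ 1 $ 1 = - D $ 2 $ 2"
    using assms by (simp add: sl2_iff add_eq_0_iff2)
  have "dS (Z ** D) a b i Z
    = D $ 2 $ 2 * (of_nat a * Z $ 2 $ 2 * S (a - 1) b (i - 1) Z - of_nat b * Z $ 1 $ 2 * S a (b - 1) (i - 1) Z)
      + D $ 1 $ 1 * (- of_nat a * Z $ 2 $ 1 * S (a - 1) b i Z + of_nat b * Z $ 1 $ 1 * S a (b - 1) i Z)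
      - D $ 1 $ 2 * (- of_nat a * Z $ 2 $ 1 * S (a - 1) b (i - 1) Z + of_nat b * Z $ 1 $ 1 * S a (b - 1) (i - 1) Z)
      - D $ 2 $ 1 * (of_nat a * Z $ 2 $ 2 * S (a - 1) b (i + 1 - 1) Z - of_nat b * Z $ 1 $ 2 * S a (b - 1) (i + 1 - 1) Z)"
    by (simp add: dS_def hc_mult_nth algebra_simps)
  also have "\<dots> = - (of_int i * D $ 1 $ 1 + (of_nat (a + b) - of_int i) * D $ 2 $ 2) * S a b i Z
    - (of_int i + 1) * D $ 2 $ 1 * S a b (i + 1) Z
    - (of_nat (a + b) - of_int i + 1) * D $ 1 $ 2 * S a b (i - 1) Z"
    unfolding S_count[symmetric] S_count'[symmetric] by (simp add: D algebra_simps)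
  finally show ?thesis .
qed

lemma dd_rotation_NS:
  assumes "A \<in> sl2" "D \<in> sl2"
  shows "dd (Z ** D - A ** Z) (NS p a b i) Z =
    (of_nat a * A $ 1 $ 1 + of_nat b * A $ 2 $ 2) * NS p a b i Z
    + of_nat a * A $ 2 $ 1 * NS p (a - 1) (Suc b) i Z + of_nat b * A $ 1 $ 2 * NS p (Suc a) (b - 1) i Z
    - (of_int i * D $ 1 $ 1 + (of_nat (a + b) - of_int i) * D $ 2 $ 2) * NS p a b i Z
    - (of_int i + 1) * D $ 2 $ 1 * NS p a b (i + 1) Z
    - (of_nat (a + b) - of_int i + 1) * D $ 1 $ 2 * NS p a b (i - 1) Z"
proof (cases "det Z = 0")
  case True
  then show ?thesis by (simp add: NS_def)
next
  case False
  have "dS (Z ** D - A ** Z) a b i Z = - dS (A ** Z) a b i Z + dS (Z ** D) a b i Z"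
    by (simp add: dS_diff)
  with False show ?thesis
    unfolding dd_NS dS_left_rotation[OF assms(1)] dS_right_rotation[OF assms(2)]
    by (simp add: ddet_rotation[OF assms] NS_def) (simp add: algebra_simps)
qed

text \<open>
  The common transformation rule of \<open>F1\<close> and \<open>F2\<close>: \<open>A\<close> moves \<open>(a, b)\<close> and \<open>D\<close> moves \<open>i\<close> in the range
  \<open>0..m\<close>. The vector components contribute the missing index shifts, so that \<open>m\<close> is \<open>a + b + 1\<close>
  for \<open>F1\<close> and \<open>a + b - 1\<close> for \<open>F2\<close>.
\<close>

definition rotates :: "nat \<Rightarrow> (nat \<Rightarrow> nat \<Rightarrow> int \<Rightarrow> field2) \<Rightarrow> nat \<Rightarrow> nat \<Rightarrow> int \<Rightarrow> bool" where
  "rotates m f a b i \<longleftrightarrow> (\<forall>A\<in>sl2. \<forall>D\<in>sl2. dpi_left (block_diag A D) (f a b i) =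
    field_scale (of_nat a * A $ 1 $ 1 + of_nat b * A $ 2 $ 2) (f a b i)
    + field_scale (of_nat a * A $ 2 $ 1) (f (a - 1) (Suc b) i) + field_scale (of_nat b * A $ 1 $ 2) (f (Suc a) (b - 1) i)
    + field_scale (- (of_int i * D $ 1 $ 1 + (of_nat m - of_int i) * D $ 2 $ 2)) (f a b i)
    + field_scale (- (of_int i + 1) * D $ 2 $ 1) (f a b (i + 1))
    + field_scale (- (of_nat m - of_int i + 1) * D $ 1 $ 2) (f a b (i - 1)))"

lemma rotates_F1: "rotates (a + b + 1) (F1 p) a b i"
  unfolding rotates_def
proof (intro ballI)
  fix A D :: hc assume AD: "A \<in> sl2" "D \<in> sl2"
  have A: "A $ 2 $ 2 = - A $ 1 $ 1"
    using AD by (simp add: sl2_iff add_eq_0_iff)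
  show "dpi_left (block_diag A D) (F1 p a b i) =
    field_scale (of_nat a * A $ 1 $ 1 + of_nat b * A $ 2 $ 2) (F1 p a b i)
    + field_scale (of_nat a * A $ 2 $ 1) (F1 p (a - 1) (Suc b) i) + field_scale (of_nat b * A $ 1 $ 2) (F1 p (Suc a) (b - 1) i)
    + field_scale (- (of_int i * D $ 1 $ 1 + (of_nat (a + b + 1) - of_int i) * D $ 2 $ 2)) (F1 p a b i)
    + field_scale (- (of_int i + 1) * D $ 2 $ 1) (F1 p a b (i + 1))
    + field_scale (- (of_nat (a + b + 1) - of_int i + 1) * D $ 1 $ 2) (F1 p a b (i - 1))"
    unfolding field_eq_iff_2
    by (intro allI conjI; cases a; cases b)
      (simp_all add: dpi_left_block_diag[OF F1_laurent AD(1)] matrix_vector_mult_def sum_2 dd_uminus NS_laurent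
        dd_rotation_NS[OF AD] field_scale_nth pointwise A, simp_all add: algebra_simps)
qed

lemma rotates_F2: "a + b > 0 \<Longrightarrow> rotates (a + b - 1) (F2 p) a b i"
  unfolding rotates_def
proof (intro ballI)
  fix A D :: hc assume AD: "A \<in> sl2" "D \<in> sl2" and ab: "a + b > 0"
  have A: "A $ 2 $ 2 = - A $ 1 $ 1"
    using AD by (simp add: sl2_iff add_eq_0_iff)
  show "dpi_left (block_diag A D) (F2 p a b i) =
    field_scale (of_nat a * A $ 1 $ 1 + of_nat b * A $ 2 $ 2) (F2 p a b i)
    + field_scale (of_nat a * A $ 2 $ 1) (F2 p (a - 1) (Suc b) i) + field_scale (of_nat b * A $ 1 $ 2) (F2 p (Suc a) (b - 1) i)
    + field_scale (- (of_int i * D $ 1 $ 1 + (of_nat (a + b - 1) - of_int i) * D $ 2 $ 2)) (F2 p a b i)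
    + field_scale (- (of_int i + 1) * D $ 2 $ 1) (F2 p a b (i + 1))
    + field_scale (- (of_nat (a + b - 1) - of_int i + 1) * D $ 1 $ 2) (F2 p a b (i - 1))"
    unfolding field_eq_iff_2 using ab
    by (intro allI conjI; cases a; cases b; cases "a - 1"; cases "b - 1")
      (simp_all add: dpi_left_block_diag[OF F2_laurent AD(1)] matrix_vector_mult_def sum_2 dd_cmult NS_laurent
        dd_rotation_NS[OF AD] field_scale_nth pointwise A, simp_all add: algebra_simps)
qed

section \<open>A spanning set of the vector-valued Laurent functions\<close>

definition fun_scale :: "complex \<Rightarrow> (hc \<Rightarrow> complex) \<Rightarrow> hc \<Rightarrow> complex" where
  "fun_scale c f = (\<lambda>Z. c * f Z)"

interpretation scal: vector_space fun_scale
  by unfold_locales (auto simp: fun_scale_def fun_eq_iff pointwise algebra_simps)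

abbreviation "NS_span \<equiv> scal.span {NS p a b i | p a b i. True}"

lemma NS_span_base: "NS p a b i \<in> NS_span"
  by (intro scal.span_base) blast

lemma NS_span_mult:
  assumes base: "\<And>p a b i. (\<lambda>Z. h Z * NS p a b i Z) \<in> NS_span" and g: "g \<in> NS_span"
  shows "(\<lambda>Z. h Z * g Z) \<in> NS_span"
  using g
proof (induction rule: scal.span_induct_alt)
  case base
  then show ?case
    using scal.span_zero[of "{NS p a b i | p a b i. True}"] by (simp add: pointwise zero_fun_def)
next
  case (step c x y)
  have "(\<lambda>Z. h Z * (fun_scale c x + y) Z) = fun_scale c (\<lambda>Z. h Z * x Z) + (\<lambda>Z. h Z * y Z)"
    by (simp add: fun_eq_iff fun_scale_def pointwise algebra_simps)
  then show ?case
    using step base by (auto intro!: scal.span_add scal.span_scale)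
qed

lemma NS_shift_up: "NS (p + 1) a b i Z = det Z * NS p a b i Z"
  using NS_shift[of Z "p + 1" a b i] by simp

lemma NS_span_lincomb2:
  "(\<lambda>Z. c * NS p a b i Z + c' * NS p' a' b' i' Z) \<in> NS_span"
proof -
  have "(\<lambda>Z. c * NS p a b i Z + c' * NS p' a' b' i' Z) = fun_scale c (NS p a b i) + fun_scale c' (NS p' a' b' i')"
    by (simp add: fun_eq_iff fun_scale_def pointwise)
  then show ?thesis
    by (simp only: scal.span_add scal.span_scale NS_span_base)
qed

lemma entry_mult_NS:
  "(\<lambda>Z. ext0 (\<lambda>Z. Z $ r $ s) Z * NS p a b i Z) \<in> NS_span"
proof -
  define n where "n = (of_nat a + of_nat b + 1 :: complex)"
  have n: "n \<noteq> 0"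
    unfolding n_def by (metis of_nat_Suc of_nat_add of_nat_eq_0_iff add.commute nat.distinct(1))
  have *: "(\<lambda>Z. ext0 (\<lambda>Z. Z $ r $ s) Z * NS p a b i Z) \<in> NS_span"
    if mult: "\<And>Z. n * Z $ r $ s * S a b i Z = c * S a' b' i' Z + c' * det Z * S a'' b'' i'' Z"
    for c c' a' b' a'' b'' i' i'' r s
  proof -
    have "(\<lambda>Z. ext0 (\<lambda>Z. Z $ r $ s) Z * NS p a b i Z)
        = (\<lambda>Z. c / n * NS p a' b' i' Z + c' / n * NS (p + 1) a'' b'' i'' Z)"
    proof
      fix Z
      show "ext0 (\<lambda>Z. Z $ r $ s) Z * NS p a b i Z = c / n * NS p a' b' i' Z + c' / n * NS (p + 1) a'' b'' i'' Z"
      proof (cases "det Z = 0")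
        case False
        then have "ext0 (\<lambda>Z. Z $ r $ s) Z * NS p a b i Z = det Z powi p * (n * Z $ r $ s * S a b i Z) / n"
          using n by (simp add: NS_def)
        also have "\<dots> = c / n * NS p a' b' i' Z + c' / n * NS (p + 1) a'' b'' i'' Z"
          unfolding mult NS_shift_up using False by (simp add: NS_def algebra_simps) (simp only: add_divide_distrib)
        finally show ?thesis .
      qed (simp add: NS_def)
    qed
    then show ?thesis
      by (simp only: NS_span_lincomb2)
  qed
  have "(\<lambda>Z. ext0 (\<lambda>Z. Z $ 2 $ 2) Z * NS p a b i Z) \<in> NS_span"
    by (rule *) (simp only: n_def mult_z22_S)
  moreover have "(\<lambda>Z. ext0 (\<lambda>Z. Z $ 2 $ 1) Z * NS p a b i Z) \<in> NS_span"
    by (rule *) (simp only: n_def mult_z21_S)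
  moreover have "(\<lambda>Z. ext0 (\<lambda>Z. Z $ 1 $ 2) Z * NS p a b i Z) \<in> NS_span"
    by (rule *) (simp only: n_def mult_z12_S)
  moreover have "(\<lambda>Z. ext0 (\<lambda>Z. Z $ 1 $ 1) Z * NS p a b i Z) \<in> NS_span"
    by (rule *) (simp only: n_def mult_z11_S)
  moreover have "r = 1 \<or> r = 2" "s = 1 \<or> s = 2"
    using exhaust_2 by auto
  ultimately show ?thesis
    by auto
qed

lemma laurent_mult_NS_span: "f \<in> laurent \<Longrightarrow> g \<in> NS_span \<Longrightarrow> (\<lambda>Z. f Z * g Z) \<in> NS_span"
proof (induction arbitrary: g rule: laurent.induct)
  case (const c)
  show ?case
  proof (rule NS_span_mult[OF _ const])
    fix p a b i
    have "(\<lambda>Z. ext0 (\<lambda>Z. c) Z * NS p a b i Z) = fun_scale c (NS p a b i)"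
      by (auto simp: fun_eq_iff fun_scale_def NS_def ext0_def)
    then show "(\<lambda>Z. ext0 (\<lambda>Z. c) Z * NS p a b i Z) \<in> NS_span"
      by (simp only: scal.span_scale NS_span_base)
  qed
next
  case (coord p)
  have "\<exists>c1 c2 c3 c4. coord p = (\<lambda>Z. c1 * Z $ 1 $ 1 + c2 * Z $ 1 $ 2 + c3 * Z $ 2 $ 1 + c4 * Z $ 2 $ 2)"
    by (rule exI[of _ "coord p (hmat 1 0 0 0)"], rule exI[of _ "coord p (hmat 0 1 0 0)"],
        rule exI[of _ "coord p (hmat 0 0 1 0)"], rule exI[of _ "coord p (hmat 0 0 0 1)"])
      (simp add: coord_def fun_eq_iff field_simps)
  then obtain c1 c2 c3 c4
    where c: "coord p = (\<lambda>Z. c1 * Z $ 1 $ 1 + c2 * Z $ 1 $ 2 + c3 * Z $ 2 $ 1 + c4 * Z $ 2 $ 2)"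
    by blast
  have "(\<lambda>Z. ext0 (coord p) Z * g Z) = fun_scale c1 (\<lambda>Z. ext0 (\<lambda>Z. Z $ 1 $ 1) Z * g Z)
      + (fun_scale c2 (\<lambda>Z. ext0 (\<lambda>Z. Z $ 1 $ 2) Z * g Z)
      + (fun_scale c3 (\<lambda>Z. ext0 (\<lambda>Z. Z $ 2 $ 1) Z * g Z)
      + fun_scale c4 (\<lambda>Z. ext0 (\<lambda>Z. Z $ 2 $ 2) Z * g Z)))"
    unfolding c by (auto simp: fun_eq_iff fun_scale_def ext0_def pointwise algebra_simps)
  then show ?case
    using coord.prems by (simp only: scal.span_add scal.span_scale NS_span_mult[OF entry_mult_NS])
next
  case inv_norm
  show ?case
  proof (rule NS_span_mult[OF _ inv_norm])
    fix p a b i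
    have "(\<lambda>Z. ext0 (\<lambda>Z. 1 / det Z) Z * NS p a b i Z) = NS (p - 1) a b i"
    proof
      fix Z
      show "ext0 (\<lambda>Z. 1 / det Z) Z * NS p a b i Z = NS (p - 1) a b i Z"
        using NS_shift[of Z p a b i] by (cases "det Z = 0") (simp add: NS_def, simp add: field_simps)
    qed
    then show "(\<lambda>Z. ext0 (\<lambda>Z. 1 / det Z) Z * NS p a b i Z) \<in> NS_span"
      by (simp only: NS_span_base)
  qed
next
  case (add f h)
  have "(\<lambda>Z. (f Z + h Z) * g Z) = (\<lambda>Z. f Z * g Z) + (\<lambda>Z. h Z * g Z)"
    by (simp add: fun_eq_iff pointwise distrib_right)
  then show ?case
    using add by (simp add: scal.span_add)
next
  case (mult f h)
  then show ?case
    by (simp add: mult.assoc)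
qed

lemma laurent_in_NS_span: "f \<in> laurent \<Longrightarrow> f \<in> NS_span"
proof -
  assume f: "f \<in> laurent"
  have "(\<lambda>Z. f Z * NS 0 0 0 0 Z) = f"
    using laurent_singular[OF f] by (auto simp: fun_eq_iff NS_def ext0_def S_0_0)
  then show ?thesis
    using laurent_mult_NS_span[OF f NS_span_base[of 0 0 0 0]] by simp
qed

definition field_basis :: "field2 set" where
  "field_basis = {F1 p a b i | p a b i. True} \<union> {F2 p a b i | p a b i. a + b > 0}"

text \<open>
  Multiplying a scalar function by a constant column is again a tensor product with a
  two-dimensional representation; \<open>F1\<close> and \<open>F2\<close> are its two summands, and solving for the pure
  columns requires division by \<open>a + b + 1\<close>.
\<close>

lemma axis_NS_span:
  "(\<lambda>Z. vector [NS p a b i Z, 0]) \<in> fields.span field_basis"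
  "(\<lambda>Z. vector [0, NS p a b i Z]) \<in> fields.span field_basis"
proof -
  have nz: "(of_nat a + of_nat b + 1 :: complex) \<noteq> 0"
    by (metis of_nat_Suc of_nat_add of_nat_eq_0_iff add.commute nat.distinct(1))
  have F1: "F1 p a b i \<in> fields.span field_basis" for p a b i
    by (intro fields.span_base) (auto simp: field_basis_def)
  have F2: "F2 p a b i \<in> fields.span field_basis" if "a + b > 0" for p a b i
    unfolding field_basis_def by (intro fields.span_base UnI2) (use that in blast)
  define m where "m = (of_nat a + of_nat b + 1 :: complex)"
  have "F2 p (Suc a) b i + field_scale (of_nat b) (F1 p a (b - 1) i) = field_scale m (\<lambda>Z. vector [NS p a b i Z, 0])"
    by (cases b) (simp_all add: m_def field_eq_iff_2 field_scale_nth pointwise algebra_simps)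
  then have "field_scale (1 / m) (F2 p (Suc a) b i + field_scale (of_nat b) (F1 p a (b - 1) i))
      = (\<lambda>Z. vector [NS p a b i Z, 0])"
    using nz by (simp add: m_def)
  moreover have "field_scale (1 / m) (F2 p (Suc a) b i + field_scale (of_nat b) (F1 p a (b - 1) i)) \<in> fields.span field_basis"
    by (simp only: fields.span_add fields.span_scale F1 F2 zero_less_Suc add_Suc)
  ultimately show "(\<lambda>Z. vector [NS p a b i Z, 0]) \<in> fields.span field_basis"
    by simp
  have "F2 p a (Suc b) i + field_scale (- of_nat a) (F1 p (a - 1) b i) = field_scale m (\<lambda>Z. vector [0, NS p a b i Z])"
    by (cases a) (simp_all add: m_def field_eq_iff_2 field_scale_nth pointwise algebra_simps)
  then have "field_scale (1 / m) (F2 p a (Suc b) i + field_scale (- of_nat a) (F1 p (a - 1) b i))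
      = (\<lambda>Z. vector [0, NS p a b i Z])"
    using nz by (simp add: m_def)
  moreover have "field_scale (1 / m) (F2 p a (Suc b) i + field_scale (- of_nat a) (F1 p (a - 1) b i)) \<in> fields.span field_basis"
    by (simp only: fields.span_add fields.span_scale F1 F2 zero_less_Suc add_Suc_right)
  ultimately show "(\<lambda>Z. vector [0, NS p a b i Z]) \<in> fields.span field_basis"
    by simp
qed

lemma axis_span:
  assumes "f \<in> NS_span"
  shows "(\<lambda>Z. vector [f Z, 0]) \<in> fields.span field_basis \<and> (\<lambda>Z. vector [0, f Z]) \<in> fields.span field_basis"
  using assms
proof (induction rule: scal.span_induct_alt)
  case base
  have "(\<lambda>Z. vector [(0 :: hc \<Rightarrow> complex) Z, 0]) = (0 :: field2)" "(\<lambda>Z. vector [0, (0 :: hc \<Rightarrow> complex) Z]) = (0 :: field2)"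
    by (simp_all add: field_eq_iff_2 pointwise)
  then show ?case
    by (simp add: fields.span_zero)
next
  case (step c x y)
  have "(\<lambda>Z. vector [(fun_scale c x + y) Z, 0]) = field_scale c (\<lambda>Z. vector [x Z, 0]) + (\<lambda>Z. vector [y Z, 0])"
    "(\<lambda>Z. vector [0, (fun_scale c x + y) Z]) = field_scale c (\<lambda>Z. vector [0, x Z]) + (\<lambda>Z. vector [0, y Z])"
    by (simp_all add: field_eq_iff_2 pointwise fun_scale_def field_scale_nth)
  then show ?case
    using step axis_NS_span by (auto intro!: fields.span_add fields.span_scale)
qed

lemma laurent_fields_span: "fields.span field_basis = laurent_fields"
proof
  show "fields.span field_basis \<subseteq> laurent_fields"
    by (intro fields.span_minimal laurent_fields_subspace) (auto simp: field_basis_def F1_laurent F2_laurent)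
  show "laurent_fields \<subseteq> fields.span field_basis"
  proof
    fix f assume f: "f \<in> laurent_fields"
    have "f = (\<lambda>Z. vector [f Z $ 1, 0]) + (\<lambda>Z. vector [0, f Z $ 2])"
      by (simp add: field_eq_iff_2 pointwise)
    moreover have "(\<lambda>Z. vector [f Z $ 1, 0]) \<in> fields.span field_basis"
      "(\<lambda>Z. vector [0, f Z $ 2]) \<in> fields.span field_basis"
      using axis_span laurent_in_NS_span[OF laurent_fieldsD[OF f]] by blast+
    ultimately show "f \<in> fields.span field_basis"
      using fields.span_add by metis
  qed
qed

section \<open>Non-vanishing and homogeneity\<close>

text \<open>
  At this matrix, which has determinant \<open>- 1\<close>, the forms are \<open>x = s + 1\<close> and \<open>y = 2s + 1\<close>, so that all
  coefficients of \<open>x\<^sup>a y\<^sup>b\<close> in the range \<open>0..a+b\<close> are positive. Hence none of the functions \<open>S a b i\<close>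
  with \<open>i\<close> in this range is zero.
\<close>

lemma S_sample_positive:
  "\<exists>n::nat. S a b i (hmat 1 (-2) (-1) 1) = of_nat n \<and> (0 \<le> i \<and> i \<le> int (a + b) \<longrightarrow> n > 0)"
proof (induction a b arbitrary: i rule: S_induct)
  case 0
  show ?case by (rule exI[of _ "if i = 0 then 1 else 0"]) (simp add: S_0_0)
next
  case (left a b)
  obtain n n' where n: "S a b i (hmat 1 (-2) (-1) 1) = of_nat n" "0 \<le> i \<and> i \<le> int (a + b) \<longrightarrow> n > 0"
    "S a b (i - 1) (hmat 1 (-2) (-1) 1) = of_nat n'" "0 \<le> i - 1 \<and> i - 1 \<le> int (a + b) \<longrightarrow> n' > 0"
    using left[of i] left[of "i - 1"] by blast
  have "0 \<le> i \<and> i \<le> int (Suc a + b) \<longrightarrow> (0 \<le> i \<and> i \<le> int (a + b)) \<or> (0 \<le> i - 1 \<and> i - 1 \<le> int (a + b))"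
    by auto
  then show ?case
    using n by (intro exI[of _ "n' + n"]) auto
next
  case (right b)
  obtain n n' where n: "S 0 b i (hmat 1 (-2) (-1) 1) = of_nat n" "0 \<le> i \<and> i \<le> int (0 + b) \<longrightarrow> n > 0"
    "S 0 b (i - 1) (hmat 1 (-2) (-1) 1) = of_nat n'" "0 \<le> i - 1 \<and> i - 1 \<le> int (0 + b) \<longrightarrow> n' > 0"
    using right[of i] right[of "i - 1"] by blast
  have "0 \<le> i \<and> i \<le> int (0 + Suc b) \<longrightarrow> (0 \<le> i \<and> i \<le> int (0 + b)) \<or> (0 \<le> i - 1 \<and> i - 1 \<le> int (0 + b))"
    by auto
  then show ?case
    using n by (intro exI[of _ "n + 2 * n'"]) (auto simp: S_Suc_right)
qed

lemma NS_sample_nonzero: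
  assumes "0 \<le> i" "i \<le> int (a + b)"
  shows "NS p a b i (hmat 1 (-2) (-1) 1) \<noteq> 0"
  using S_sample_positive[of a b i] assms by (auto simp: NS_def det_2)

lemma F1_nonzero:
  assumes "0 \<le> i" "i \<le> int (a + b + 1)"
  shows "F1 p a b i \<noteq> 0"
proof
  assume "F1 p a b i = 0"
  then have "F1 p a b i (hmat 1 (-2) (-1) 1) $ 1 = 0"
    by (simp add: pointwise)
  then show False
    using NS_sample_nonzero[of i a "Suc b" p] assms by simp
qed

lemma F2_nonzero:
  assumes "0 \<le> i" "i + 1 \<le> int (a + b)"
  shows "F2 p a b i \<noteq> 0"
proof
  assume F: "F2 p a b i = 0"
  have "F2 p a b i (hmat 1 (-2) (-1) 1) $ 1 = 0" "F2 p a b i (hmat 1 (-2) (-1) 1) $ 2 = 0"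
    by (simp_all add: F pointwise)
  then show False
    using NS_sample_nonzero[of i "a - 1" b p] NS_sample_nonzero[of i a "b - 1" p] assms
    by (cases "a = 0") auto
qed

lemma NS_out_of_range: "i < 0 \<or> i > int (a + b) \<Longrightarrow> NS p a b i Z = 0"
  by (simp add: NS_def ext0_def S_out_of_range)

lemma F1_out_of_range: "i < 0 \<or> i > int (a + b + 1) \<Longrightarrow> F1 p a b i = 0"
  by (simp add: field_eq_iff_2 pointwise NS_out_of_range)

lemma F2_out_of_range: "i < 0 \<or> i + 1 > int (a + b) \<Longrightarrow> F2 p a b i = 0"
  by (cases a; cases b) (auto simp: field_eq_iff_2 pointwise NS_out_of_range)

lemma det_hscale: "det (hscale c Z) = c\<^sup>2 * det (Z :: hc)"
  by (simp add: det_2 power2_eq_square algebra_simps)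

lemma S_homogeneous: "S a b i (hscale c Z) = c ^ (a + b) * S a b i Z"
  by (induction a b arbitrary: i rule: S_induct) (auto simp: S_0_0 S_Suc_right algebra_simps)

lemma NS_homogeneous: "c \<noteq> 0 \<Longrightarrow> NS p a b i (hscale c Z) = c powi (2 * p + int (a + b)) * NS p a b i Z"
  by (cases "det Z = 0")
    (simp_all add: NS_def det_hscale S_homogeneous power_int_mult_distrib power_int_add power_int_mult power_add)

lemma F1_homogeneous: "homogeneous (2 * p + int (a + b) + 1) (F1 p a b i)"
  by (simp add: homogeneous_def vec_eq_iff forall_2 NS_homogeneous) (simp add: algebra_simps)

lemma F2_homogeneous: "homogeneous (2 * p + int (a + b) - 1) (F2 p a b i)"
  unfolding homogeneous_def
proof (intro allI impI)
  fix c :: complex and Z :: hc assume "c \<noteq> 0"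
  then have "of_nat a * NS p (a - 1) b i (hscale c Z) = c powi (2 * p + int (a + b) - 1) * (of_nat a * NS p (a - 1) b i Z)"
    "of_nat b * NS p a (b - 1) i (hscale c Z) = c powi (2 * p + int (a + b) - 1) * (of_nat b * NS p a (b - 1) i Z)"
    by (cases a; cases b; simp add: NS_homogeneous algebra_simps)+
  then show "F2 p a b i (hscale c Z) = c powi (2 * p + int (a + b) - 1) *s F2 p a b i Z"
    by (simp add: vec_eq_iff forall_2)
qed

section \<open>Families of eigenfunctions as box modules\<close>

lemma dpi_left_linear:
  assumes "A \<in> sl2" "f \<in> laurent_fields" "g \<in> laurent_fields"
  shows "dpi_left (block_diag A D) (field_scale c f + g)
    = field_scale c (dpi_left (block_diag A D) f) + dpi_left (block_diag A D) g"
proof (rule field_eqI)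
  fix Z r
  have "field_scale c f + g \<in> laurent_fields"
    using assms laurent_fields_subspace by (simp add: fields.subspace_add fields.subspace_scale)
  then show "dpi_left (block_diag A D) (field_scale c f + g) Z $ r
    = (field_scale c (dpi_left (block_diag A D) f) + dpi_left (block_diag A D) g) Z $ r"
    using assms
    by (simp add: dpi_left_block_diag dd_comp_linear' pointwise field_scale_nth matrix_vector_mult_def sum_2)
      (simp add: algebra_simps)
qed

lemma span_rescale:
  assumes "\<And>x. x \<in> X \<Longrightarrow> c x \<noteq> 0"
  shows "fields.span ((\<lambda>x. field_scale (c x) (f x)) ` X) = fields.span (f ` X)"
proof
  show "fields.span ((\<lambda>x. field_scale (c x) (f x)) ` X) \<subseteq> fields.span (f ` X)"
    by (intro fields.span_minimal fields.subspace_span) (auto intro: fields.span_scale fields.span_base)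
  have "f x \<in> fields.span ((\<lambda>x. field_scale (c x) (f x)) ` X)" if "x \<in> X" for x
  proof -
    have "field_scale (c x) (f x) \<in> fields.span ((\<lambda>x. field_scale (c x) (f x)) ` X)"
      using that by (intro fields.span_base) auto
    from fields.span_scale[OF this, of "1 / c x"] show ?thesis
      using assms[OF that] by simp
  qed
  then show "fields.span (f ` X) \<subseteq> fields.span ((\<lambda>x. field_scale (c x) (f x)) ` X)"
    by (intro fields.span_minimal fields.subspace_span) auto
qed

text \<open>
  Rescaling the \<open>i\<close>-th basis vector by \<open>1 / (m choose i)\<close> exchanges the ladder coefficients \<open>i + 1\<close>
  and \<open>m - i\<close>, that is, it turns the basis \<open>s\<^sup>i\<close> into the dual one.
\<close>

lemma inverse_binomial_step:
  assumes "Suc i \<le> m"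
  shows "(of_nat i + 1) * (1 / of_nat (m choose i)) = (of_nat m - of_nat i) * (1 / of_nat (m choose Suc i) :: complex)"
proof -
  have "Suc i * (m choose Suc i) = (m - i) * (m choose i)"
    by (simp only: binomial_absorption binomial_absorb_comp)
  then have "of_nat (Suc i) * of_nat (m choose Suc i) = (of_nat (m - i) * of_nat (m choose i) :: complex)"
    by (metis of_nat_mult)
  moreover have "of_nat (m choose i) \<noteq> (0 :: complex)" "of_nat (m choose Suc i) \<noteq> (0 :: complex)"
    using assms by (simp_all add: binomial_eq_0_iff)
  ultimately show ?thesis
    using assms by (simp add: field_simps of_nat_diff)
qed

lemma pair_comprehension_image:
  "{f a i | a i. a \<in> A \<and> i \<in> B} = (\<lambda>(a, i). f a i) ` (A \<times> B)"
  by auto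

text \<open>
  The rescaling by inverse binomials brings the rule \<open>rotates\<close> into the form of two commuting
  ladders, the second one for \<open>- D\<^sup>T\<close>. Values \<open>F a b i\<close> just outside the range \<open>0..m\<close> have to vanish
  for the ladder to end there.
\<close>

lemma iso_box_family:
  fixes F :: "nat \<Rightarrow> nat \<Rightarrow> int \<Rightarrow> field2" and n m :: nat
  assumes L: "\<And>a b i. F a b i \<in> laurent_fields"
    and rot: "\<And>a i. a \<le> n \<Longrightarrow> rotates m F a (n - a) i"
    and out: "\<And>a b. a + b = n \<Longrightarrow> F a b (-1) = 0 \<and> F a b (int m + 1) = 0"
    and nz: "\<And>a i. a \<le> n \<Longrightarrow> i \<le> m \<Longrightarrow> F a (n - a) (int i) \<noteq> 0"
  shows "iso_box dpi_left (real n / 2) (real m / 2) (cspan {F a (n - a) (int i) | a i. a \<le> n \<and> i \<le> m})"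
proof -
  define c where "c i = (1 / of_nat (m choose i) :: complex)" for i
  define G where "G a i = field_scale (c i) (F a (n - a) (int i))" for a i
  have c: "c i \<noteq> 0" if "i \<le> m" for i
    using that by (simp add: c_def binomial_eq_0_iff)
  have "iso_box dpi_left (real n / 2) (real m / 2) (cspan {G a i | a i. a \<le> n \<and> i \<le> m})"
  proof (rule iso_box_weight_basis[of laurent_fields])
    show "fields.subspace laurent_fields"
      by (rule laurent_fields_subspace)
    show "G a i \<in> laurent_fields" for a i
      unfolding G_def using L laurent_fields_subspace by (simp add: fields.subspace_scale)
    show "G a i \<noteq> 0" if "a \<le> n" "i \<le> m" for a i
      using nz[OF that] c[OF that(2)] by (simp add: G_def)
    show "dpi_left (block_diag A D) (field_scale c f + g)
        = field_scale c (dpi_left (block_diag A D) f) + dpi_left (block_diag A D) g"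
      if "A \<in> sl2" "D \<in> sl2" "f \<in> laurent_fields" "g \<in> laurent_fields" for A D c f g
      using that by (intro dpi_left_linear)
    fix A D :: hc and a i :: nat assume AD: "A \<in> sl2" "D \<in> sl2" and ai: "a \<le> n" "i \<le> m"
    have up: "field_scale ((of_nat i + 1) * c i) (F a (n - a) (int i + 1)) = field_scale (of_nat m - of_nat i) (G a (Suc i))"
    proof (cases "i = m")
      case True
      then show ?thesis
        using out[of a "n - a"] ai by simp
    next
      case False
      then show ?thesis
        using inverse_binomial_step[of i m] ai by (simp add: G_def c_def add.commute)
    qed
    have down: "field_scale ((of_nat m - of_nat i + 1) * c i) (F a (n - a) (int i - 1)) = field_scale (of_nat i) (G a (i - 1))"
    proof (cases i)
      case 0
      then show ?thesis
        using out[of a "n - a"] ai by simp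
    next
      case (Suc j)
      then show ?thesis
        using inverse_binomial_step[of j m] ai by (simp add: G_def c_def add.commute)
    qed
    have left: "field_scale (of_nat a * A $ 2 $ 1) (F (a - 1) (Suc (n - a)) (int i))
        = field_scale (of_nat a * A $ 2 $ 1) (F (a - 1) (n - (a - 1)) (int i))"
      using ai by (cases a) (simp_all add: Suc_diff_Suc)
    have "dpi_left (block_diag A D) (G a i) = field_scale (c i) (dpi_left (block_diag A D) (F a (n - a) (int i)))"
      using dpi_left_linear[OF AD(1) L[of a "n - a" "int i"] fields.subspace_0[OF laurent_fields_subspace], of D "c i"]
      by (simp add: G_def dpi_left_0)
    also have "\<dots> = field_scale (c i) (
        field_scale (of_nat a * A $ 1 $ 1 + of_nat (n - a) * A $ 2 $ 2) (F a (n - a) (int i))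
        + field_scale (of_nat a * A $ 2 $ 1) (F (a - 1) (n - (a - 1)) (int i))
        + field_scale (of_nat (n - a) * A $ 1 $ 2) (F (Suc a) (n - a - 1) (int i))
        + field_scale (- (of_int (int i) * D $ 1 $ 1 + (of_nat m - of_int (int i)) * D $ 2 $ 2)) (F a (n - a) (int i))
        + field_scale (- (of_int (int i) + 1) * D $ 2 $ 1) (F a (n - a) (int i + 1))
        + field_scale (- (of_nat m - of_int (int i) + 1) * D $ 1 $ 2) (F a (n - a) (int i - 1)))"
      unfolding rot[OF ai(1), of "int i", unfolded rotates_def, rule_format, OF AD] left ..
    also have "\<dots> = field_scale (of_nat a * A $ 1 $ 1 + (of_nat n - of_nat a) * A $ 2 $ 2) (G a i)
        + field_scale (of_nat a * A $ 2 $ 1) (G (a - 1) i)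
        + field_scale ((of_nat n - of_nat a) * A $ 1 $ 2) (G (Suc a) i)
        + field_scale (- (of_nat i * D $ 1 $ 1 + (of_nat m - of_nat i) * D $ 2 $ 2)) (G a i)
        + field_scale (- (D $ 2 $ 1)) (field_scale ((of_nat i + 1) * c i) (F a (n - a) (int i + 1)))
        + field_scale (- (D $ 1 $ 2)) (field_scale ((of_nat m - of_nat i + 1) * c i) (F a (n - a) (int i - 1)))"
      using ai by (intro field_eqI) (simp add: G_def field_scale_nth pointwise of_nat_diff, simp add: algebra_simps)
    also have "\<dots> = ladder n A (\<lambda>a. G a i) a + ladder m (dual D) (G a) i"
      unfolding up down by (intro field_eqI) (simp add: ladder_def field_scale_nth pointwise algebra_simps)
    finally show "dpi_left (block_diag A D) (G a i) = ladder n A (\<lambda>a. G a i) a + ladder m (dual D) (G a) i" .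
  qed
  moreover have "cspan {G a i | a i. a \<le> n \<and> i \<le> m} = cspan {F a (n - a) (int i) | a i. a \<le> n \<and> i \<le> m}"
  proof -
    have "cspan ((\<lambda>(a, i). G a i) ` ({..n} \<times> {..m})) = cspan ((\<lambda>(a, i). F a (n - a) (int i)) ` ({..n} \<times> {..m}))"
    proof -
      have "(case x of (a, i) \<Rightarrow> c i) \<noteq> 0" if "x \<in> {..n} \<times> {..m}" for x :: "nat \<times> nat"
        using that c by auto
      from span_rescale[of _ "\<lambda>(a, i). c i" "\<lambda>(a, i). F a (n - a) (int i)", OF this] show ?thesis
        by (simp add: cspan_def G_def case_prod_beta)
    qed
    then show ?thesis
      by (simp only: pair_comprehension_image[symmetric] atMost_iff)
  qed
  ultimately show ?thesis
    by simp
qed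

section \<open>Decomposition of the solution space\<close>

text \<open>
  The non-zero functions \<open>F1\<close> and \<open>F2\<close> that are homogeneous of degree \<open>- k - 1\<close> and annihilated by \<open>\<nabla>\<box>\<close>, sorted
  by the factor of the eigenvalue that vanishes: \<open>p + n + 1\<close>, \<open>p + n\<close>, and \<open>p + n + 2\<close>, where \<open>n = a + b\<close>.
  The conditions on \<open>a\<close> and \<open>i\<close> in \<open>basis3\<close> are additive, so that \<open>basis3 k\<close> is empty for \<open>k < 2\<close>.
\<close>

definition basis1 :: "nat \<Rightarrow> field2 set" where
  "basis1 k = {F1 (- int k - 1) a (k - a) (int i) | a i. a \<le> k \<and> i \<le> k + 1}"

definition basis2 :: "nat \<Rightarrow> field2 set" where
  "basis2 k = {F2 (- int k) a (k - a) (int i) | a i. a \<le> k \<and> i + 1 \<le> k}"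

definition basis3 :: "nat \<Rightarrow> field2 set" where
  "basis3 k = {F1 (- int k) a (k - 2 - a) (int i) | a i. a + 2 \<le> k \<and> i + 1 \<le> k}"

lemma cspan_empty [simp]: "cspan {} = {0}"
  by (simp add: cspan_def)

lemma basis1_box: "iso_box dpi_left (real k / 2) (real k / 2 + 1 / 2) (cspan (basis1 k))"
proof -
  have "iso_box dpi_left (real k / 2) (real (k + 1) / 2) (cspan (basis1 k))"
    unfolding basis1_def
  proof (rule iso_box_family)
    show "rotates (k + 1) (F1 (- int k - 1)) a (k - a) i" if "a \<le> k" for a i
      using rotates_F1[of a "k - a"] that by simp
    show "F1 (- int k - 1) a (k - a) (int i) \<noteq> 0" if "a \<le> k" "i \<le> k + 1" for a i
      using that by (intro F1_nonzero) auto
  qed (auto intro!: F1_laurent F1_out_of_range)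
  then show ?thesis
    by (simp add: add_divide_distrib add.commute)
qed

lemma basis2_box: "iso_box dpi_left (real k / 2) (real k / 2 - 1 / 2) (cspan (basis2 k))"
proof (cases k)
  case 0
  then have "basis2 k = {}"
    by (auto simp: basis2_def)
  moreover have "iso_box dpi_left (real k / 2) (real k / 2 - 1 / 2) {0}"
    by (rule iso_box_zero[OF model_is_V zero_is_V]) (simp_all add: 0 dpi_left_0)
  ultimately show ?thesis
    by simp
next
  case (Suc m)
  have "iso_box dpi_left (real k / 2) (real m / 2)
      (cspan {F2 (- int k) a (k - a) (int i) | a i. a \<le> k \<and> i \<le> m})"
  proof (rule iso_box_family)
    show "rotates m (F2 (- int k)) a (k - a) i" if "a \<le> k" for a i
      using rotates_F2[of a "k - a"] that Suc by simp
    show "F2 (- int k) a (k - a) (int i) \<noteq> 0" if "a \<le> k" "i \<le> m" for a i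
      using that Suc by (intro F2_nonzero) auto
  qed (auto intro!: F2_laurent F2_out_of_range simp: Suc)
  then show ?thesis
    by (simp add: basis2_def Suc add_divide_distrib)
qed

lemma basis3_box: "iso_box dpi_left (real k / 2 - 1) (real k / 2 - 1 / 2) (cspan (basis3 k))"
proof (cases "k \<ge> 2")
  case False
  then have e: "basis3 k = {}"
    by (auto simp: basis3_def)
  have "k = 0 \<or> k = 1"
    using False by auto
  then have "iso_box dpi_left (real k / 2 - 1) (real k / 2 - 1 / 2) {0}"
  proof
    assume "k = 0"
    then show ?thesis
      by (intro iso_box_zero[OF zero_is_V zero_is_V]) (simp_all add: dpi_left_0)
  next
    assume "k = 1"
    then show ?thesis
      using iso_box_zero[OF zero_is_V[of "- 1 / 2"] model_is_V[of 0], of dpi_left] by (simp add: dpi_left_0)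
  qed
  then show ?thesis
    by (simp add: e)
next
  case True
  define m where "m = k - 2"
  have k: "k = m + 2"
    using True by (simp add: m_def)
  have "iso_box dpi_left (real m / 2) (real (m + 1) / 2)
      (cspan {F1 (- int k) a (m - a) (int i) | a i. a \<le> m \<and> i \<le> m + 1})"
  proof (rule iso_box_family)
    show "rotates (m + 1) (F1 (- int k)) a (m - a) i" if "a \<le> m" for a i
      using rotates_F1[of a "m - a"] that by simp
    show "F1 (- int k) a (m - a) (int i) \<noteq> 0" if "a \<le> m" "i \<le> m + 1" for a i
      using that by (intro F1_nonzero) auto
  qed (auto intro!: F1_laurent F1_out_of_range)
  then show ?thesis
    by (simp add: basis3_def k add_divide_distrib)
qed

lemma U_left_alt: "U_left = {f \<in> laurent_fields. nabla_left (laplace f) = 0}"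
  by (simp add: U_left_def laurent_fields_def zero_fun_def)

lemma U_left_subspace: "fields.subspace U_left"
proof (rule fields.subspaceI)
  have z: "nabla_left (laplace 0) = 0"
    using nabla_left_linear[of "laplace 0" "laplace 0" "-1"] laplace_linear[of 0 0 "-1"] laplace_closed[of 0]
      fields.subspace_0[OF laurent_fields_subspace] by simp
  then show "0 \<in> U_left"
    using fields.subspace_0[OF laurent_fields_subspace] by (simp add: U_left_alt)
  fix f g c assume f: "f \<in> U_left"
  then have "nabla_left (laplace (field_scale c f + 0)) = field_scale c 0 + 0"
    using fields.subspace_0[OF laurent_fields_subspace] z
    by (simp only: laplace_linear nabla_left_linear laplace_closed U_left_alt mem_Collect_eq)
  then show "field_scale c f \<in> U_left"
    using f laurent_fields_subspace by (simp add: U_left_alt fields.subspace_scale)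
  assume g: "g \<in> U_left"
  then have "nabla_left (laplace (field_scale 1 f + g)) = field_scale 1 0 + 0"
    using f by (simp only: laplace_linear nabla_left_linear laplace_closed U_left_alt mem_Collect_eq)
  then show "f + g \<in> U_left"
    using f g laurent_fields_subspace by (simp add: U_left_alt fields.subspace_add)
qed

lemma homogeneous_subspace: "fields.subspace {f. homogeneous d f}"
  by (rule fields.subspaceI)
    (simp_all add: homogeneous_def pointwise field_scale_apply vec_eq_iff algebra_simps)

lemma U_left_deg_subspace: "fields.subspace (U_left_deg d)"
proof -
  have "U_left_deg d = U_left \<inter> {f. homogeneous d f}"
    by (auto simp: U_left_deg_def)
  then show ?thesis
    using U_left_subspace homogeneous_subspace fields.subspace_inter by metis
qed

lemma Z_kernel:
  fixes Z :: hc
  assumes "det Z \<noteq> 0" "Z *v x = 0"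
  shows "x = 0"
proof -
  have 1: "Z $ 1 $ 1 * x $ 1 + Z $ 1 $ 2 * x $ 2 = 0" "Z $ 2 $ 1 * x $ 1 + Z $ 2 $ 2 * x $ 2 = 0"
    using assms(2) by (simp_all add: vec_eq_iff forall_2 matrix_vector_mult_def sum_2)
  have "det Z * x $ 1 = Z $ 2 $ 2 * (Z $ 1 $ 1 * x $ 1 + Z $ 1 $ 2 * x $ 2) - Z $ 1 $ 2 * (Z $ 2 $ 1 * x $ 1 + Z $ 2 $ 2 * x $ 2)"
    "det Z * x $ 2 = Z $ 1 $ 1 * (Z $ 2 $ 1 * x $ 1 + Z $ 2 $ 2 * x $ 2) - Z $ 2 $ 1 * (Z $ 1 $ 1 * x $ 1 + Z $ 1 $ 2 * x $ 2)"
    by (simp_all add: det_2 algebra_simps)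
  then show ?thesis
    unfolding 1 using assms(1) by (simp add: vec_eq_iff forall_2)
qed

lemma U_left_symbol3:
  assumes "f \<in> laurent_fields"
  shows "f \<in> U_left \<longleftrightarrow> symbol3 f = 0"
proof
  assume "f \<in> U_left"
  then show "symbol3 f = 0"
    by (simp add: U_left_alt symbol3_def fun_eq_iff pointwise)
next
  assume s: "symbol3 f = 0"
  have "nabla_left (laplace f) Z = 0" for Z
  proof (cases "det Z = 0")
    case True
    then show ?thesis
      by (simp add: nabla_left_expand[OF laplace_closed[OF assms]] vec_eq_iff forall_2)
  next
    case False
    then show ?thesis
      using fun_cong[OF s, of Z] Z_kernel[OF False] by (simp add: symbol3_def pointwise)
  qed
  then show "f \<in> U_left"
    using assms by (simp add: U_left_alt fun_eq_iff pointwise)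
qed

lemma bases_in_U: "basis1 k \<union> basis2 k \<union> basis3 k \<subseteq> U_left_deg (- int k - 1)"
proof -
  have F1: "F1 p a b i \<in> U_left_deg (- int k - 1)"
    if "2 * p + int (a + b) + 1 = - int k - 1" "p + 2 + int a + int b = 0 \<or> p + 1 + int a + int b = 0" for p a b i
  proof -
    have "of_int (p + 2 + int a + int b) * of_int (p + 1 + int a + int b) = (0 :: complex)"
      using that(2) by (metis mult_zero_left mult_zero_right of_int_0)
    then have "symbol3 (F1 p a b i) = 0"
      by (simp add: symbol3_F1)
    then show ?thesis
      using F1_homogeneous[of p a b i, unfolded that(1)] by (simp add: U_left_deg_def U_left_symbol3 F1_laurent)
  qed
  have F2: "F2 p a b i \<in> U_left_deg (- int k - 1)"
    if "2 * p + int (a + b) - 1 = - int k - 1" "p + int a + int b = 0" for p a b i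
  proof -
    have "of_int (p + int a + int b) = (0 :: complex)"
      using that(2) by simp
    then have "symbol3 (F2 p a b i) = 0"
      by (simp add: symbol3_F2)
    then show ?thesis
      using F2_homogeneous[of p a b i, unfolded that(1)] by (simp add: U_left_deg_def U_left_symbol3 F2_laurent)
  qed
  show ?thesis
    by (auto simp: basis1_def basis2_def basis3_def intro!: F1 F2)
qed

text \<open>
  The eigenvalue filter \<open>eigen_span\<close> is applied to the spanning set \<open>field_basis\<close> twice, for the Euler
  operator and for \<open>symbol3\<close>. The remaining indices satisfy \<open>2p + n \<plusminus> 1 = - k - 1\<close> and the vanishing of the
  eigenvalue. As \<open>n \<ge> 0\<close>, and \<open>n > 0\<close> for \<open>F2\<close>, the roots \<open>p = 0\<close> and \<open>p = 1\<close> are excluded by the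
  degree.
\<close>

lemma U_left_deg_span: "U_left_deg (- int k - 1) = fields.span (basis1 k \<union> basis2 k \<union> basis3 k)" (is "?U = ?S")
proof
  show "?S \<subseteq> ?U"
    by (intro fields.span_minimal bases_in_U U_left_deg_subspace)
  show "?U \<subseteq> ?S"
  proof
    fix f assume f: "f \<in> ?U"
    then have fL: "f \<in> laurent_fields" and "symbol3 f = 0" "homogeneous (- int k - 1) f"
      by (auto simp: U_left_deg_def U_left_alt U_left_symbol3[symmetric])
    let ?d = "of_int (- int k - 1) :: complex"
    have "f \<in> fields.span {b \<in> field_basis. euler b = field_scale ?d b}"
    proof (rule fields.eigen_span)
      show "f \<in> fields.span field_basis"
        by (simp add: laurent_fields_span fL)
      show "euler f = field_scale ?d f"
        by (rule euler_homogeneous) fact+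
      show "\<exists>\<nu>. euler b = field_scale \<nu> b" if "b \<in> field_basis" for b
        using that by (auto simp: field_basis_def
            intro: euler_homogeneous[OF F1_laurent F1_homogeneous] euler_homogeneous[OF F2_laurent F2_homogeneous])
    qed (simp_all add: laurent_fields_span euler_linear)
    then have "f \<in> fields.span {b \<in> {b \<in> field_basis. euler b = field_scale ?d b}. symbol3 b = field_scale 0 b}"
    proof (rule fields.eigen_span)
      show "symbol3 f = field_scale 0 f"
        by (simp add: \<open>symbol3 f = 0\<close>)
      have "fields.span {b \<in> field_basis. euler b = field_scale ?d b} \<subseteq> laurent_fields"
        unfolding laurent_fields_span[symmetric] by (rule fields.span_mono) auto
      then show "symbol3 (field_scale c x + y) = field_scale c (symbol3 x) + symbol3 y"
        if "x \<in> fields.span {b \<in> field_basis. euler b = field_scale ?d b}"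
          "y \<in> fields.span {b \<in> field_basis. euler b = field_scale ?d b}" for x y c
        using that by (intro symbol3_linear) auto
      show "\<exists>\<nu>. symbol3 b = field_scale \<nu> b" if "b \<in> {b \<in> field_basis. euler b = field_scale ?d b}" for b
        using that by (auto simp: field_basis_def intro: symbol3_F1 symbol3_F2)
    qed
    also have "\<dots> \<subseteq> ?S"
    proof (intro fields.span_minimal fields.subspace_span subsetI)
      fix b assume b: "b \<in> {b \<in> {b \<in> field_basis. euler b = field_scale ?d b}. symbol3 b = field_scale 0 b}"
      show "b \<in> ?S"
      proof (cases "b = 0")
        case True
        then show ?thesis by (simp add: fields.span_zero)
      next
        case False
        from b have s: "symbol3 b = 0" and e: "euler b = field_scale ?d b"
          by auto
        have sc: "c = c'" if "field_scale c b = field_scale c' b" for c c'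
          using that False by simp
        from b consider p x y i where "b = F1 p x y i" | p x y i where "b = F2 p x y i" "x + y > 0"
          by (auto simp: field_basis_def)
        then show ?thesis
        proof cases
          case 1
          have "of_int (2 * p + int (x + y) + 1) = ?d"
            using sc e euler_homogeneous[OF F1_laurent F1_homogeneous, of p x y i] 1 by metis
          then have deg: "2 * p + int (x + y) + 1 = - int k - 1"
            by (simp only: of_int_eq_iff)
          have "(8 * of_int p * (of_int p + 2 + of_nat x + of_nat y) * (of_int p + 1 + of_nat x + of_nat y) :: complex) = 0"
            by (rule sc) (use s symbol3_F1[of p x y i] 1 in simp)
          then have "(of_int (p * (p + 2 + int x + int y) * (p + 1 + int x + int y)) :: complex) = 0"
            by simp
          then have "p * (p + 2 + int x + int y) * (p + 1 + int x + int y) = 0"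
            by (simp only: of_int_eq_0_iff)
          then have ev: "p = 0 \<or> p + 2 + int x + int y = 0 \<or> p + 1 + int x + int y = 0"
            by auto
          have i: "0 \<le> i \<and> i \<le> int (x + y + 1)"
            using F1_out_of_range[of i x y p] False 1 by (meson linorder_not_le)
          then obtain j where j: "i = int j"
            using nonneg_int_cases by blast
          from ev deg have "(p = - int k \<and> x + y + 2 = k) \<or> (p = - int k - 1 \<and> x + y = k)"
            by auto
          then have "b \<in> basis1 k \<union> basis3 k"
          proof
            assume "p = - int k \<and> x + y + 2 = k"
            then have "b \<in> basis3 k"
              unfolding basis3_def 1 using i j by (intro CollectI exI[of _ x] exI[of _ j]) auto
            then show ?thesis ..
          next
            assume "p = - int k - 1 \<and> x + y = k"
            then have "b \<in> basis1 k"
              unfolding basis1_def 1 using i j by (intro CollectI exI[of _ x] exI[of _ j]) auto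
            then show ?thesis ..
          qed
          then show ?thesis
            by (auto intro: fields.span_base)
        next
          case 2
          have "of_int (2 * p + int (x + y) - 1) = ?d"
            using sc e euler_homogeneous[OF F2_laurent F2_homogeneous, of p x y i] 2 by metis
          then have deg: "2 * p + int (x + y) - 1 = - int k - 1"
            by (simp only: of_int_eq_iff)
          have "(8 * of_int p * (of_int p - 1) * (of_int p + of_nat x + of_nat y) :: complex) = 0"
            by (rule sc) (use s symbol3_F2[of p x y i] 2 in simp)
          then have "(of_int (p * (p - 1) * (p + int x + int y)) :: complex) = 0"
            by simp
          then have "p * (p - 1) * (p + int x + int y) = 0"
            by (simp only: of_int_eq_0_iff)
          then have ev: "p = 0 \<or> p = 1 \<or> p + int x + int y = 0"
            by auto
          have i: "0 \<le> i \<and> i + 1 \<le> int (x + y)"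
            using F2_out_of_range[of i x y p] False 2 by (meson linorder_not_le)
          then obtain j where j: "i = int j"
            using nonneg_int_cases by blast
          from ev deg 2(2) have "p = - int k \<and> x + y = k"
            by auto
          then have "b \<in> basis2 k"
            unfolding basis2_def 2 using i j by (intro CollectI exI[of _ x] exI[of _ j]) auto
          then show ?thesis
            by (auto intro: fields.span_base)
        qed
      qed
    qed
    finally show "f \<in> ?S" .
  qed
qed

section \<open>Uniqueness of the components\<close>

definition casimir_first :: "field2 \<Rightarrow> field2" where
  "casimir_first = casimir (\<lambda>A. dpi_left (block_diag A 0)) field_scale"

definition casimir_second :: "field2 \<Rightarrow> field2" where
  "casimir_second = casimir (\<lambda>D. dpi_left (block_diag 0 D)) field_scale"

text \<open>
  The Casimir operators apply the action repeatedly, so the action must not leave the Laurent columns.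
\<close>

lemma dpi_left_closed:
  assumes A: "A \<in> sl2" and f: "f \<in> laurent_fields"
  shows "dpi_left (block_diag A D) f \<in> laurent_fields"
proof -
  have "(\<lambda>Z. dpi_left (block_diag A D) f Z $ r) \<in> laurent" for r
  proof -
    note fr = laurent_fieldsD[OF f]
    have e: "ext0 (\<lambda>Z. (Z ** D - A ** Z) $ p $ q) \<in> laurent" for p q
      unfolding vector_minus_component hc_mult_nth
      by (intro laurent_ext0_diff laurent_ext0_add laurent_ext0_mult laurent_entry laurent.const)
    have "dpi_left (block_diag A D) f Z $ r = A $ r $ 1 * f Z $ 1 + A $ r $ 2 * f Z $ 2
       + (ext0 (\<lambda>Z. (Z ** D - A ** Z) $ 1 $ 1) Z * d11 (\<lambda>Z. f Z $ r) Z
       + ext0 (\<lambda>Z. (Z ** D - A ** Z) $ 1 $ 2) Z * d12 (\<lambda>Z. f Z $ r) Z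
       + ext0 (\<lambda>Z. (Z ** D - A ** Z) $ 2 $ 1) Z * d21 (\<lambda>Z. f Z $ r) Z
       + ext0 (\<lambda>Z. (Z ** D - A ** Z) $ 2 $ 2) Z * d22 (\<lambda>Z. f Z $ r) Z)" for Z
      unfolding dpi_left_block_diag[OF f A] dd_expand[OF fr, of "Z ** D - A ** Z"]
      by (cases "det Z = 0") (simp_all add: matrix_vector_mult_def sum_2)
    then show ?thesis
      by (simp only: laurent.add laurent.mult laurent_cmult dd_laurent fr e)
  qed
  then show ?thesis
    by (simp add: laurent_fields_def)
qed

lemma casimir_linear:
  assumes lin: "\<And>A f g c. A \<in> sl2 \<Longrightarrow> f \<in> laurent_fields \<Longrightarrow> g \<in> laurent_fields \<Longrightarrow>
      \<rho> A (field_scale c f + g) = field_scale c (\<rho> A f) + \<rho> A g"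
    and closed: "\<And>A f. A \<in> sl2 \<Longrightarrow> f \<in> laurent_fields \<Longrightarrow> \<rho> A f \<in> laurent_fields"
    and f: "f \<in> laurent_fields" and g: "g \<in> laurent_fields"
  shows "casimir \<rho> field_scale (field_scale c f + g)
    = field_scale c (casimir \<rho> field_scale f) + casimir \<rho> field_scale g"
  using f g
  by (simp add: casimir_def lin closed) (simp add: fields.scale_right_distrib mult.commute add_ac)

lemma casimir_first_linear: "f \<in> laurent_fields \<Longrightarrow> g \<in> laurent_fields \<Longrightarrow>
    casimir_first (field_scale c f + g) = field_scale c (casimir_first f) + casimir_first g"
  unfolding casimir_first_def by (intro casimir_linear dpi_left_linear dpi_left_closed) auto

lemma casimir_second_linear: "f \<in> laurent_fields \<Longrightarrow> g \<in> laurent_fields \<Longrightarrow>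
    casimir_second (field_scale c f + g) = field_scale c (casimir_second f) + casimir_second g"
  unfolding casimir_second_def by (intro casimir_linear dpi_left_linear dpi_left_closed) auto

lemma is_V_casimir:
  assumes "is_V j V \<rho>" "v \<in> V"
  shows "casimir \<rho> seq_scale v = seq_scale (of_real (4 * j * (j + 1))) v"
proof (cases "j < 0")
  case True
  then have V: "sl2_module V \<rho>" "v = 0"
    using assms by (auto simp: is_V_def)
  interpret sl2_rep V \<rho>
    by unfold_locales (rule V)
  show ?thesis
    by (simp add: V casimir_def)
next
  case False
  then have irr: "irreducible_sl2_module V \<rho>" and dim: "real (seqs.dim V) = 2 * j + 1"
    using assms by (auto simp: is_V_def)
  interpret sl2_rep V \<rho>
    by unfold_locales (use irr in \<open>simp add: irreducible_sl2_module_def\<close>)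
  define n where "n = seqs.dim V - 1"
  have n: "seqs.dim V = Suc n"
    using dim False by (cases "seqs.dim V") (auto simp: n_def)
  then have "real n = 2 * j"
    using dim by simp
  then have "real (n * (n + 2)) = 4 * j * (j + 1)"
    by (simp add: algebra_simps)
  then have "of_nat (n * (n + 2)) = (of_real (4 * j * (j + 1)) :: complex)"
    by (metis of_real_of_nat_eq)
  then show ?thesis
    using casimir_irreducible[OF irr n assms(2)] by simp
qed

lemma is_V_zero: "is_V j V \<rho> \<Longrightarrow> v \<in> V \<Longrightarrow> \<rho> 0 v = 0"
proof -
  assume "is_V j V \<rho>" and v: "v \<in> V"
  then have "sl2_module V \<rho>"
    by (auto simp: is_V_def irreducible_sl2_module_def split: if_splits)
  then interpret sl2_rep V \<rho>
    by unfold_locales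
  show ?thesis
    by (rule rho_zero[OF v])
qed

lemma is_V_closed: "is_V j V \<rho> \<Longrightarrow> A \<in> sl2 \<Longrightarrow> v \<in> V \<Longrightarrow> \<rho> A v \<in> V"
  by (auto simp: is_V_def irreducible_sl2_module_def sl2_module_def split: if_splits)

lemma pure_tensor_linear:
  "pure_tensor (v + v') w = pure_tensor v w + pure_tensor v' w"
  "pure_tensor (seq_scale c v) w = tensor_scale c (pure_tensor v w)"
  "pure_tensor v (w + w') = pure_tensor v w + pure_tensor v w'"
  "pure_tensor v (seq_scale c w) = tensor_scale c (pure_tensor v w)"
  "pure_tensor v 0 = 0" "pure_tensor 0 w = 0"
  by (auto simp: fun_eq_iff pure_tensor_def pointwise algebra_simps)

text \<open>
  On a pure tensor the Casimir element of one factor acts through that factor alone, where it is a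
  scalar; both sides are linear.
\<close>

lemma iso_box_casimir:
  assumes box: "iso_box dpi_left j k M" and M: "M \<subseteq> laurent_fields" and f: "f \<in> M"
  shows "casimir_first f = field_scale (of_real (4 * j * (j + 1))) f"
    and "casimir_second f = field_scale (of_real (4 * k * (k + 1))) f"
proof -
  obtain V \<rho> W \<sigma> \<phi> where V: "is_V j V \<rho>" and W: "is_V k W \<sigma>"
    and lin: "Vector_Spaces.linear tensor_scale field_scale \<phi>" and bij: "bij_betw \<phi> (tensor_space V W) M"
    and act: "\<And>A D v w. A \<in> sl2 \<Longrightarrow> D \<in> sl2 \<Longrightarrow> v \<in> V \<Longrightarrow> w \<in> W \<Longrightarrow>
      dpi_left (block_diag A D) (\<phi> (pure_tensor v w)) = \<phi> (pure_tensor (\<rho> A v) w + pure_tensor v (\<sigma> D w))"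
    using box unfolding iso_box_def by blast
  interpret \<phi>: Vector_Spaces.linear tensor_scale field_scale \<phi>
    by (fact lin)
  have actA: "dpi_left (block_diag A 0) (\<phi> (pure_tensor v w)) = \<phi> (pure_tensor (\<rho> A v) w)"
    if "A \<in> sl2" "v \<in> V" "w \<in> W" for A v w
    using act[OF that(1) _ that(2,3), of 0] is_V_zero[OF W that(3)] by (simp add: pure_tensor_linear)
  have actD: "dpi_left (block_diag 0 D) (\<phi> (pure_tensor v w)) = \<phi> (pure_tensor v (\<sigma> D w))"
    if "D \<in> sl2" "v \<in> V" "w \<in> W" for D v w
    using act[OF _ that, of 0] is_V_zero[OF V that(2)] by (simp add: pure_tensor_linear)
  have first: "casimir_first (\<phi> (pure_tensor v w)) = field_scale (of_real (4 * j * (j + 1))) (\<phi> (pure_tensor v w))"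
    if vw: "v \<in> V" "w \<in> W" for v w
  proof -
    have "casimir_first (\<phi> (pure_tensor v w)) = \<phi> (pure_tensor (casimir \<rho> seq_scale v) w)"
      using vw by (simp add: casimir_first_def casimir_def actA is_V_closed[OF V] pure_tensor_linear \<phi>.add \<phi>.scale)
    then show ?thesis
      unfolding is_V_casimir[OF V vw(1)] pure_tensor_linear \<phi>.scale .
  qed
  have second: "casimir_second (\<phi> (pure_tensor v w)) = field_scale (of_real (4 * k * (k + 1))) (\<phi> (pure_tensor v w))"
    if vw: "v \<in> V" "w \<in> W" for v w
  proof -
    have "casimir_second (\<phi> (pure_tensor v w)) = \<phi> (pure_tensor v (casimir \<sigma> seq_scale w))"
      using vw by (simp add: casimir_second_def casimir_def actD is_V_closed[OF W] pure_tensor_linear \<phi>.add \<phi>.scale)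
    then show ?thesis
      unfolding is_V_casimir[OF W vw(2)] pure_tensor_linear \<phi>.scale .
  qed
  have mem: "\<phi> T \<in> laurent_fields" if "T \<in> tensor_space V W" for T
    using that bij M by (auto simp: bij_betw_def)
  obtain T where T: "T \<in> tensor_space V W" "f = \<phi> T"
    using f bij by (auto simp: bij_betw_def)
  have zero: "casimir_first 0 = 0" "casimir_second 0 = 0"
    using casimir_first_linear[of 0 0 1] casimir_second_linear[of 0 0 1]
      fields.subspace_0[OF laurent_fields_subspace] by simp_all
  have "T \<in> tensor_space V W \<and> casimir_first (\<phi> T) = field_scale (of_real (4 * j * (j + 1))) (\<phi> T)
      \<and> casimir_second (\<phi> T) = field_scale (of_real (4 * k * (k + 1))) (\<phi> T)"
    using T(1) unfolding tensor_space_def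
  proof (induction rule: tensors.span_induct_alt)
    case base
    then show ?case
      by (simp add: zero tensors.span_zero \<phi>.zero)
  next
    case (step c x y)
    then obtain v w where vw: "x = pure_tensor v w" "v \<in> V" "w \<in> W"
      by blast
    have x: "x \<in> tensor_space V W" and y: "y \<in> tensor_space V W"
      using step unfolding tensor_space_def by (auto intro: tensors.span_base)
    have "tensor_scale c x + y \<in> tensor_space V W"
      using x y unfolding tensor_space_def by (intro tensors.span_add tensors.span_scale)
    moreover have "casimir_first (\<phi> (tensor_scale c x + y))
        = field_scale c (casimir_first (\<phi> x)) + casimir_first (\<phi> y)"
      "casimir_second (\<phi> (tensor_scale c x + y))
        = field_scale c (casimir_second (\<phi> x)) + casimir_second (\<phi> y)"
      unfolding \<phi>.add \<phi>.scale by (intro casimir_first_linear casimir_second_linear mem x y)+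
    ultimately show ?case
      using step.IH vw first[OF vw(2,3)] second[OF vw(2,3)]
      by (simp add: tensor_space_def \<phi>.add \<phi>.scale fields.scale_right_distrib mult.commute)
  qed
  then show "casimir_first f = field_scale (of_real (4 * j * (j + 1))) f"
    "casimir_second f = field_scale (of_real (4 * k * (k + 1))) f"
    using T by simp_all
qed

lemma iso_box_zero_mem: "iso_box act j k M \<Longrightarrow> 0 \<in> M"
proof -
  assume "iso_box act j k M"
  then obtain V W \<phi> where lin: "Vector_Spaces.linear tensor_scale field_scale \<phi>"
    and bij: "bij_betw \<phi> (tensor_space V W) M"
    unfolding iso_box_def by blast
  interpret \<phi>: Vector_Spaces.linear tensor_scale field_scale \<phi>
    by (fact lin)
  have "0 \<in> tensor_space V W"
    unfolding tensor_space_def by (rule tensors.span_zero)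
  then have "\<phi> 0 \<in> M"
    by (rule bij_betwE[OF bij, rule_format])
  then show ?thesis
    by (simp add: \<phi>.zero)
qed

lemma iso_box_trivial:
  assumes "iso_box act j k M" "j < 0 \<or> k < 0"
  shows "M = {0}"
proof -
  obtain V \<rho> W \<sigma> \<phi> where V: "is_V j V \<rho>" and W: "is_V k W \<sigma>"
    and lin: "Vector_Spaces.linear tensor_scale field_scale \<phi>" and bij: "bij_betw \<phi> (tensor_space V W) M"
    using assms(1) unfolding iso_box_def by blast
  interpret \<phi>: Vector_Spaces.linear tensor_scale field_scale \<phi>
    by (fact lin)
  have "V = {0} \<or> W = {0}"
    using assms(2) V W by (auto simp: is_V_def)
  then have "{pure_tensor v w | v w. v \<in> V \<and> w \<in> W} \<subseteq> {0}"
    by (auto simp: pure_tensor_linear)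
  then have "tensor_space V W \<subseteq> {0}"
    unfolding tensor_space_def by (intro tensors.span_minimal) (auto intro: tensors.subspace_single_0)
  then have "M \<subseteq> {0}"
    using bij by (auto simp: bij_betw_def \<phi>.zero)
  then show ?thesis
    using iso_box_zero_mem[OF assms(1)] by blast
qed

lemma components_subset:
  assumes "sl2sl2_components act U \<tau>1 \<tau>2 \<tau>3 M1 M2 M3"
  shows "M1 \<subseteq> U" "M2 \<subseteq> U" "M3 \<subseteq> U"
proof -
  have bij: "bij_betw (\<lambda>(x, y, z). x + y + z) (M1 \<times> M2 \<times> M3) U"
    and z: "0 \<in> M1" "0 \<in> M2" "0 \<in> M3"
    using assms iso_box_zero_mem by (auto simp: sl2sl2_components_def)
  have *: "x + y + z \<in> U" if "x \<in> M1" "y \<in> M2" "z \<in> M3" for x y z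
    using bij that by (force simp: bij_betw_def)
  show "M1 \<subseteq> U" "M2 \<subseteq> U" "M3 \<subseteq> U"
    using *[OF _ z(2,3)] *[OF z(1) _ z(3)] *[OF z(1,2)] by auto
qed

text \<open>
  With \<open>x = x1 + x2 + x3\<close>, the second Casimir operator separates \<open>x1\<close> from \<open>x2 + x3\<close>, and the first
  one separates \<open>x1 + x2\<close> from \<open>x3\<close>, since its eigenvalues \<open>4 l (l + 1)\<close> and \<open>4 (l - 1) l\<close> differ
  by \<open>8 l\<close>. For \<open>l = 0\<close> they coincide, but then \<open>x2\<close> and \<open>x3\<close> lie in modules that are zero.
\<close>

lemma casimir_separates:
  fixes k :: nat
  defines "l \<equiv> real k / 2"
  assumes box: "iso_box dpi_left l (l + 1/2) M1" "iso_box dpi_left l (l - 1/2) M2" "iso_box dpi_left (l - 1) (l - 1/2) M3"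
    and L: "M1 \<subseteq> laurent_fields" "M2 \<subseteq> laurent_fields" "M3 \<subseteq> laurent_fields"
    and x: "x1 \<in> M1" "x2 \<in> M2" "x3 \<in> M3"
    and eq: "x = x1 + x2 + x3"
  shows "casimir_first x = field_scale (of_real (4 * l * (l + 1))) x \<Longrightarrow>
      casimir_second x = field_scale (of_real (4 * (l + 1/2) * (l + 1/2 + 1))) x \<Longrightarrow> x = x1"
    and "casimir_first x = field_scale (of_real (4 * l * (l + 1))) x \<Longrightarrow>
      casimir_second x = field_scale (of_real (4 * (l - 1/2) * (l - 1/2 + 1))) x \<Longrightarrow> x = x2"
    and "casimir_first x = field_scale (of_real (4 * (l - 1) * (l - 1 + 1))) x \<Longrightarrow>
      casimir_second x = field_scale (of_real (4 * (l - 1/2) * (l - 1/2 + 1))) x \<Longrightarrow> x = x3"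
proof -
  define a where "a = complex_of_real (4 * l * (l + 1))"
  define a' where "a' = complex_of_real (4 * (l - 1) * (l - 1 + 1))"
  define b where "b = complex_of_real (4 * (l + 1/2) * (l + 1/2 + 1))"
  define b' where "b' = complex_of_real (4 * (l - 1/2) * (l - 1/2 + 1))"
  have mem: "x1 \<in> laurent_fields" "x2 \<in> laurent_fields" "x3 \<in> laurent_fields" "x2 + x3 \<in> laurent_fields"
    using x L laurent_fields_subspace by (auto intro: fields.subspace_add)
  have x_alt: "x = field_scale 1 x1 + (field_scale 1 x2 + x3)"
    by (simp add: eq add.assoc)
  note cas = iso_box_casimir[OF box(1) L(1) x(1)] iso_box_casimir[OF box(2) L(2) x(2)] iso_box_casimir[OF box(3) L(3) x(3)]
  have "casimir_first x = field_scale 1 (casimir_first x1) + (field_scale 1 (casimir_first x2) + casimir_first x3)"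
    unfolding x_alt by (subst casimir_first_linear; (subst casimir_first_linear)?) (use mem in simp_all)
  then have first: "casimir_first x = field_scale a x1 + field_scale a x2 + field_scale a' x3"
    by (simp add: cas a_def a'_def add.assoc)
  have "casimir_second x = field_scale 1 (casimir_second x1) + (field_scale 1 (casimir_second x2) + casimir_second x3)"
    unfolding x_alt by (subst casimir_second_linear; (subst casimir_second_linear)?) (use mem in simp_all)
  then have second: "casimir_second x = field_scale b x1 + field_scale b' x2 + field_scale b' x3"
    by (simp add: cas b_def b'_def add.assoc)
  have "b - b' = complex_of_real (8 * l + 4)"
    unfolding b_def b'_def of_real_diff[symmetric] by (intro arg_cong[of _ _ complex_of_real]) (simp add: algebra_simps)
  moreover have "8 * l + 4 \<noteq> 0"
    by (simp add: l_def add_nonneg_eq_0_iff)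
  ultimately have bb: "b - b' \<noteq> 0"
    by (metis of_real_eq_0_iff)
  have "a - a' = complex_of_real (8 * l)"
    unfolding a_def a'_def of_real_diff[symmetric] by (intro arg_cong[of _ _ complex_of_real]) (simp add: algebra_simps)
  then have aa: "a - a' \<noteq> 0 \<or> k = 0"
    by (auto simp: l_def)
  have triv: "x2 = 0 \<and> x3 = 0" if "k = 0"
    using iso_box_trivial[OF box(2)] iso_box_trivial[OF box(3)] x that by (auto simp: l_def)
  {
    assume "casimir_second x = field_scale b x"
    then have "field_scale (b - b') (x2 + x3) = 0"
      unfolding second unfolding eq
      by (simp add: fields.scale_left_diff_distrib fields.scale_right_distrib) (simp add: algebra_simps)
    then have "x2 + x3 = 0"
      using bb by simp
    then have "x = x1"
      unfolding eq by (simp add: add.assoc)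
  }
  then show "casimir_first x = field_scale (of_real (4 * l * (l + 1))) x \<Longrightarrow>
      casimir_second x = field_scale (of_real (4 * (l + 1/2) * (l + 1/2 + 1))) x \<Longrightarrow> x = x1"
    by (simp only: b_def)
  have x1: "x1 = 0" if "casimir_second x = field_scale b' x"
  proof -
    have "field_scale (b - b') x1 = 0"
      using that unfolding second unfolding eq
      by (simp add: fields.scale_left_diff_distrib fields.scale_right_distrib)
    then show ?thesis
      using bb by simp
  qed
  {
    assume A: "casimir_first x = field_scale a x" "casimir_second x = field_scale b' x"
    then have "field_scale (a - a') x3 = 0"
      unfolding first unfolding eq
      by (auto simp add: fields.scale_left_diff_distrib fields.scale_right_distrib)
    then have "x3 = 0"
      using aa triv by auto
    then have "x = x2"
      using x1[OF A(2)] by (simp add: eq)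
  }
  then show "casimir_first x = field_scale (of_real (4 * l * (l + 1))) x \<Longrightarrow>
      casimir_second x = field_scale (of_real (4 * (l - 1/2) * (l - 1/2 + 1))) x \<Longrightarrow> x = x2"
    by (simp only: a_def b'_def)
  {
    assume A: "casimir_first x = field_scale a' x" "casimir_second x = field_scale b' x"
    then have "field_scale (a - a') x2 = 0"
      unfolding first using x1[OF A(2)] unfolding eq
      by (auto simp add: fields.scale_left_diff_distrib fields.scale_right_distrib)
    then have "x2 = 0"
      using aa triv by auto
    then have "x = x3"
      using x1[OF A(2)] by (simp add: eq)
  }
  then show "casimir_first x = field_scale (of_real (4 * (l - 1) * (l - 1 + 1))) x \<Longrightarrow>
      casimir_second x = field_scale (of_real (4 * (l - 1/2) * (l - 1/2 + 1))) x \<Longrightarrow> x = x3"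
    by (simp only: a'_def b'_def)
qed

text \<open>
  An element of \<open>M1\<close> has the Casimir eigenvalues of the first type; hence its decomposition with
  respect to \<open>N1\<close>, \<open>N2\<close>, \<open>N3\<close> consists of the first summand only. By symmetry the inclusions are
  equalities.
\<close>

lemma left_components_unique:
  fixes k :: nat
  defines "l \<equiv> real k / 2"
  assumes M: "sl2sl2_components dpi_left U (l, l + 1/2) (l, l - 1/2) (l - 1, l - 1/2) M1 M2 M3"
    and N: "sl2sl2_components dpi_left U (l, l + 1/2) (l, l - 1/2) (l - 1, l - 1/2) N1 N2 N3"
    and U: "U \<subseteq> laurent_fields"
  shows "M1 \<subseteq> N1 \<and> M2 \<subseteq> N2 \<and> M3 \<subseteq> N3"
proof -
  have boxM: "iso_box dpi_left l (l + 1/2) M1" "iso_box dpi_left l (l - 1/2) M2" "iso_box dpi_left (l - 1) (l - 1/2) M3"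
    using M by (simp_all add: sl2sl2_components_def)
  have boxN: "iso_box dpi_left l (l + 1/2) N1" "iso_box dpi_left l (l - 1/2) N2" "iso_box dpi_left (l - 1) (l - 1/2) N3"
    using N by (simp_all add: sl2sl2_components_def)
  note MU = components_subset[OF M] and NU = components_subset[OF N]
  have lfM: "M1 \<subseteq> laurent_fields" "M2 \<subseteq> laurent_fields" "M3 \<subseteq> laurent_fields"
    and lfN: "N1 \<subseteq> laurent_fields" "N2 \<subseteq> laurent_fields" "N3 \<subseteq> laurent_fields"
    using MU NU U by auto
  have split: "\<exists>x1\<in>N1. \<exists>x2\<in>N2. \<exists>x3\<in>N3. x = x1 + x2 + x3" if "x \<in> U" for x
  proof -
    have "x \<in> (\<lambda>(x, y, z). x + y + z) ` (N1 \<times> N2 \<times> N3)"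
      using N that by (simp add: sl2sl2_components_def bij_betw_def)
    then show ?thesis
      by force
  qed
  note sep = casimir_separates[OF boxN[unfolded l_def] lfN, folded l_def]
  have "x \<in> N1" if x: "x \<in> M1" for x
  proof -
    obtain x1 x2 x3 where n: "x1 \<in> N1" "x2 \<in> N2" "x3 \<in> N3" and eq: "x = x1 + x2 + x3"
      using split x MU(1) by blast
    have "x = x1"
      by (rule sep(1)[OF n eq iso_box_casimir[OF boxM(1) lfM(1) x]])
    then show ?thesis
      using n by simp
  qed
  moreover have "x \<in> N2" if x: "x \<in> M2" for x
  proof -
    obtain x1 x2 x3 where n: "x1 \<in> N1" "x2 \<in> N2" "x3 \<in> N3" and eq: "x = x1 + x2 + x3"
      using split x MU(2) by blast
    have "x = x2"
      by (rule sep(2)[OF n eq iso_box_casimir[OF boxM(2) lfM(2) x]])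
    then show ?thesis
      using n by simp
  qed
  moreover have "x \<in> N3" if x: "x \<in> M3" for x
  proof -
    obtain x1 x2 x3 where n: "x1 \<in> N1" "x2 \<in> N2" "x3 \<in> N3" and eq: "x = x1 + x2 + x3"
      using split x MU(3) by blast
    have "x = x3"
      by (rule sep(3)[OF n eq iso_box_casimir[OF boxM(3) lfM(3) x]])
    then show ?thesis
      using n by simp
  qed
  ultimately show ?thesis
    by blast
qed

text \<open>
  The sum is direct because an equation \<open>x + y + z = 0\<close> exhibits \<open>0\<close>, an eigenvector for every
  eigenvalue, as a sum to which \<open>casimir_separates\<close> applies.
\<close>

lemma left_components_exist:
  fixes k :: nat
  defines "l \<equiv> real k / 2"
  shows "sl2sl2_components dpi_left (U_left_deg (- int k - 1)) (l, l + 1/2) (l, l - 1/2) (l - 1, l - 1/2)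
    (cspan (basis1 k)) (cspan (basis2 k)) (cspan (basis3 k))"
proof -
  note box = basis1_box[of k, folded l_def] basis2_box[of k, folded l_def] basis3_box[of k, folded l_def]
  let ?N1 = "cspan (basis1 k)" and ?N2 = "cspan (basis2 k)" and ?N3 = "cspan (basis3 k)"
  have "basis1 k \<subseteq> laurent_fields" "basis2 k \<subseteq> laurent_fields" "basis3 k \<subseteq> laurent_fields"
    by (auto simp: basis1_def basis2_def basis3_def F1_laurent F2_laurent)
  then have L: "?N1 \<subseteq> laurent_fields" "?N2 \<subseteq> laurent_fields" "?N3 \<subseteq> laurent_fields"
    unfolding cspan_def by (simp_all add: fields.span_minimal laurent_fields_subspace)
  have sub: "x - y \<in> cspan B" if "x \<in> cspan B" "y \<in> cspan B" for x y B
    using that by (simp add: cspan_def fields.span_diff)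
  have zero: "0 \<in> cspan B" for B
    by (simp add: cspan_def fields.span_zero)
  note sep = casimir_separates[OF box[unfolded l_def] L, folded l_def]
  have indep: "x = 0 \<and> y = 0 \<and> z = 0" if xyz: "x \<in> ?N1" "y \<in> ?N2" "z \<in> ?N3" "x + y + z = 0" for x y z
  proof -
    have c0: "casimir_first 0 = field_scale c 0" "casimir_second 0 = field_scale c 0" for c
      using casimir_first_linear[of 0 0 1] casimir_second_linear[of 0 0 1]
        fields.subspace_0[OF laurent_fields_subspace] by simp_all
    show ?thesis
      using sep[OF xyz(1,2,3) xyz(4)[symmetric]] c0 by simp
  qed
  have "inj_on (\<lambda>(x, y, z). x + y + z) (?N1 \<times> ?N2 \<times> ?N3)"
  proof (rule inj_onI)
    fix u v assume uv: "u \<in> ?N1 \<times> ?N2 \<times> ?N3" "v \<in> ?N1 \<times> ?N2 \<times> ?N3"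
      and eq: "(case u of (x, y, z) \<Rightarrow> x + y + z) = (case v of (x, y, z) \<Rightarrow> x + y + z)"
    obtain x y z x' y' z' where u: "u = (x, y, z)" and v: "v = (x', y', z')"
      by (metis prod_cases3)
    have "(x - x') + (y - y') + (z - z') = (x + y + z) - (x' + y' + z')"
      by (simp add: algebra_simps)
    also have "\<dots> = 0"
      using eq by (simp add: u v)
    finally show "u = v"
      using indep[of "x - x'" "y - y'" "z - z'"] sub uv by (simp add: u v)
  qed
  moreover have "(\<lambda>(x, y, z). x + y + z) ` (?N1 \<times> ?N2 \<times> ?N3) = U_left_deg (- int k - 1)"
  proof -
    have "(\<lambda>(x, y, z). x + y + z) ` (?N1 \<times> ?N2 \<times> ?N3) = {x + y + z | x y z. x \<in> ?N1 \<and> y \<in> ?N2 \<and> z \<in> ?N3}"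
      by force
    also have "\<dots> = fields.span (basis1 k \<union> basis2 k \<union> basis3 k)"
      unfolding fields.span_Un cspan_def by blast
    finally show ?thesis
      by (simp add: U_left_deg_span)
  qed
  ultimately show ?thesis
    using box by (simp add: sl2sl2_components_def bij_betw_def)
qed

lemma U_left_deg_laurent: "U_left_deg d \<subseteq> laurent_fields"
  by (auto simp: U_left_deg_def U_left_alt)

theorem left_components:
  fixes k :: nat
  defines "l \<equiv> real k / 2"
  shows "sl2sl2_components dpi_left (U_left_deg (- int k - 1)) (l, l + 1/2) (l, l - 1/2) (l - 1, l - 1/2) M1 M2 M3
    \<longleftrightarrow> M1 = cspan (basis1 k) \<and> M2 = cspan (basis2 k) \<and> M3 = cspan (basis3 k)"
proof
  note N = left_components_exist[of k, folded l_def]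
  assume M: "sl2sl2_components dpi_left (U_left_deg (- int k - 1)) (l, l + 1/2) (l, l - 1/2) (l - 1, l - 1/2) M1 M2 M3"
  show "M1 = cspan (basis1 k) \<and> M2 = cspan (basis2 k) \<and> M3 = cspan (basis3 k)"
    using left_components_unique[OF M[unfolded l_def] N[unfolded l_def] U_left_deg_laurent]
      left_components_unique[OF N[unfolded l_def] M[unfolded l_def] U_left_deg_laurent] by blast
qed (use left_components_exist[of k] in \<open>simp add: l_def\<close>)

section \<open>The matrix coefficients of the inverse\<close>

text \<open>
  The adjugate matrix. It is an involution, so a polynomial in the linear forms
  \<open>s w\<^sub>1\<^sub>1 + w\<^sub>2\<^sub>1\<close> and \<open>s w\<^sub>1\<^sub>2 + w\<^sub>2\<^sub>2\<close> of \<open>W\<close> is one in the forms \<open>x\<close> and \<open>y\<close> of \<open>adj W\<close>.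
\<close>

definition adj :: "hc \<Rightarrow> hc" where
  "adj W = hmat (W $ 2 $ 2) (- W $ 1 $ 2) (- W $ 2 $ 1) (W $ 1 $ 1)"

lemma power_int_circle_integral:
  "((\<lambda>s. s powi e / s) has_contour_integral (if e = 0 then 2 * of_real pi * \<i> else 0)) (circlepath 0 1)"
proof (cases "e = 0")
  case True
  have "((\<lambda>u. 1 / (u - 0)) has_contour_integral 2 * of_real pi * \<i> * 1) (circlepath 0 1)"
    by (rule Cauchy_integral_circlepath_simple) auto
  then show ?thesis
    using True by simp
next
  case False
  have "((\<lambda>s. s powi e / s) has_contour_integral 0) (circlepath 0 1)"
  proof (rule Cauchy_theorem_primitive[where S = "- {0}" and f = "\<lambda>s. s powi e / of_int e"])
    fix x :: complex assume x: "x \<in> - {0}"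
    have "((\<lambda>s. s powi e / of_int e) has_field_derivative of_int e * x powi (e - 1) * 1 / of_int e) (at x within - {0})"
      using x by (intro DERIV_cdivide DERIV_power_int DERIV_ident) auto
    moreover have "of_int e * x powi (e - 1) * 1 / of_int e = x powi e / x"
      using x False by (simp add: power_int_diff)
    ultimately show "((\<lambda>s. s powi e / of_int e) has_field_derivative x powi e / x) (at x within - {0})"
      by simp
  qed auto
  then show ?thesis
    using False by simp
qed

text \<open>
  The recursion of \<open>S\<close> is matched by expanding one linear factor of the integrand.
\<close>

lemma t_integral:
  "((\<lambda>s. (s * W $ 1 $ 1 + W $ 2 $ 1) ^ a * (s * W $ 1 $ 2 + W $ 2 $ 2) ^ b * s powi (- i) / s)
    has_contour_integral 2 * of_real pi * \<i> * S a b i (adj W)) (circlepath 0 1)"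
proof (induction a b arbitrary: i rule: S_induct)
  case 0
  show ?case
    using power_int_circle_integral[of "- i"] by (simp add: S_0_0 if_distrib cong: if_cong)
next
  case (left a b)
  let ?f = "\<lambda>i s. (s * W $ 1 $ 1 + W $ 2 $ 1) ^ a * (s * W $ 1 $ 2 + W $ 2 $ 2) ^ b * s powi (- i) / s"
  have "((\<lambda>s. W $ 1 $ 1 * ?f (i - 1) s + W $ 2 $ 1 * ?f i s) has_contour_integral
      W $ 1 $ 1 * (2 * of_real pi * \<i> * S a b (i - 1) (adj W)) + W $ 2 $ 1 * (2 * of_real pi * \<i> * S a b i (adj W)))
      (circlepath 0 1)"
    by (intro has_contour_integral_add has_contour_integral_lmul left)
  moreover have "W $ 1 $ 1 * (2 * of_real pi * \<i> * S a b (i - 1) (adj W)) + W $ 2 $ 1 * (2 * of_real pi * \<i> * S a b i (adj W))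
      = 2 * of_real pi * \<i> * S (Suc a) b i (adj W)"
    by (simp add: adj_def algebra_simps)
  ultimately have "((\<lambda>s. W $ 1 $ 1 * ?f (i - 1) s + W $ 2 $ 1 * ?f i s) has_contour_integral
      2 * of_real pi * \<i> * S (Suc a) b i (adj W)) (circlepath 0 1)"
    by simp
  then show ?case
  proof (rule has_contour_integral_eq)
    fix s :: complex assume "s \<in> path_image (circlepath 0 1)"
    then have "s \<noteq> 0" by auto
    then have "s powi (- (i - 1)) = s * s powi (- i)"
      using power_int_add_1'[of s "- i"] by simp
    then show "W $ 1 $ 1 * ?f (i - 1) s + W $ 2 $ 1 * ?f i s
        = (s * W $ 1 $ 1 + W $ 2 $ 1) ^ Suc a * (s * W $ 1 $ 2 + W $ 2 $ 2) ^ b * s powi (- i) / s"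
      using \<open>s \<noteq> 0\<close> by (simp add: field_simps)
  qed
next
  case (right b)
  let ?f = "\<lambda>i s. (s * W $ 1 $ 1 + W $ 2 $ 1) ^ 0 * (s * W $ 1 $ 2 + W $ 2 $ 2) ^ b * s powi (- i) / s"
  have "((\<lambda>s. W $ 1 $ 2 * ?f (i - 1) s + W $ 2 $ 2 * ?f i s) has_contour_integral
      W $ 1 $ 2 * (2 * of_real pi * \<i> * S 0 b (i - 1) (adj W)) + W $ 2 $ 2 * (2 * of_real pi * \<i> * S 0 b i (adj W)))
      (circlepath 0 1)"
    by (intro has_contour_integral_add has_contour_integral_lmul right)
  moreover have "W $ 1 $ 2 * (2 * of_real pi * \<i> * S 0 b (i - 1) (adj W)) + W $ 2 $ 2 * (2 * of_real pi * \<i> * S 0 b i (adj W))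
      = 2 * of_real pi * \<i> * S 0 (Suc b) i (adj W)"
    by (simp add: adj_def S_Suc_right algebra_simps)
  ultimately have "((\<lambda>s. W $ 1 $ 2 * ?f (i - 1) s + W $ 2 $ 2 * ?f i s) has_contour_integral
      2 * of_real pi * \<i> * S 0 (Suc b) i (adj W)) (circlepath 0 1)"
    by simp
  then show ?case
  proof (rule has_contour_integral_eq)
    fix s :: complex assume "s \<in> path_image (circlepath 0 1)"
    then have "s \<noteq> 0" by auto
    then have "s powi (- (i - 1)) = s * s powi (- i)"
      using power_int_add_1'[of s "- i"] by simp
    then show "W $ 1 $ 2 * ?f (i - 1) s + W $ 2 $ 2 * ?f i s
        = (s * W $ 1 $ 1 + W $ 2 $ 1) ^ 0 * (s * W $ 1 $ 2 + W $ 2 $ 2) ^ Suc b * s powi (- i) / s"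
      using \<open>s \<noteq> 0\<close> by (simp add: field_simps)
  qed
qed

lemma tcoef_S:
  assumes "lam = real n / 2" "nn = real n / 2 - real i" "mm = real n / 2 - real a" "a \<le> n" "i \<le> n"
  shows "tcoef lam nn mm W = S a (n - a) (int i) (adj W)"
proof -
  have e: "lam - mm = real_of_int (int a)" "lam - nn = real_of_int (int i)" "2 * lam = real n"
    "lam + mm = real_of_int (int (n - a))" "- lam + nn = real_of_int (- int i)"
    using assms by (simp_all add: of_nat_diff)
  have "\<bar>mm\<bar> \<le> lam" "\<bar>nn\<bar> \<le> lam"
    using assms by (simp_all add: abs_le_iff)
  then have "tcoef lam nn mm W = 1 / (2 * of_real pi * \<i>) *
       contour_integral (circlepath 0 1)
         (\<lambda>s. (s * W $ 1 $ 1 + W $ 2 $ 1) ^ a * (s * W $ 1 $ 2 + W $ 2 $ 2) ^ (n - a) * s powi (- int i) / s)"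
    unfolding tcoef_def e floor_of_int nat_int by simp
  then show ?thesis
    using contour_integral_unique[OF t_integral[of W a "n - a" "int i"]] by simp
qed

lemma adj_matrix_inv:
  assumes "det Z \<noteq> 0"
  shows "adj (matrix_inv Z) = hscale (1 / det Z) Z"
  by (simp add: adj_def matrix_inv_hc[OF assms] hc_eq_iff)

lemma tcoef_inverse:
  assumes Z: "det Z \<noteq> 0" and n: "lam = real n / 2" "nn = real n / 2 - real i" "mm = real n / 2 - real a" "a \<le> n" "i \<le> n"
  shows "tcoef lam nn mm (matrix_inv Z) = NS (- int n) a (n - a) (int i) Z"
  using Z n(4)
  by (simp add: tcoef_S[OF n] adj_matrix_inv[OF Z] S_homogeneous NS_def power_int_minus power_one_over inverse_eq_divide)

lemma tcoef_out_of_range: "\<bar>mm\<bar> > lam \<or> \<bar>nn\<bar> > lam \<Longrightarrow> tcoef lam nn mm W = 0"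
  by (auto simp: tcoef_def)

text \<open>
  Absorbs the factors \<open>N(Z)\<^sup>-\<^sup>1\<close> of the second and third families.
\<close>

lemma NS_inv_det: "1 / det Z * NS p a b i Z = NS (p - 1) a b i Z"
proof (cases "det Z = 0")
  case False
  then show ?thesis
    using NS_shift[of Z p a b i] by (simp add: field_simps)
qed (simp add: NS_def)

lemma ft1_F1:
  assumes "l = real k / 2" "a \<le> k" "i \<le> k + 1" "n = l - real a" "m = l + 1/2 - real i"
  shows "ft1 l m n = F1 (- int k - 1) a (k - a) (int i)"
proof
  fix Z
  show "ft1 l m n Z = F1 (- int k - 1) a (k - a) (int i) Z"
  proof (cases "det Z = 0")
    case True
    then show ?thesis
      by (simp add: ft1_def vec_eq_iff forall_2 NS_def)
  next
    case False
    have "tcoef (l + 1/2) m (n + 1/2) (matrix_inv Z) = NS (- int (k + 1)) a (k + 1 - a) (int i) Z"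
      using assms by (intro tcoef_inverse False) (auto simp: field_simps)
    moreover have "tcoef (l + 1/2) m (n - 1/2) (matrix_inv Z) = NS (- int (k + 1)) (Suc a) (k + 1 - Suc a) (int i) Z"
      using assms by (intro tcoef_inverse False) (auto simp: field_simps)
    moreover have "- int (k + 1) = - int k - 1"
      by simp
    ultimately show ?thesis
      using False assms(2) by (simp only: ft1_def vec_eq_iff forall_2 ext0_regular vector_2 F_nth)
        (simp add: Suc_diff_le)
  qed
qed

lemma ft3_F1:
  assumes "l = real k / 2" "a + 2 \<le> k" "i + 1 \<le> k" "n = l - 1 - real a" "m = l - 1/2 - real i"
  shows "ft3 l m n = F1 (- int k) a (k - 2 - a) (int i)"
proof
  fix Z
  obtain k' where k': "k = Suc (Suc k')"
    using that[of "k - 2"] assms(2) by simp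
  show "ft3 l m n Z = F1 (- int k) a (k - 2 - a) (int i) Z"
  proof (cases "det Z = 0")
    case True
    then show ?thesis
      by (simp add: ft3_def vec_eq_iff forall_2 NS_def)
  next
    case False
    have t1: "tcoef (l - 1/2) m (n + 1/2) (matrix_inv Z) = NS (- int (Suc k')) a (Suc k' - a) (int i) Z"
      using assms k' by (intro tcoef_inverse False) (auto simp: field_simps)
    have t2: "tcoef (l - 1/2) m (n - 1/2) (matrix_inv Z) = NS (- int (Suc k')) (Suc a) (Suc k' - Suc a) (int i) Z"
      using assms k' by (intro tcoef_inverse False) (auto simp: field_simps)
    have p: "- int k = - int (Suc k') - 1"
      by (simp add: k')
    have "ft3 l m n Z = vector [1 / det Z * NS (- int (Suc k')) a (Suc k' - a) (int i) Z,
        - (1 / det Z * NS (- int (Suc k')) (Suc a) (Suc k' - Suc a) (int i) Z)]"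
      unfolding ft3_def ext0_regular[OF False] t1 t2 ..
    then show ?thesis
      unfolding NS_inv_det p using k' assms(2) by (simp add: vec_eq_iff forall_2 Suc_diff_le)
  qed
qed

lemma ft2_F2:
  assumes "l = real k / 2" "a \<le> k" "i + 1 \<le> k" "n = l - real a" "m = l - 1/2 - real i"
  shows "ft2 l m n = F2 (- int k) a (k - a) (int i)"
proof
  fix Z
  obtain k' where k': "k = Suc k'"
    using assms(3) by (cases k) auto
  show "ft2 l m n Z = F2 (- int k) a (k - a) (int i) Z"
  proof (cases "det Z = 0")
    case True
    then show ?thesis
      by (simp add: ft2_def vec_eq_iff forall_2 NS_def)
  next
    case False
    have p: "- int k = - int k' - 1"
      by (simp add: k')
    have "of_real (l - n) * (1 / det Z) * tcoef (l - 1/2) m (n + 1/2) (matrix_inv Z) = of_nat a * NS (- int k) (a - 1) (k - a) (int i) Z"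
    proof (cases a)
      case 0
      then show ?thesis
        using assms by simp
    next
      case (Suc a')
      have "tcoef (l - 1/2) m (n + 1/2) (matrix_inv Z) = NS (- int k') a' (k' - a') (int i) Z"
        using assms k' Suc by (intro tcoef_inverse False) (auto simp: field_simps)
      moreover have "l - n = real a"
        using assms by simp
      ultimately have "of_real (l - n) * (1 / det Z) * tcoef (l - 1/2) m (n + 1/2) (matrix_inv Z)
          = of_nat a * (1 / det Z * NS (- int k') a' (k' - a') (int i) Z)"
        by (simp only: of_real_of_nat_eq mult.assoc)
      then show ?thesis
        unfolding NS_inv_det p using Suc k' by simp
    qed
    moreover have "of_real (l + n) * (1 / det Z) * tcoef (l - 1/2) m (n - 1/2) (matrix_inv Z) = of_nat (k - a) * NS (- int k) a (k - a - 1) (int i) Z"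
    proof (cases "a = k")
      case True
      then have "l + n = 0"
        using assms by simp
      then show ?thesis
        using True by simp
    next
      case False
      have "tcoef (l - 1/2) m (n - 1/2) (matrix_inv Z) = NS (- int k') a (k' - a) (int i) Z"
        using assms k' False by (intro tcoef_inverse \<open>det Z \<noteq> 0\<close>) (auto simp: field_simps)
      moreover have "l + n = real (k - a)"
        using assms by (simp add: of_nat_diff)
      ultimately have "of_real (l + n) * (1 / det Z) * tcoef (l - 1/2) m (n - 1/2) (matrix_inv Z)
          = of_nat (k - a) * (1 / det Z * NS (- int k') a (k' - a) (int i) Z)"
        by (simp only: of_real_of_nat_eq mult.assoc)
      then show ?thesis
        unfolding NS_inv_det p using k' by simp
    qed
    ultimately show ?thesis
      using False by (simp add: ft2_def vec_eq_iff forall_2)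
  qed
qed

text \<open>
  Counting from the top matches the substitutions \<open>n = l - a\<close> and \<open>m = l + 1/2 - i\<close>.
\<close>

lemma steps_down:
  assumes "b - a = real N"
  shows "x \<in> steps a b \<longleftrightarrow> (\<exists>i\<le>N. x = b - real i)"
proof
  assume "x \<in> steps a b"
  then obtain j where j: "x = a + real j" "a + real j \<le> b"
    by (auto simp: steps_def)
  then have "real j \<le> real N"
    using assms by linarith
  then have "j \<le> N" by simp
  then show "\<exists>i\<le>N. x = b - real i"
    using j assms by (intro exI[of _ "N - j"]) (simp add: of_nat_diff)
next
  assume "\<exists>i\<le>N. x = b - real i"
  then obtain i where "i \<le> N" "x = b - real i" by blast
  then show "x \<in> steps a b"
    using assms unfolding steps_def by (intro CollectI exI[of _ "N - i"]) (simp add: of_nat_diff)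
qed

lemma steps_empty: "b < a \<Longrightarrow> steps a b = {}"
  by (auto simp: steps_def)

section \<open>Transposition\<close>

definition transposed :: "field2 \<Rightarrow> field2" where
  "transposed f Z = f (transpose Z)"

lemma transpose_nth: "transpose A $ i $ j = A $ j $ i"
  by (simp add: transpose_def)

lemma transp_transp [simp]: "transposed (transposed f) = f"
  by (simp add: transposed_def fun_eq_iff)

lemma transp_inj: "inj transposed"
  by (metis injI transp_transp)

lemma transp_linear: "transposed (f + g) = transposed f + transposed g" "transposed (field_scale c f) = field_scale c (transposed f)"
  "transposed 0 = 0"
  by (simp_all add: fun_eq_iff transposed_def pointwise field_scale_apply)

lemma laurent_transpose: "f \<in> laurent \<Longrightarrow> (\<lambda>Z. f (transpose Z)) \<in> laurent"
proof (induction rule: laurent.induct)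
  case (coord p)
  have "(\<lambda>Z. ext0 (coord p) (transpose Z)) = (\<lambda>Z. (if p = 2 then - 1 else 1) * ext0 (coord p) Z)"
    by (auto simp: fun_eq_iff ext0_def coord_def transpose_nth add.commute diff_divide_distrib)
  then show ?case
    by (simp only: laurent_cmult laurent.coord coord)
next
  case inv_norm
  have "(\<lambda>Z. ext0 (\<lambda>Z. 1 / det Z) (transpose Z)) = ext0 (\<lambda>Z. 1 / det Z :: complex)"
    by (simp add: fun_eq_iff ext0_def)
  then show ?case
    by (simp only: laurent.inv_norm)
next
  case (const c)
  have "(\<lambda>Z. ext0 (\<lambda>Z. c) (transpose Z)) = ext0 (\<lambda>Z. c)"
    by (simp add: fun_eq_iff ext0_def)
  then show ?case
    by (simp only: laurent.const)
qed (simp_all add: laurent.add laurent.mult)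

lemma transp_laurent: "f \<in> laurent_fields \<Longrightarrow> transposed f \<in> laurent_fields"
  using laurent_transpose[of "\<lambda>Z. f Z $ r" for r] by (simp add: laurent_fields_def transposed_def)

lemma transp_laurent_iff [simp]: "transposed f \<in> laurent_fields \<longleftrightarrow> f \<in> laurent_fields"
  using transp_laurent transp_transp by metis

lemma transpose_line: "transpose (Z + hscale w E) = transpose Z + hscale w (transpose E)"
  by (simp add: hc_eq_iff transpose_nth)

lemma dd_transpose: "dd E (\<lambda>Z. g (transpose Z)) Z = dd (transpose E) g (transpose Z)"
  by (simp add: dd_def ext0_def transpose_line)

lemma dd_neg_direction: "g \<in> laurent \<Longrightarrow> dd (- E) g Z = - dd E g Z"
  by (subst (1 2) dd_expand) simp_all

text \<open>
  Transposition fixes \<open>e\<^sub>0\<close>, \<open>e\<^sub>1\<close>, \<open>e\<^sub>3\<close> and reverses \<open>e\<^sub>2\<close>.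
\<close>

definition transp_sign :: "nat \<Rightarrow> complex" where
  "transp_sign p = (if p = 2 then - 1 else 1)"

lemma transpose_qe: "p < 4 \<Longrightarrow> transpose (qe p) = (if p = 2 then - qe p else qe p)"
  by (auto simp: hc_eq_iff transpose_nth qe_def)

lemma pd_transp:
  assumes "f \<in> laurent_fields" "p < 4"
  shows "pd p (transposed f) = field_scale (transp_sign p) (transposed (pd p f))"
proof (rule field_eqI)
  fix Z r
  have "dd (- qe p) (\<lambda>Z. f Z $ r) (transpose Z) = - dd (qe p) (\<lambda>Z. f Z $ r) (transpose Z)"
    by (rule dd_neg_direction[OF laurent_fieldsD[OF assms(1)]])
  then show "pd p (transposed f) Z $ r = field_scale (transp_sign p) (transposed (pd p f)) Z $ r"
    using transpose_qe[OF assms(2)]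
    by (cases "p = 2") (simp_all add: pd_nth transposed_def dd_transpose[of _ "\<lambda>Z. f Z $ r"] transp_sign_def field_scale_nth)
qed

lemma pd_scale: "f \<in> laurent_fields \<Longrightarrow> pd p (field_scale c f) = field_scale c (pd p f)"
  using pd_linear[of f 0 p c] fields.subspace_0[OF laurent_fields_subspace] pd_linear[of 0 0 p "-1"] by simp

lemma transp_sign_square: "transp_sign p * (transp_sign p * x) = x"
  by (simp add: transp_sign_def)

lemma laplace_transp:
  assumes f: "f \<in> laurent_fields"
  shows "laplace (transposed f) = transposed (laplace f)"
proof -
  have "pd p (pd p (transposed f)) = transposed (pd p (pd p f))" if "p < 4" for p
    using f that transp_sign_square[of p 1]
    by (simp add: pd_transp pd_scale pd_closed transp_linear)
  then show ?thesis
    by (simp add: laplace_alt fun_eq_iff sum_fun_apply transposed_def)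
qed

text \<open>
  The row \<open>v e\<^sub>p\<close> is the column \<open>e\<^sub>p\<^sup>T v\<close>, so the sign from \<open>pd_transp\<close> cancels the sign of \<open>e\<^sub>2\<^sup>T = - e\<^sub>2\<close>.
\<close>

lemma nabla_right_transp:
  assumes f: "f \<in> laurent_fields"
  shows "nabla_right (transposed f) Z = nabla_left f (transpose Z)"
proof -
  have "pd p (transposed f) Z v* qe_conj p = qe_conj p *v pd p f (transpose Z)" if "p < 4" for p
  proof -
    have "(transp_sign p *s x) v* qe_conj p = qe_conj p *v x" for x
      using that by (auto simp: vec_eq_iff forall_2 matrix_vector_mult_def vector_matrix_mult_def sum_2
          qe_conj_def qe_def transp_sign_def)
    then show ?thesis
      by (simp add: pd_transp[OF f that] field_scale_apply transposed_def)
  qed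
  then show ?thesis
    by (simp add: nabla_right_def nabla_left_def)
qed

lemma U_right_deg_transp: "U_right_deg d = transposed ` U_left_deg d"
proof -
  have "transposed f \<in> U_right_deg d \<longleftrightarrow> f \<in> U_left_deg d" for f
  proof -
    have "transposed f \<in> U_right \<longleftrightarrow> f \<in> U_left" if f: "f \<in> laurent_fields"
    proof -
      have "nabla_right (laplace (transposed f)) Z = nabla_left (laplace f) (transpose Z)" for Z
        by (simp add: laplace_transp f nabla_right_transp laplace_closed)
      then have "nabla_right (laplace (transposed f)) = (\<lambda>Z. 0) \<longleftrightarrow> nabla_left (laplace f) = (\<lambda>Z. 0)"
        by (metis (no_types, lifting) transpose_transpose ext)
      moreover have "\<forall>i. (\<lambda>Z. transposed f Z $ i) \<in> laurent" "\<forall>i. (\<lambda>Z. f Z $ i) \<in> laurent"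
        using f transp_laurent[OF f] by (simp_all add: laurent_fields_def)
      ultimately show ?thesis
        by (simp add: U_right_def U_left_def)
    qed
    moreover have "homogeneous d (transposed f) \<longleftrightarrow> homogeneous d f"
    proof -
      have "transpose (hscale c Z) = hscale c (transpose Z)" for c Z
        by (simp add: hc_eq_iff transpose_nth)
      then show ?thesis
        unfolding homogeneous_def transposed_def by (metis transpose_transpose)
    qed
    moreover have "transposed f \<in> U_right \<Longrightarrow> f \<in> laurent_fields" "f \<in> U_left \<Longrightarrow> f \<in> laurent_fields"
      using transp_laurent_iff[of f] by (auto simp: U_right_def U_left_def laurent_fields_def simp del: transp_laurent_iff)
    ultimately show ?thesis
      by (auto simp: U_right_deg_def U_left_deg_def)
  qed
  then show ?thesis
    by (metis (no_types, lifting) image_eqI image_subsetI subsetI subset_antisym transp_transp)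
qed

lemma matrix_inv_inverse:
  fixes M :: hc
  assumes "det M \<noteq> 0"
  shows "M ** matrix_inv M = mat 1" "matrix_inv M ** M = mat 1"
proof -
  have "M ** matrix_inv M = mat 1 \<and> matrix_inv M ** M = mat 1"
    unfolding matrix_inv_def
    by (rule someI_ex) (use assms invertible_det_nz[of M] in \<open>auto simp: invertible_def\<close>)
  then show "M ** matrix_inv M = mat 1" "matrix_inv M ** M = mat 1"
    by auto
qed

lemma block_diag_nth:
  "block_diag A D $ Inl i $ Inl j = A $ i $ j" "block_diag A D $ Inl i $ Inr j' = 0"
  "block_diag A D $ Inr i' $ Inl j = 0" "block_diag A D $ Inr i' $ Inr j' = D $ i' $ j'"
  by (simp_all add: block_diag_def)

lemma sum_over_blocks: "(\<Sum>x\<in>UNIV. f x) = f (Inl 1) + f (Inl 2) + f (Inr 1) + f (Inr 2)"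
  for f :: "2 + 2 \<Rightarrow> 'a::comm_monoid_add"
proof -
  have "x \<in> {Inl 1, Inl 2, Inr 1, Inr 2}" for x :: "2 + 2"
    by (cases x) (use exhaust_2 in auto)
  then have U: "(UNIV :: (2 + 2) set) = {Inl 1, Inl 2, Inr 1, Inr 2}"
    by blast
  show ?thesis
    unfolding U by (simp add: add.assoc)
qed

lemma block_matrix_inv:
  assumes "det M \<noteq> 0" "det M' \<noteq> 0"
  shows "matrix_inv (block_diag M M') = block_diag (matrix_inv M) (matrix_inv M')"
proof (rule matrix_inv_eqI)
  have mult: "block_diag A B ** block_diag A' B' = block_diag (A ** A') (B ** B')" for A B A' B'
  proof -
    have "(block_diag A B ** block_diag A' B') $ r $ s = block_diag (A ** A') (B ** B') $ r $ s" for r s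
      by (cases r; cases s) (simp_all add: matrix_matrix_mult_def sum_over_blocks sum_2 block_diag_nth)
    then show ?thesis
      by (simp add: vec_eq_iff)
  qed
  have one: "block_diag (mat 1) (mat 1) = (mat 1 :: gl2hc)"
  proof -
    have "block_diag (mat 1) (mat 1) $ r $ s = (mat 1 :: gl2hc) $ r $ s" for r s
      by (cases r; cases s) (simp_all add: mat_def block_diag_nth)
    then show ?thesis
      by (simp add: vec_eq_iff)
  qed
  show "block_diag M M' ** block_diag (matrix_inv M) (matrix_inv M') = mat 1"
    "block_diag (matrix_inv M) (matrix_inv M') ** block_diag M M' = mat 1"
    using assms by (simp_all add: mult matrix_inv_inverse one)
qed

lemma hadd1_entry: "hadd1 t A $ i $ j = (if i = j then 1 else 0) + t * A $ i $ j"
proof -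
  have "i = 1 \<or> i = 2" "j = 1 \<or> j = 2"
    using exhaust_2 by auto
  then show ?thesis by auto
qed

lemma curve_block_diag: "mat 1 + (\<chi> r s. t * block_diag A D $ r $ s) = block_diag (hadd1 t A) (hadd1 t D)"
  by (auto simp: vec_eq_iff block_diag_def mat_def hadd1_entry simp del: hadd1_nth split: sum.split)

lemma dpi_right_block_diag:
  assumes g: "g \<in> laurent_fields" and D: "D \<in> sl2"
  shows "dpi_right (block_diag A D) g Z $ r
    = - (g Z v* D) $ r + dd (Z ** D - A ** Z) (\<lambda>Z. g Z $ r) Z"
proof -
  let ?\<gamma> = "\<lambda>t. matrix_inv (hadd1 t A) ** (Z ** hadd1 t D)"
  let ?p = "\<lambda>t. det (hadd1 t D) * (g (?\<gamma> t) $ 1 * matrix_inv (hadd1 t D) $ 1 $ r + g (?\<gamma> t) $ 2 * matrix_inv (hadd1 t D) $ 2 $ r)"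
  have blocks: "block11 (block_diag X Y) = X" "block12 (block_diag X Y) = 0"
    "block21 (block_diag X Y) = 0" "block22 (block_diag X Y) = Y" for X Y
    by (simp_all add: block11_def block12_def block21_def block22_def block_diag_def vec_eq_iff)
  have zero_mult: "(0 :: hc) ** Z = 0"
    by (simp add: hc_eq_iff hc_mult_nth)
  have pi: "\<forall>\<^sub>F t in nhds 0. ?p t = pi_right (mat 1 + (\<chi> r s. t * block_diag A D $ r $ s)) g Z $ r"
    using det_hadd1_nz[of A] det_hadd1_nz[of D]
  proof eventually_elim
    case (elim t)
    have inv: "matrix_inv (matrix_inv (hadd1 t D)) = hadd1 t D"
      by (rule matrix_inv_eqI) (use elim in \<open>simp_all add: matrix_inv_inverse\<close>)
    have "det (hadd1 t D) * det (matrix_inv (hadd1 t D)) = 1"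
      using matrix_inv_inverse(1)[OF elim(2)] det_mul[of "hadd1 t D" "matrix_inv (hadd1 t D)"] by simp
    then have "1 / det (matrix_inv (hadd1 t D)) = det (hadd1 t D)"
      by (metis mult.commute nonzero_eq_divide_eq mult_zero_right zero_neq_one)
    then show ?case
      by (simp add: pi_right_def Let_def curve_block_diag block_matrix_inv[OF elim] blocks zero_mult inv
          vector_matrix_mult_def sum_2 matrix_mul_assoc)
  qed
  have r: "r = 1 \<or> r = 2"
    using exhaust_2 by auto
  have deriv: "dpi_right (block_diag A D) g Z $ r = d" if "(?p has_field_derivative d) (at 0)" for d
    unfolding dpi_right_def vec_lambda_beta
    by (rule DERIV_imp_deriv) (use that in \<open>subst (asm) DERIV_cong_ev[OF refl pi refl]\<close>)
  show ?thesis
  proof (cases "det Z = 0")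
    case True
    then have "det (?\<gamma> t) = 0" for t
      by (simp add: det_mul)
    then have z: "g (?\<gamma> t) $ s = 0" for t s
      using laurent_singular[OF laurent_fieldsD[OF g]] by blast
    moreover have "g Z $ s = 0" for s
      using laurent_singular[OF laurent_fieldsD[OF g] True] by blast
    ultimately show ?thesis
      using True deriv[of 0] by (simp add: vector_matrix_mult_def)
  next
    case False
    have f: "((\<lambda>t. g (?\<gamma> t) $ s) has_field_derivative dd (Z ** D - A ** Z) (\<lambda>Z. g Z $ s) Z) (at 0)" for s
      by (rule laurent_curve[OF laurent_fieldsD[OF g] False curve_conj])
    have tr: "D $ 1 $ 1 + D $ 2 $ 2 = 0"
      using D by (simp add: sl2_iff)
    have "(?p has_field_derivative - (g Z v* D) $ r + dd (Z ** D - A ** Z) (\<lambda>Z. g Z $ r) Z) (at 0)"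
    proof (rule DERIV_cong[OF DERIV_mult[OF det_hadd1_deriv DERIV_add[OF DERIV_mult[OF f inv_hadd1_deriv] DERIV_mult[OF f inv_hadd1_deriv]]]])
      have "?\<gamma> 0 = Z"
        by (rule curve_at_0[OF curve_conj])
      moreover have "matrix_inv (hadd1 0 D) $ s $ r = (if s = r then 1 else 0)" for s
        unfolding hadd1_0 matrix_inv_mat_1 by (simp add: mat_def)
      ultimately show "(D $ 1 $ 1 + D $ 2 $ 2)
          * (g (?\<gamma> 0) $ 1 * matrix_inv (hadd1 0 D) $ 1 $ r + g (?\<gamma> 0) $ 2 * matrix_inv (hadd1 0 D) $ 2 $ r)
          + (dd (Z ** D - A ** Z) (\<lambda>Z. g Z $ 1) Z * matrix_inv (hadd1 0 D) $ 1 $ r + - D $ 1 $ r * g (?\<gamma> 0) $ 1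
             + (dd (Z ** D - A ** Z) (\<lambda>Z. g Z $ 2) Z * matrix_inv (hadd1 0 D) $ 2 $ r + - D $ 2 $ r * g (?\<gamma> 0) $ 2))
          * det (hadd1 0 D)
        = - (g Z v* D) $ r + dd (Z ** D - A ** Z) (\<lambda>Z. g Z $ r) Z"
        using r by (auto simp: tr vector_matrix_mult_def sum_2 algebra_simps)
    qed
    then show ?thesis
      by (rule deriv)
  qed
qed

text \<open>
  Transposing \<open>Z D - A Z\<close> gives \<open>D\<^sup>T Z\<^sup>T - Z\<^sup>T A\<^sup>T\<close>, the infinitesimal motion of \<open>Z\<^sup>T\<close> for the pair
  \<open>(- D\<^sup>T, - A\<^sup>T)\<close>; the matrix \<open>D\<close> acts on rows as \<open>D\<^sup>T\<close> does on columns.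
\<close>

lemma dpi_right_transp:
  assumes f: "f \<in> laurent_fields" and AD: "A \<in> sl2" "D \<in> sl2"
  shows "dpi_right (block_diag A D) (transposed f) = transposed (dpi_left (block_diag (dual D) (dual A)) f)"
proof (rule field_eqI)
  fix Z r
  have e: "transpose (Z ** D - A ** Z) = transpose Z ** dual A - dual D ** transpose Z"
    by (simp add: hc_eq_iff transpose_nth hc_mult_nth algebra_simps)
  have 1: "dd (Z ** D - A ** Z) (\<lambda>Z. transposed f Z $ r) Z
      = dd (transpose Z ** dual A - dual D ** transpose Z) (\<lambda>Z. f Z $ r) (transpose Z)"
    using dd_transpose[of "Z ** D - A ** Z" "\<lambda>Z. f Z $ r" Z] by (simp only: transposed_def e)
  have 2: "dual D *v x = - (x v* D)" for x
    by (simp add: vec_eq_iff matrix_vector_mult_def vector_matrix_mult_def sum_2 algebra_simps)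
  show "dpi_right (block_diag A D) (transposed f) Z $ r = transposed (dpi_left (block_diag (dual D) (dual A)) f) Z $ r"
    unfolding dpi_right_block_diag[OF transp_laurent[OF f] AD(2)] 1
    by (simp add: transposed_def dpi_left_block_diag[OF f] AD 2)
qed

text \<open>
  Stated for arbitrary actions, so that it can be used to pass from columns to rows and back.
\<close>

lemma iso_box_transp:
  assumes box: "iso_box act j k M"
    and act: "\<And>A D f. A \<in> sl2 \<Longrightarrow> D \<in> sl2 \<Longrightarrow> f \<in> M \<Longrightarrow>
      act' (block_diag A D) (transposed f) = transposed (act (block_diag (dual D) (dual A)) f)"
  shows "iso_box act' k j (transposed ` M)"
proof -
  obtain V \<rho> W \<sigma> \<phi> where V: "is_V j V \<rho>" and W: "is_V k W \<sigma>"
    and lin: "Vector_Spaces.linear tensor_scale field_scale \<phi>" and bij: "bij_betw \<phi> (tensor_space V W) M"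
    and act0: "\<And>A D v w. A \<in> sl2 \<Longrightarrow> D \<in> sl2 \<Longrightarrow> v \<in> V \<Longrightarrow> w \<in> W \<Longrightarrow>
      act (block_diag A D) (\<phi> (pure_tensor v w)) = \<phi> (pure_tensor (\<rho> A v) w + pure_tensor v (\<sigma> D w))"
    using box unfolding iso_box_def by blast
  interpret \<phi>: Vector_Spaces.linear tensor_scale field_scale \<phi>
    by (fact lin)
  define sw where "sw T = (\<lambda>i j. T j i)" for T :: "nat \<Rightarrow> cseq"
  have sw_sw: "sw (sw T) = T" for T
    by (simp add: sw_def)
  have sw_lin: "sw (S + T) = sw S + sw T" "sw (tensor_scale c T) = tensor_scale c (sw T)" for S T c
    by (simp_all add: sw_def fun_eq_iff pointwise)
  have sw_pure: "sw (pure_tensor v w) = pure_tensor w v" for v w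
    by (simp add: sw_def pure_tensor_def fun_eq_iff)
  have sw_linear: "Vector_Spaces.linear tensor_scale tensor_scale sw"
    by unfold_locales (simp_all add: sw_lin)
  interpret sw: Vector_Spaces.linear tensor_scale tensor_scale sw
    by (fact sw_linear)
  have sw_space: "sw ` tensor_space V W = tensor_space W V" for V W
  proof -
    have "sw ` {pure_tensor v w | v w. v \<in> V \<and> w \<in> W} = {pure_tensor w v | w v. w \<in> W \<and> v \<in> V}"
      by (force simp: sw_pure image_iff)
    then show ?thesis
      unfolding tensor_space_def by (simp only: sw.span_image[symmetric])
  qed
  have bij_sw: "bij_betw sw (tensor_space W V) (tensor_space V W)"
    unfolding bij_betw_def sw_space by (metis inj_on_inverseI sw_sw)
  have bij_tr: "bij_betw transposed M (transposed ` M)"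
    using transp_inj by (meson inj_on_imp_bij_betw inj_on_subset subset_UNIV)
  let ?\<phi> = "\<lambda>T. transposed (\<phi> (sw T))"
  have "Vector_Spaces.linear tensor_scale field_scale ?\<phi>"
    by unfold_locales (simp_all add: sw_lin \<phi>.add \<phi>.scale transp_linear)
  moreover have "bij_betw ?\<phi> (tensor_space W V) (transposed ` M)"
    using bij_betw_trans[OF bij_betw_trans[OF bij_sw bij] bij_tr] by (simp add: o_def)
  moreover have "act' (block_diag A D) (?\<phi> (pure_tensor w v))
      = ?\<phi> (pure_tensor (\<sigma> (dual A) w) v + pure_tensor w (\<rho> (dual D) v))"
    if "A \<in> sl2" "D \<in> sl2" "v \<in> V" "w \<in> W" for A D v w
  proof -
    have "\<phi> (pure_tensor v w) \<in> M"
      using bij that unfolding tensor_space_def by (auto simp: bij_betw_def intro!: imageI tensors.span_base)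
    then show ?thesis
      using that by (simp add: sw_pure sw_lin act act0 add.commute)
  qed
  ultimately show ?thesis
    unfolding iso_box_def using dual_is_V[OF W] dual_is_V[OF V] by blast
qed

lemma components_transp:
  assumes comp: "sl2sl2_components act U (j1, k1) (j2, k2) (j3, k3) M1 M2 M3"
    and act: "\<And>A D f. A \<in> sl2 \<Longrightarrow> D \<in> sl2 \<Longrightarrow> f \<in> U \<Longrightarrow>
      act' (block_diag A D) (transposed f) = transposed (act (block_diag (dual D) (dual A)) f)"
  shows "sl2sl2_components act' (transposed ` U) (k1, j1) (k2, j2) (k3, j3) (transposed ` M1) (transposed ` M2) (transposed ` M3)"
proof -
  note sub = components_subset[OF comp]
  have bij: "bij_betw (\<lambda>(x, y, z). x + y + z) (M1 \<times> M2 \<times> M3) U"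
    and box: "iso_box act j1 k1 M1" "iso_box act j2 k2 M2" "iso_box act j3 k3 M3"
    using comp by (simp_all add: sl2sl2_components_def)
  have bij1: "bij_betw (map_prod transposed (map_prod transposed transposed)) (transposed ` M1 \<times> transposed ` M2 \<times> transposed ` M3) (M1 \<times> M2 \<times> M3)"
  proof -
    have "bij_betw transposed (transposed ` M) M" for M
      unfolding bij_betw_def by (auto simp: image_image intro!: inj_on_inverseI[of _ transposed])
    then show ?thesis
      by (intro bij_betw_map_prod)
  qed
  have bij2: "bij_betw transposed U (transposed ` U)"
    using transp_inj by (meson inj_on_imp_bij_betw inj_on_subset subset_UNIV)
  have "bij_betw (transposed \<circ> ((\<lambda>(x, y, z). x + y + z) \<circ> map_prod transposed (map_prod transposed transposed)))
      (transposed ` M1 \<times> transposed ` M2 \<times> transposed ` M3) (transposed ` U)"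
    by (rule bij_betw_trans[OF bij_betw_trans[OF bij1 bij] bij2])
  moreover have "transposed \<circ> ((\<lambda>(x, y, z). x + y + z) \<circ> map_prod transposed (map_prod transposed transposed)) = (\<lambda>(x, y, z). x + y + z)"
    by (simp add: fun_eq_iff[where 'b = field2] transp_linear)
  ultimately have "bij_betw (\<lambda>(x, y, z). x + y + z) (transposed ` M1 \<times> transposed ` M2 \<times> transposed ` M3) (transposed ` U)"
    by simp
  then show ?thesis
    unfolding sl2sl2_components_def
    using iso_box_transp[OF box(1), of act'] iso_box_transp[OF box(2), of act'] iso_box_transp[OF box(3), of act'] act sub
    by (simp add: subset_iff)
qed

section \<open>Symmetry of the coefficients under transposition\<close>

text \<open>
  The coefficient of \<open>u\<^sup>a s\<^sup>i\<close> in \<open>(x u + y)\<^sup>n = (z\<^sub>2\<^sub>2 s u - z\<^sub>2\<^sub>1 u - z\<^sub>1\<^sub>2 s + z\<^sub>1\<^sub>1)\<^sup>n\<close>. The polynomial is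
  invariant under the simultaneous exchange of \<open>s\<close> with \<open>u\<close> and \<open>Z\<close> with \<open>Z\<^sup>T\<close>, which interchanges
  the two indices of \<open>t\<close>.
\<close>

primrec bigen :: "nat \<Rightarrow> int \<Rightarrow> int \<Rightarrow> hc \<Rightarrow> complex" where
  "bigen 0 a i Z = (if a = 0 \<and> i = 0 then 1 else 0)"
| "bigen (Suc n) a i Z = Z $ 2 $ 2 * bigen n (a - 1) (i - 1) Z - Z $ 2 $ 1 * bigen n (a - 1) i Z
     - Z $ 1 $ 2 * bigen n a (i - 1) Z + Z $ 1 $ 1 * bigen n a i Z"

lemma bigen_transpose: "bigen n a i (transpose Z) = bigen n i a Z"
  by (induction n arbitrary: a i) (auto simp: transpose_nth)

lemma bigen_negative: "a < 0 \<Longrightarrow> bigen n a i Z = 0"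
  by (induction n arbitrary: a i) auto

lemma bigen_S: "bigen n (int a) i Z = of_nat (n choose a) * S a (n - a) i Z"
proof (induction n arbitrary: a i)
  case 0
  show ?case
    by (cases a) (simp_all add: S_0_0)
next
  case (Suc n)
  show ?case
  proof (cases a)
    case 0
    then show ?thesis
      using Suc.IH[of 0] by (simp add: bigen_negative S_Suc_right)
  next
    case (Suc a')
    have 1: "int a - 1 = int a'"
      by (simp add: Suc)
    have 2: "of_nat (n choose a) * (Z $ 1 $ 1 * S a (n - a) i Z - Z $ 1 $ 2 * S a (n - a) (i - 1) Z)
        = of_nat (n choose a) * S a (n - a') i Z"
    proof (cases "a \<le> n")
      case True
      then have "n - a' = Suc (n - a)"
        using Suc by simp
      then show ?thesis
        by (simp add: S_Suc_right)
    qed (simp add: binomial_eq_0)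
    have "bigen (Suc n) (int a) i Z = of_nat (n choose a') * (Z $ 2 $ 2 * S a' (n - a') (i - 1) Z - Z $ 2 $ 1 * S a' (n - a') i Z)
        + of_nat (n choose a) * (Z $ 1 $ 1 * S a (n - a) i Z - Z $ 1 $ 2 * S a (n - a) (i - 1) Z)"
      unfolding bigen.simps 1 Suc.IH by (simp add: algebra_simps)
    also have "\<dots> = (of_nat (n choose a') + of_nat (n choose a)) * S a (n - a') i Z"
      unfolding 2 by (simp add: Suc algebra_simps)
    finally show ?thesis
      by (simp add: Suc)
  qed
qed

lemma NS_transpose:
  "of_nat (n choose i) * NS p i (n - i) (int a) Z = of_nat (n choose a) * NS p a (n - a) (int i) (transpose Z)"
  using bigen_S[of n i "int a" Z] bigen_S[of n a "int i" "transpose Z"] bigen_transpose[of n "int a" "int i" Z]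
  by (cases "det Z = 0") (simp_all add: NS_def mult.left_commute)

text \<open>
  The two components carry different binomial coefficients; the factors \<open>b + 1\<close> and \<open>a + 1\<close>, which are
  the factors in the rows \<open>g\<^sup>(\<^sup>1\<^sup>)\<close> and \<open>g\<^sup>(\<^sup>3\<^sup>)\<close>, make them equal by the absorption identities.
\<close>

lemma F1_transpose:
  assumes "i \<le> a + b + 1"
  defines "c \<equiv> of_nat (Suc (a + b) * (a + b choose a)) / of_nat (Suc (a + b) choose i)"
  shows "c \<noteq> 0"
    and "of_nat (Suc b) * NS p i (Suc (a + b) - i) (int a) Z = c * F1 p a b (int i) (transpose Z) $ 1"
    and "- (of_nat (Suc a) * NS p i (Suc (a + b) - i) (int (Suc a)) Z) = c * F1 p a b (int i) (transpose Z) $ 2"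
proof -
  have ch: "of_nat (Suc (a + b) choose i) \<noteq> (0 :: complex)"
    using assms by (simp add: binomial_eq_0_iff del: binomial_Suc_Suc)
  show "c \<noteq> 0"
  proof -
    have "of_nat (Suc (a + b) * (a + b choose a)) \<noteq> (0 :: complex)"
      unfolding of_nat_eq_0_iff by (simp add: binomial_eq_0_iff)
    then show ?thesis
      using ch unfolding c_def by (simp only: divide_eq_0_iff simp_thms)
  qed
  have "Suc b * (Suc (a + b) choose a) = Suc (a + b) * (a + b choose a)"
    using binomial_absorb_comp[of "Suc (a + b)" a] by simp
  then have 1: "of_nat (Suc b) * of_nat (Suc (a + b) choose a) = (of_nat (Suc (a + b) * (a + b choose a)) :: complex)"
    by (metis of_nat_mult)
  have "Suc a * (Suc (a + b) choose Suc a) = Suc (a + b) * (a + b choose a)"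
    using binomial_absorption[of a "Suc (a + b)"] by simp
  then have 2: "of_nat (Suc a) * of_nat (Suc (a + b) choose Suc a) = (of_nat (Suc (a + b) * (a + b choose a)) :: complex)"
    by (metis of_nat_mult)
  have "of_nat (Suc (a + b) choose i) * (of_nat (Suc b) * NS p i (Suc (a + b) - i) (int a) Z)
      = of_nat (Suc b) * of_nat (Suc (a + b) choose a) * NS p a (Suc (a + b) - a) (int i) (transpose Z)"
    using NS_transpose[of "Suc (a + b)" i p a Z] by (simp only: mult.left_commute mult.assoc)
  then show "of_nat (Suc b) * NS p i (Suc (a + b) - i) (int a) Z = c * F1 p a b (int i) (transpose Z) $ 1"
    unfolding 1 c_def F_nth using ch by (simp add: nonzero_eq_divide_eq mult.commute Suc_diff_le del: of_nat_Suc binomial_Suc_Suc of_nat_mult)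
  have "of_nat (Suc (a + b) choose i) * (of_nat (Suc a) * NS p i (Suc (a + b) - i) (int (Suc a)) Z)
      = of_nat (Suc a) * of_nat (Suc (a + b) choose Suc a) * NS p (Suc a) (Suc (a + b) - Suc a) (int i) (transpose Z)"
    using NS_transpose[of "Suc (a + b)" i p "Suc a" Z] by (simp only: mult.left_commute mult.assoc)
  then show "- (of_nat (Suc a) * NS p i (Suc (a + b) - i) (int (Suc a)) Z) = c * F1 p a b (int i) (transpose Z) $ 2"
    unfolding 2 c_def F_nth using ch by (simp add: nonzero_eq_divide_eq mult.commute del: of_nat_Suc binomial_Suc_Suc of_nat_mult)
qed

text \<open>
  Here the factors \<open>a\<close> and \<open>b\<close> are those of \<open>F2\<close>, so the rows \<open>g\<^sup>(\<^sup>2\<^sup>)\<close> have none. If \<open>a = 0\<close> or \<open>b = 0\<close> the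
  corresponding component of \<open>F2\<close> is zero.
\<close>

lemma F2_transpose:
  assumes "i < a + b"
  defines "c \<equiv> of_nat (a + b choose a) / of_nat ((a + b) * (a + b - 1 choose i))"
  shows "c \<noteq> 0"
    and "a > 0 \<Longrightarrow> NS p i (a + b - 1 - i) (int (a - 1)) Z = c * F2 p a b (int i) (transpose Z) $ 1"
    and "b > 0 \<Longrightarrow> NS p i (a + b - 1 - i) (int a) Z = c * F2 p a b (int i) (transpose Z) $ 2"
proof -
  have ch: "of_nat (a + b - 1 choose i) \<noteq> (0 :: complex)"
    using assms by (simp add: binomial_eq_0_iff)
  have ab: "of_nat (a + b) \<noteq> (0 :: complex)"
    unfolding of_nat_eq_0_iff using assms(1) by arith
  show "c \<noteq> 0"
  proof -
    have "of_nat (a + b choose a) \<noteq> (0 :: complex)"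
      unfolding of_nat_eq_0_iff by (simp add: binomial_eq_0_iff)
    then show ?thesis
      using ch ab unfolding c_def of_nat_mult by (simp only: divide_eq_0_iff mult_eq_0_iff simp_thms)
  qed
  {
    assume "a > 0"
    have "a * (a + b choose a) = (a + b) * (a + b - 1 choose (a - 1))"
      using binomial_absorption[of "a - 1" "a + b"] \<open>a > 0\<close> by simp
    then have 1: "of_nat a * of_nat (a + b choose a) = (of_nat (a + b) * of_nat (a + b - 1 choose (a - 1)) :: complex)"
      by (metis of_nat_mult)
    have "a + b - 1 - (a - 1) = b"
      using \<open>a > 0\<close> by simp
    then have "of_nat (a + b) * (of_nat (a + b - 1 choose i) * NS p i (a + b - 1 - i) (int (a - 1)) Z)
        = of_nat (a + b) * (of_nat (a + b - 1 choose (a - 1)) * NS p (a - 1) b (int i) (transpose Z))"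
      using NS_transpose[of "a + b - 1" i p "a - 1" Z] by simp
    also have "\<dots> = of_nat (a + b choose a) * (of_nat a * NS p (a - 1) b (int i) (transpose Z))"
      unfolding mult.assoc[symmetric] 1[symmetric] by (simp only: ac_simps)
    finally show "NS p i (a + b - 1 - i) (int (a - 1)) Z = c * F2 p a b (int i) (transpose Z) $ 1"
      unfolding c_def F_nth of_nat_mult using ch ab by (simp add: field_simps del: of_nat_add)
  }
  {
    assume "b > 0"
    have "b * (a + b choose a) = (a + b) * (a + b - 1 choose a)"
      using binomial_absorb_comp[of "a + b" a] by simp
    then have 2: "of_nat b * of_nat (a + b choose a) = (of_nat (a + b) * of_nat (a + b - 1 choose a) :: complex)"
      by (metis of_nat_mult)
    have "a + b - 1 - a = b - 1"
      by simp
    then have "of_nat (a + b) * (of_nat (a + b - 1 choose i) * NS p i (a + b - 1 - i) (int a) Z)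
        = of_nat (a + b) * (of_nat (a + b - 1 choose a) * NS p a (b - 1) (int i) (transpose Z))"
      using NS_transpose[of "a + b - 1" i p a Z] by simp
    also have "\<dots> = of_nat (a + b choose a) * (of_nat b * NS p a (b - 1) (int i) (transpose Z))"
      unfolding mult.assoc[symmetric] 2[symmetric] by (simp only: ac_simps)
    finally show "NS p i (a + b - 1 - i) (int a) Z = c * F2 p a b (int i) (transpose Z) $ 2"
      unfolding c_def F_nth of_nat_mult using ch ab by (simp add: field_simps del: of_nat_add)
  }
qed

lemma field2_eqI: "(\<And>Z. det Z \<noteq> 0 \<Longrightarrow> f Z $ 1 = g Z $ 1 \<and> f Z $ 2 = g Z $ 2) \<Longrightarrow>
  (\<And>Z. det Z = 0 \<Longrightarrow> f Z = 0 \<and> g Z = 0) \<Longrightarrow> f = (g :: field2)"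
  unfolding field_eq_iff_2 by metis

lemma F_singular: "det Z = 0 \<Longrightarrow> F1 p a b i Z = 0" "det Z = 0 \<Longrightarrow> F2 p a b i Z = 0"
  by (simp_all add: vec_eq_iff forall_2 NS_def)

lemma gt1_F1:
  assumes "l = real k / 2" "a \<le> k" "i \<le> k + 1" "m = l - real a" "n = l + 1/2 - real i"
  shows "\<exists>c. c \<noteq> 0 \<and> gt1 l m n = field_scale c (transposed (F1 (- int k - 1) a (k - a) (int i)))"
proof -
  define b where "b = k - a"
  have k: "k = a + b"
    using assms(2) by (simp add: b_def)
  have i: "i \<le> a + b + 1"
    using assms(3) k by simp
  note F0 = F1_transpose(1)[OF i] and F = F1_transpose(2,3)[OF i, of "- int k - 1"]
  define c :: complex where "c = of_nat (Suc (a + b) * (a + b choose a)) / of_nat (Suc (a + b) choose i)"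
  have "gt1 l m n = field_scale c (transposed (F1 (- int k - 1) a b (int i)))"
  proof (rule field2_eqI)
    fix Z :: hc assume Z: "det Z \<noteq> 0"
    have p: "- int (Suc (a + b)) = - int k - 1"
      by (simp add: k)
    have t1: "tcoef (l + 1/2) (m + 1/2) n (matrix_inv Z) = NS (- int (Suc (a + b))) i (Suc (a + b) - i) (int a) Z"
      using assms k by (intro tcoef_inverse Z) (auto simp: field_simps)
    have t2: "tcoef (l + 1/2) (m - 1/2) n (matrix_inv Z) = NS (- int (Suc (a + b))) i (Suc (a + b) - i) (int (Suc a)) Z"
      using assms k by (intro tcoef_inverse Z) (auto simp: field_simps)
    have "l + m + 1 = real (Suc b)" "l - m + 1 = real (Suc a)"
      using assms k by simp_all
    then have "gt1 l m n Z = vector [of_nat (Suc b) * NS (- int k - 1) i (Suc (a + b) - i) (int a) Z,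
        - (of_nat (Suc a) * NS (- int k - 1) i (Suc (a + b) - i) (int (Suc a)) Z)]"
      unfolding gt1_def ext0_regular[OF Z] t1 t2 p by (simp only: of_real_of_nat_eq)
    then show "gt1 l m n Z $ 1 = field_scale c (transposed (F1 (- int k - 1) a b (int i))) Z $ 1
        \<and> gt1 l m n Z $ 2 = field_scale c (transposed (F1 (- int k - 1) a b (int i))) Z $ 2"
      unfolding field_scale_nth transposed_def using F(1,2)[of Z] by (simp only: vector_2 c_def)
  qed (simp add: gt1_def field_scale_apply transposed_def F_singular)
  then show ?thesis
    using F0 by (intro exI[of _ c]) (simp only: c_def b_def simp_thms)
qed

lemma gt3_F1:
  assumes "l = real k / 2" "a + 2 \<le> k" "i + 1 \<le> k" "m = l - 1 - real a" "n = l - 1/2 - real i"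
  shows "\<exists>c. c \<noteq> 0 \<and> gt3 l m n = field_scale c (transposed (F1 (- int k) a (k - 2 - a) (int i)))"
proof -
  define b where "b = k - 2 - a"
  have k: "k = a + b + 2"
    using assms(2) by (simp add: b_def)
  have i: "i \<le> a + b + 1"
    using assms(3) k by simp
  note F0 = F1_transpose(1)[OF i] and F = F1_transpose(2,3)[OF i, of "- int k"]
  define c :: complex where "c = of_nat (Suc (a + b) * (a + b choose a)) / of_nat (Suc (a + b) choose i)"
  have "gt3 l m n = field_scale c (transposed (F1 (- int k) a b (int i)))"
  proof (rule field2_eqI)
    fix Z :: hc assume Z: "det Z \<noteq> 0"
    have p: "- int (Suc (a + b)) - 1 = - int k"
      by (simp add: k)
    have t1: "tcoef (l - 1/2) (m + 1/2) n (matrix_inv Z) = NS (- int (Suc (a + b))) i (Suc (a + b) - i) (int a) Z"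
      using assms k by (intro tcoef_inverse Z) (auto simp: field_simps)
    have t2: "tcoef (l - 1/2) (m - 1/2) n (matrix_inv Z) = NS (- int (Suc (a + b))) i (Suc (a + b) - i) (int (Suc a)) Z"
      using assms k by (intro tcoef_inverse Z) (auto simp: field_simps)
    have lm: "l + m = real (Suc b)" "l - m = real (Suc a)"
      using assms k by simp_all
    have "gt3 l m n Z $ 1 = of_nat (Suc b) * (1 / det Z * NS (- int (Suc (a + b))) i (Suc (a + b) - i) (int a) Z)"
      "gt3 l m n Z $ 2 = - (of_nat (Suc a) * (1 / det Z * NS (- int (Suc (a + b))) i (Suc (a + b) - i) (int (Suc a)) Z))"
      unfolding gt3_def ext0_regular[OF Z] t1 t2 lm by (simp_all del: of_nat_Suc)
    then show "gt3 l m n Z $ 1 = field_scale c (transposed (F1 (- int k) a b (int i))) Z $ 1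
        \<and> gt3 l m n Z $ 2 = field_scale c (transposed (F1 (- int k) a b (int i))) Z $ 2"
      unfolding NS_inv_det p field_scale_nth transposed_def using F(1,2)[of Z] by (simp only: c_def simp_thms)
  qed (simp add: gt3_def field_scale_apply transposed_def F_singular)
  then show ?thesis
    using F0 by (intro exI[of _ c]) (simp only: c_def b_def simp_thms)
qed

lemma gt2_F2:
  assumes "l = real k / 2" "a \<le> k" "i + 1 \<le> k" "m = l - real a" "n = l - 1/2 - real i"
  shows "\<exists>c. c \<noteq> 0 \<and> gt2 l m n = field_scale c (transposed (F2 (- int k) a (k - a) (int i)))"
proof -
  define b where "b = k - a"
  have k: "k = a + b"
    using assms(2) by (simp add: b_def)
  have i: "i < a + b"
    using assms(3) k by simp
  note F0 = F2_transpose(1)[OF i] and F = F2_transpose(2,3)[OF i, of "- int k"]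
  define c :: complex where "c = of_nat (a + b choose a) / of_nat ((a + b) * (a + b - 1 choose i))"
  have "gt2 l m n = field_scale c (transposed (F2 (- int k) a b (int i)))"
  proof (rule field2_eqI)
    fix Z :: hc assume Z: "det Z \<noteq> 0"
    have p: "- int (a + b - 1) - 1 = - int k"
      using i by (simp add: k)
    have g: "gt2 l m n Z $ 1 = 1 / det Z * tcoef (l - 1/2) (m + 1/2) n (matrix_inv Z)"
      "gt2 l m n Z $ 2 = 1 / det Z * tcoef (l - 1/2) (m - 1/2) n (matrix_inv Z)"
      unfolding gt2_def ext0_regular[OF Z] by simp_all
    have "gt2 l m n Z $ 1 = c * F2 (- int k) a b (int i) (transpose Z) $ 1"
    proof (cases "a > 0")
      case True
      have t: "tcoef (l - 1/2) (m + 1/2) n (matrix_inv Z) = NS (- int (a + b - 1)) i (a + b - 1 - i) (int (a - 1)) Z"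
        using assms k True by (intro tcoef_inverse Z) (auto simp: field_simps of_nat_diff)
      show ?thesis
        unfolding g t NS_inv_det p using F(1)[OF True, of Z] by (simp only: c_def)
    next
      case False
      then have "tcoef (l - 1/2) (m + 1/2) n (matrix_inv Z) = 0"
        using assms by (intro tcoef_out_of_range) simp
      then show ?thesis
        unfolding g using False by simp
    qed
    moreover have "gt2 l m n Z $ 2 = c * F2 (- int k) a b (int i) (transpose Z) $ 2"
    proof (cases "b > 0")
      case True
      have t: "tcoef (l - 1/2) (m - 1/2) n (matrix_inv Z) = NS (- int (a + b - 1)) i (a + b - 1 - i) (int a) Z"
        using assms k True by (intro tcoef_inverse Z) (auto simp: field_simps of_nat_diff)
      show ?thesis
        unfolding g t NS_inv_det p using F(2)[OF True, of Z] by (simp only: c_def)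
    next
      case False
      then have "tcoef (l - 1/2) (m - 1/2) n (matrix_inv Z) = 0"
        using assms k by (intro tcoef_out_of_range) simp
      then show ?thesis
        unfolding g using False by simp
    qed
    ultimately show "gt2 l m n Z $ 1 = field_scale c (transposed (F2 (- int k) a b (int i))) Z $ 1
        \<and> gt2 l m n Z $ 2 = field_scale c (transposed (F2 (- int k) a b (int i))) Z $ 2"
      by (simp only: field_scale_nth transposed_def simp_thms)
  qed (simp add: gt2_def field_scale_apply transposed_def F_singular)
  then show ?thesis
    using F0 by (intro exI[of _ c]) (simp only: c_def b_def simp_thms)
qed

section \<open>The spanning sets\<close>

lemma steps_pair:
  assumes "b - a = real N" "b' - a' = real N'"
  shows "{f m n | m n. m \<in> steps a b \<and> n \<in> steps a' b'} = (\<lambda>(x, y). f (b - real x) (b' - real y)) ` ({..N} \<times> {..N'})"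
  unfolding steps_down[OF assms(1)] steps_down[OF assms(2)] by force

lemma ft1_basis1:
  assumes l: "l = real k / 2"
  shows "{ft1 l m n | m n. m \<in> steps (- l - 1/2) (l + 1/2) \<and> n \<in> steps (- l) l} = basis1 k"
proof -
  have "{ft1 l m n | m n. m \<in> steps (- l - 1/2) (l + 1/2) \<and> n \<in> steps (- l) l}
      = (\<lambda>(i, a). ft1 l (l + 1/2 - real i) (l - real a)) ` ({..k + 1} \<times> {..k})"
    by (rule steps_pair) (simp_all add: l)
  also have "\<dots> = (\<lambda>(i, a). F1 (- int k - 1) a (k - a) (int i)) ` ({..k + 1} \<times> {..k})"
    by (intro image_cong refl) (auto intro!: ft1_F1 l)
  also have "\<dots> = basis1 k"
    by (force simp: basis1_def)
  finally show ?thesis .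
qed

lemma ft2_basis2:
  assumes l: "l = real k / 2"
  shows "{ft2 l m n | m n. m \<in> steps (- l + 1/2) (l - 1/2) \<and> n \<in> steps (- l) l} = basis2 k"
proof (cases "k = 0")
  case True
  then show ?thesis
    by (simp add: l steps_empty basis2_def)
next
  case False
  have "{ft2 l m n | m n. m \<in> steps (- l + 1/2) (l - 1/2) \<and> n \<in> steps (- l) l}
      = (\<lambda>(i, a). ft2 l (l - 1/2 - real i) (l - real a)) ` ({..k - 1} \<times> {..k})"
    by (rule steps_pair) (use False in \<open>simp_all add: l of_nat_diff Suc_le_eq\<close>)
  also have "\<dots> = (\<lambda>(i, a). F2 (- int k) a (k - a) (int i)) ` ({..k - 1} \<times> {..k})"
    by (intro image_cong refl) (use False in \<open>auto intro!: ft2_F2 l\<close>)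
  also have "\<dots> = basis2 k"
    using False by (force simp: basis2_def)
  finally show ?thesis .
qed

lemma ft3_basis3:
  assumes l: "l = real k / 2"
  shows "{ft3 l m n | m n. m \<in> steps (- l + 1/2) (l - 1/2) \<and> n \<in> steps (- l + 1) (l - 1)} = basis3 k"
proof (cases "k \<ge> 2")
  case False
  then have "l - 1 < - l + 1"
    by (simp add: l)
  with False show ?thesis
    by (auto simp: steps_empty basis3_def)
next
  case True
  have "{ft3 l m n | m n. m \<in> steps (- l + 1/2) (l - 1/2) \<and> n \<in> steps (- l + 1) (l - 1)}
      = (\<lambda>(i, a). ft3 l (l - 1/2 - real i) (l - 1 - real a)) ` ({..k - 1} \<times> {..k - 2})"
    by (rule steps_pair) (use True in \<open>simp_all add: l of_nat_diff\<close>)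
  also have "\<dots> = (\<lambda>(i, a). F1 (- int k) a (k - 2 - a) (int i)) ` ({..k - 1} \<times> {..k - 2})"
    by (intro image_cong refl) (use True in \<open>auto intro!: ft3_F1 l simp del: diff_diff_left\<close>)
  also have "\<dots> = basis3 k"
    using True by (force simp: basis3_def)
  finally show ?thesis .
qed

lemma transposed_span: "transposed ` cspan B = cspan (transposed ` B)"
proof -
  have "Vector_Spaces.linear field_scale field_scale transposed"
    by unfold_locales (simp_all add: transp_linear)
  then interpret transposed: Vector_Spaces.linear field_scale field_scale transposed .
  show ?thesis
    unfolding cspan_def by (rule transposed.span_image[symmetric])
qed

lemma span_proportional:
  assumes "\<And>x. x \<in> X \<Longrightarrow> \<exists>c. c \<noteq> 0 \<and> g x = field_scale c (f x)"
  shows "cspan (g ` X) = cspan (f ` X)"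
proof -
  obtain c where c: "\<And>x. x \<in> X \<Longrightarrow> c x \<noteq> 0 \<and> g x = field_scale (c x) (f x)"
    using assms by metis
  then have "g ` X = (\<lambda>x. field_scale (c x) (f x)) ` X"
    by (intro image_cong) auto
  then show ?thesis
    unfolding cspan_def using span_rescale[of X c f] c by simp
qed

lemma gt1_span:
  assumes l: "l = real k / 2"
  shows "cspan {gt1 l m n | m n. m \<in> steps (- l) l \<and> n \<in> steps (- l - 1/2) (l + 1/2)} = transposed ` cspan (basis1 k)"
proof -
  let ?X = "{..k} \<times> {..k + 1}"
  have "{gt1 l m n | m n. m \<in> steps (- l) l \<and> n \<in> steps (- l - 1/2) (l + 1/2)}
      = (\<lambda>(a, i). gt1 l (l - real a) (l + 1/2 - real i)) ` ?X"
    by (rule steps_pair) (simp_all add: l)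
  moreover have "cspan ((\<lambda>(a, i). gt1 l (l - real a) (l + 1/2 - real i)) ` ?X)
      = cspan ((\<lambda>(a, i). transposed (F1 (- int k - 1) a (k - a) (int i))) ` ?X)"
    by (rule span_proportional) (auto intro!: gt1_F1 l)
  moreover have "(\<lambda>(a, i). transposed (F1 (- int k - 1) a (k - a) (int i))) ` ?X = transposed ` basis1 k"
    unfolding basis1_def by force
  ultimately show ?thesis
    by (simp only: transposed_span)
qed

lemma gt2_span:
  assumes l: "l = real k / 2"
  shows "cspan {gt2 l m n | m n. m \<in> steps (- l) l \<and> n \<in> steps (- l + 1/2) (l - 1/2)} = transposed ` cspan (basis2 k)"
proof (cases "k = 0")
  case True
  then show ?thesis
    by (simp add: l steps_empty basis2_def transp_linear)
next
  case False
  let ?X = "{..k} \<times> {..k - 1}"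
  have "{gt2 l m n | m n. m \<in> steps (- l) l \<and> n \<in> steps (- l + 1/2) (l - 1/2)}
      = (\<lambda>(a, i). gt2 l (l - real a) (l - 1/2 - real i)) ` ?X"
    by (rule steps_pair) (use False in \<open>simp_all add: l of_nat_diff Suc_le_eq\<close>)
  moreover have "cspan ((\<lambda>(a, i). gt2 l (l - real a) (l - 1/2 - real i)) ` ?X)
      = cspan ((\<lambda>(a, i). transposed (F2 (- int k) a (k - a) (int i))) ` ?X)"
    by (rule span_proportional) (use False in \<open>auto intro!: gt2_F2 l\<close>)
  moreover have "(\<lambda>(a, i). transposed (F2 (- int k) a (k - a) (int i))) ` ?X = transposed ` basis2 k"
    using False by (force simp: basis2_def)
  ultimately show ?thesis
    by (simp only: transposed_span)
qed

lemma gt3_span: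
  assumes l: "l = real k / 2"
  shows "cspan {gt3 l m n | m n. m \<in> steps (- l + 1) (l - 1) \<and> n \<in> steps (- l + 1/2) (l - 1/2)} = transposed ` cspan (basis3 k)"
proof (cases "k \<ge> 2")
  case False
  then have "l - 1 < - l + 1"
    by (simp add: l)
  moreover have "basis3 k = {}"
    using False by (auto simp: basis3_def)
  ultimately show ?thesis
    by (simp add: steps_empty transp_linear)
next
  case True
  let ?X = "{..k - 2} \<times> {..k - 1}"
  have "{gt3 l m n | m n. m \<in> steps (- l + 1) (l - 1) \<and> n \<in> steps (- l + 1/2) (l - 1/2)}
      = (\<lambda>(a, i). gt3 l (l - 1 - real a) (l - 1/2 - real i)) ` ?X"
    by (rule steps_pair) (use True in \<open>simp_all add: l of_nat_diff\<close>)
  moreover have "cspan ((\<lambda>(a, i). gt3 l (l - 1 - real a) (l - 1/2 - real i)) ` ?X)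
      = cspan ((\<lambda>(a, i). transposed (F1 (- int k) a (k - 2 - a) (int i))) ` ?X)"
    by (rule span_proportional) (use True in \<open>auto intro!: gt3_F1 l simp del: diff_diff_left\<close>)
  moreover have "(\<lambda>(a, i). transposed (F1 (- int k) a (k - 2 - a) (int i))) ` ?X = transposed ` basis3 k"
    using True by (force simp: basis3_def)
  ultimately show ?thesis
    by (simp only: transposed_span)
qed

lemma right_components:
  fixes k :: nat
  defines "l \<equiv> real k / 2"
  shows "sl2sl2_components dpi_right (U_right_deg (- int k - 1)) (l + 1/2, l) (l - 1/2, l) (l - 1/2, l - 1) M1 M2 M3
    \<longleftrightarrow> M1 = transposed ` cspan (basis1 k) \<and> M2 = transposed ` cspan (basis2 k) \<and> M3 = transposed ` cspan (basis3 k)"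
    (is "?R M1 M2 M3 \<longleftrightarrow> ?rhs")
proof
  let ?U = "U_left_deg (- int k - 1)"
  let ?L = "sl2sl2_components dpi_left ?U (l, l + 1/2) (l, l - 1/2) (l - 1, l - 1/2)"
  note UR = U_right_deg_transp[of "- int k - 1"]
  have tt: "transposed ` transposed ` M = M" for M
    by (simp add: image_image)
  have "?R (transposed ` N1) (transposed ` N2) (transposed ` N3)" if "?L N1 N2 N3" for N1 N2 N3
    unfolding UR
  proof (rule components_transp[OF that])
    fix A D f assume "A \<in> sl2" "D \<in> sl2" "f \<in> ?U"
    then show "dpi_right (block_diag A D) (transposed f) = transposed (dpi_left (block_diag (dual D) (dual A)) f)"
      using U_left_deg_laurent by (intro dpi_right_transp) auto
  qed
  then show "?rhs \<Longrightarrow> ?R M1 M2 M3"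
    using left_components_exist[of k] by (simp add: l_def)
  assume R: "?R M1 M2 M3"
  have "sl2sl2_components dpi_left (transposed ` U_right_deg (- int k - 1)) (l, l + 1/2) (l, l - 1/2) (l - 1, l - 1/2)
      (transposed ` M1) (transposed ` M2) (transposed ` M3)"
  proof (rule components_transp[OF R])
    fix A D f assume AD: "A \<in> sl2" "D \<in> sl2" and f: "f \<in> U_right_deg (- int k - 1)"
    then have "transposed f \<in> ?U"
      unfolding UR by auto
    then have "transposed f \<in> laurent_fields"
      using U_left_deg_laurent by blast
    then have "dpi_right (block_diag (dual D) (dual A)) (transposed (transposed f))
        = transposed (dpi_left (block_diag (dual (dual A)) (dual (dual D))) (transposed f))"
      by (rule dpi_right_transp) (simp_all add: AD)
    then show "dpi_left (block_diag A D) (transposed f) = transposed (dpi_right (block_diag (dual D) (dual A)) f)"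
      by simp
  qed
  then have "?L (transposed ` M1) (transposed ` M2) (transposed ` M3)"
    by (simp only: UR tt)
  then have "transposed ` M1 = cspan (basis1 k) \<and> transposed ` M2 = cspan (basis2 k) \<and> transposed ` M3 = cspan (basis3 k)"
    unfolding l_def left_components .
  then show ?rhs
    by (metis tt)
qed

theorem proposition31:
  fixes k :: nat and l :: real
  assumes "l = real k / 2"
  shows
    "(\<forall>M1 M2 M3.
        sl2sl2_components dpi_left (U_left_deg (- int k - 1))
          (l, l + 1/2) (l, l - 1/2) (l - 1, l - 1/2) M1 M2 M3 \<longleftrightarrow>
        M1 = cspan {ft1 l m n | m n. m \<in> steps (- l - 1/2) (l + 1/2) \<and> n \<in> steps (- l) l} \<and>
        M2 = cspan {ft2 l m n | m n. m \<in> steps (- l + 1/2) (l - 1/2) \<and> n \<in> steps (- l) l} \<and>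
        M3 = cspan {ft3 l m n | m n. m \<in> steps (- l + 1/2) (l - 1/2) \<and> n \<in> steps (- l + 1) (l - 1)})
     \<and>
     (\<forall>M1 M2 M3.
        sl2sl2_components dpi_right (U_right_deg (- int k - 1))
          (l + 1/2, l) (l - 1/2, l) (l - 1/2, l - 1) M1 M2 M3 \<longleftrightarrow>
        M1 = cspan {gt1 l m n | m n. m \<in> steps (- l) l \<and> n \<in> steps (- l - 1/2) (l + 1/2)} \<and>
        M2 = cspan {gt2 l m n | m n. m \<in> steps (- l) l \<and> n \<in> steps (- l + 1/2) (l - 1/2)} \<and>
        M3 = cspan {gt3 l m n | m n. m \<in> steps (- l + 1) (l - 1) \<and> n \<in> steps (- l + 1/2) (l - 1/2)})"
  unfolding ft1_basis1[OF assms] ft2_basis2[OF assms] ft3_basis3[OF assms]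
    gt1_span[OF assms] gt2_span[OF assms] gt3_span[OF assms]
  using left_components[of k] right_components[of k] by (simp only: assms) blast

end
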